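(* Let $X$ be an infinite-dimensional complex Banach space and $T\in L(X)$. (a) Let $\mathbf R$ be one of $\mathcal B_+$, $\mathcal B_-$, $\mathcal B$, $\Phi_+$, $\Phi_-$, $\Phi$, $\mathcal W_+$, $\mathcal W_-$, $\mathcal W$. If $\partial\sigma_{\mathbf R}(T)\subset\operatorname{acc}\sigma_{\mathbf R}(T)$, then $$\partial\sigma_{\mathbf R}(T)\subset\sigma_{gKR}(T)\subset\sigma_{gK}(T)\subset\sigma_{Kt}(T)\subset\sigma_{eK}(T)\subset\sigma_{\mathbf R}(T),$$ $$\partial\sigma_{\mathbf R}(T)\subset\sigma_{gKR}(T)\subset\sigma_{gK}(T)\subset\sigma_{\mathbf{gDR}\mathbf R}(T)\subset\sigma_{\mathbf R}(T),$$ and $\eta\sigma_{\mathbf R}(T)=\eta\sigma_{gKR}(T)=\eta\sigma_{gK}(T)=\eta\sigma_{Kt}(T)=\eta\sigma_{eK}(T)=\eta\sigma_{\mathbf{gDR}\mathbf R}(T)$. (b) Let $(\mathbf R,\mathbf R')$ be one of the pairs $(\mathcal M,\mathcal B_+)$, $(\mathcal Q,\mathcal B_-)$, $(L(X)^{-1},\mathcal B)$. If $\partial\sigma_{\mathbf R}(T)\subset\operatorname{acc}\sigma_{\mathbf R'}(T)$, then $$\partial\sigma_{\mathbf R}(T)\subset\sigma_{gKR}(T)\subset\sigma_{gK}(T)\subset\sigma_{Kt}(T)\subset\sigma_{eK}(T)\subset\sigma_K(T)\subset\sigma_{\mathbf R}(T)$$ and $\eta\sigma_{\mathbf R}(T)=\eta\sigma_{gKR}(T)=\eta\sigma_{gK}(T)=\eta\sigma_{Kt}(T)=\eta\sigma_{eK}(T)=\eta\sigma_K(T)=\eta\sigma_{\mathbf{gDR}\mathbf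 R}(T)$.
   Context: $S$ is Kato if $R(S)$ is closed and $N(S)\subset R(S^n)$ for all $n$; $S$ is Riesz if $S-\lambda$ is Fredholm for all $\lambda\ne0$. For an operator $S$ and closed $S$-invariant $M,N$ with $X=M\oplus N$ and $S_M$ Kato: if $S_N$ is Riesz, $S$ admits a GKRD; if $S_N$ is quasinilpotent, a GKD; if $S_N$ is nilpotent, $S$ is of Kato type; if $N$ is finite-dimensional and $S_N$ nilpotent, $S$ is essentially Kato. $\sigma_{gKR}$, $\sigma_{gK}$, $\sigma_{Kt}$, $\sigma_{eK}$, $\sigma_K$: sets of $\lambda$ with $T-\lambda$ not admitting a GKRD, not admitting a GKD, not of Kato type, not essentially Kato, not Kato. Classes: $\mathcal M$ bounded below; $\mathcal Q$ surjective; $L(X)^{-1}$ invertible; $\Phi_+$: finite-dimensional kernel and closed range; $\Phi_-$: finite-codimensional range; $\Phi=\Phi_+\cap\Phi_-$; $\mathcal W_+,\mathcal W_-,\mathcal W$: in $\Phi_+,\Phi_-,\Phi$ with index $\le0,\ge0,=0$; $\mathcal B_+$: $\Phi_+$ with finite ascent; $\mathcal B_-$: $\Phi_-$ with finite descent; $\mathcal B$: Fredholm with finite ascent and descent. $\sigma_{\mathbf R}(T)=\{\lambda:T-\lambda\notin\mathbf R\}$; $\sigma_{\mathbf{gDR}\mathbf R}(T)$ is the set of $\lambda$ for which there are no closed $(T-\lambda)$-invariant $M,N$ with $X=M\oplus N$, $(T-\lambda)_M\in\mathbf R$, $(T-\lambda)_N$ Riesz. For compact $K\subset\mathbb C$,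 $\eta K$ is the complement of the unbounded component of $\mathbb C\setminus K$; $\partial$, $\operatorname{acc}$: boundary, accumulation points. *)

theory Defs
  imports "HOL-Analysis.Analysis"
begin

class complex_banach = banach +
  fixes scaleC :: "complex \<Rightarrow> 'a \<Rightarrow> 'a" (infixr "*\<^sub>C" 75)
  assumes scaleC_add_right: "scaleC a (x + y) = scaleC a x + scaleC a y"
    and scaleC_add_left: "scaleC (a + b) x = scaleC a x + scaleC b x"
    and scaleC_scaleC: "scaleC a (scaleC b x) = scaleC (a * b) x"
    and scaleC_one: "scaleC 1 x = x"
    and scaleC_of_real: "scaleC (of_real r) x = r *\<^sub>R x"
    and norm_scaleC: "norm (scaleC a x) = cmod a * norm x"

instantiation complex :: complex_banach
begin
definition scaleC_complex :: "complex \<Rightarrow> complex \<Rightarrow> complex" where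
  "scaleC_complex a x = a * x"
instance
  by standard (auto simp: scaleC_complex_def algebra_simps norm_mult scaleR_conv_of_real)
end

definition csubspace :: "'a::complex_banach set \<Rightarrow> bool" where
  "csubspace V \<longleftrightarrow> 0 \<in> V \<and> (\<forall>x\<in>V. \<forall>y\<in>V. x + y \<in> V) \<and> (\<forall>c. \<forall>x\<in>V. c *\<^sub>C x \<in> V)"

definition cspan :: "'a::complex_banach set \<Rightarrow> 'a set" where
  "cspan S = {\<Sum>x\<in>F. c x *\<^sub>C x | F c. finite F \<and> F \<subseteq> S}"

definition setsum :: "'a::complex_banach set \<Rightarrow> 'a set \<Rightarrow> 'a set" where
  "setsum A B = {a + b | a b. a \<in> A \<and> b \<in> B}"

definition fin_cdim :: "'a::complex_banach set \<Rightarrow> bool" where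
  "fin_cdim V \<longleftrightarrow> (\<exists>B. finite B \<and> B \<subseteq> V \<and> V \<subseteq> cspan B)"

definition cdim :: "'a::complex_banach set \<Rightarrow> nat" where
  "cdim V = (LEAST n. \<exists>B. finite B \<and> card B = n \<and> B \<subseteq> V \<and> V \<subseteq> cspan B)"

definition fin_codim :: "'a::complex_banach set \<Rightarrow> 'a set \<Rightarrow> bool" where
  "fin_codim M R \<longleftrightarrow> (\<exists>B. finite B \<and> B \<subseteq> M \<and> M \<subseteq> setsum R (cspan B))"

definition codim :: "'a::complex_banach set \<Rightarrow> 'a set \<Rightarrow> nat" where
  "codim M R = (LEAST n. \<exists>B. finite B \<and> card B = n \<and> B \<subseteq> M \<and> M \<subseteq> setsum R (cspan B))"

definition bounded_clinear :: "('a::complex_banach \<Rightarrow> 'a) \<Rightarrow> bool" where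
  "bounded_clinear S \<longleftrightarrow> bounded_linear S \<and> (\<forall>c x. S (c *\<^sub>C x) = c *\<^sub>C S x)"

definition bounded_clinear_on :: "'a::complex_banach set \<Rightarrow> ('a \<Rightarrow> 'a) \<Rightarrow> bool" where
  "bounded_clinear_on M G \<longleftrightarrow> (\<forall>x\<in>M. \<forall>y\<in>M. G (x + y) = G x + G y)
     \<and> (\<forall>c. \<forall>x\<in>M. G (c *\<^sub>C x) = c *\<^sub>C G x) \<and> (\<exists>K. \<forall>x\<in>M. norm (G x) \<le> K * norm x)"

definition closed_inv :: "('a::complex_banach \<Rightarrow> 'a) \<Rightarrow> 'a set \<Rightarrow> bool" where
  "closed_inv S M \<longleftrightarrow> csubspace M \<and> closed M \<and> S ` M \<subseteq> M"

definition inv_decomp :: "('a::complex_banach \<Rightarrow> 'a) \<Rightarrow> 'a set \<Rightarrow> 'a set \<Rightarrow> bool" where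
  "inv_decomp S M N \<longleftrightarrow> closed_inv S M \<and> closed_inv S N \<and> M \<inter> N = {0} \<and> setsum M N = UNIV"

definition shiftop :: "('a::complex_banach \<Rightarrow> 'a) \<Rightarrow> complex \<Rightarrow> 'a \<Rightarrow> 'a" where
  "shiftop T l = (\<lambda>x. T x - l *\<^sub>C x)"

definition kerOn :: "'a::complex_banach set \<Rightarrow> ('a \<Rightarrow> 'a) \<Rightarrow> 'a set" where
  "kerOn M S = {x \<in> M. S x = 0}"

definition opnorm_on :: "'a::complex_banach set \<Rightarrow> ('a \<Rightarrow> 'a) \<Rightarrow> real" where
  "opnorm_on M S = Sup {norm (S x) | x. x \<in> M \<and> norm x \<le> 1}"

definition Kato_on :: "'a::complex_banach set \<Rightarrow> ('a \<Rightarrow> 'a) \<Rightarrow> bool" where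
  "Kato_on M S \<longleftrightarrow> closed (S ` M) \<and> (\<forall>n. kerOn M S \<subseteq> (S ^^ n) ` M)"

definition upper_semi_Fredholm_on :: "'a::complex_banach set \<Rightarrow> ('a \<Rightarrow> 'a) \<Rightarrow> bool" where
  "upper_semi_Fredholm_on M S \<longleftrightarrow> fin_cdim (kerOn M S) \<and> closed (S ` M)"

definition lower_semi_Fredholm_on :: "'a::complex_banach set \<Rightarrow> ('a \<Rightarrow> 'a) \<Rightarrow> bool" where
  "lower_semi_Fredholm_on M S \<longleftrightarrow> fin_codim M (S ` M)"

definition Fredholm_on :: "'a::complex_banach set \<Rightarrow> ('a \<Rightarrow> 'a) \<Rightarrow> bool" where
  "Fredholm_on M S \<longleftrightarrow> upper_semi_Fredholm_on M S \<and> lower_semi_Fredholm_on M S"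

definition finite_ascent_on :: "'a::complex_banach set \<Rightarrow> ('a \<Rightarrow> 'a) \<Rightarrow> bool" where
  "finite_ascent_on M S \<longleftrightarrow> (\<exists>p. kerOn M (S ^^ p) = kerOn M (S ^^ Suc p))"

definition finite_descent_on :: "'a::complex_banach set \<Rightarrow> ('a \<Rightarrow> 'a) \<Rightarrow> bool" where
  "finite_descent_on M S \<longleftrightarrow> (\<exists>q. (S ^^ q) ` M = (S ^^ Suc q) ` M)"

text \<open>index \<le> 0 (index is -\<infinity> when the range has infinite codimension)\<close>
definition index_nonpos_on :: "'a::complex_banach set \<Rightarrow> ('a \<Rightarrow> 'a) \<Rightarrow> bool" where
  "index_nonpos_on M S \<longleftrightarrow> (fin_codim M (S ` M) \<longrightarrow> cdim (kerOn M S) \<le> codim M (S ` M))"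

text \<open>index \<ge> 0 (index is +\<infinity> when the kernel is infinite-dimensional)\<close>
definition index_nonneg_on :: "'a::complex_banach set \<Rightarrow> ('a \<Rightarrow> 'a) \<Rightarrow> bool" where
  "index_nonneg_on M S \<longleftrightarrow> (fin_cdim (kerOn M S) \<longrightarrow> codim M (S ` M) \<le> cdim (kerOn M S))"

definition Riesz_on :: "'a::complex_banach set \<Rightarrow> ('a \<Rightarrow> 'a) \<Rightarrow> bool" where
  "Riesz_on N S \<longleftrightarrow> (\<forall>l. l \<noteq> 0 \<longrightarrow> Fredholm_on N (shiftop S l))"

definition quasinilpotent_on :: "'a::complex_banach set \<Rightarrow> ('a \<Rightarrow> 'a) \<Rightarrow> bool" where
  "quasinilpotent_on N S \<longleftrightarrow> (\<lambda>n. opnorm_on N (S ^^ n) powr (1 / real n)) \<longlonglongrightarrow> 0"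

definition nilpotent_on :: "'a::complex_banach set \<Rightarrow> ('a \<Rightarrow> 'a) \<Rightarrow> bool" where
  "nilpotent_on N S \<longleftrightarrow> (\<exists>n. \<forall>x\<in>N. (S ^^ n) x = 0)"

datatype opclass = BoundedBelow | Surjective | Invertible
  | PhiPlus | PhiMinus | Phi | WPlus | WMinus | W | BPlus | BMinus | B

fun in_class_on :: "opclass \<Rightarrow> 'a::complex_banach set \<Rightarrow> ('a \<Rightarrow> 'a) \<Rightarrow> bool" where
  "in_class_on BoundedBelow M S = (\<exists>c>0. \<forall>x\<in>M. c * norm x \<le> norm (S x))"
| "in_class_on Surjective M S = (S ` M = M)"
| "in_class_on Invertible M S = (\<exists>G. bounded_clinear_on M G \<and> G ` M \<subseteq> M \<and>
      (\<forall>x\<in>M. G (S x) = x \<and> S (G x) = x))"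
| "in_class_on PhiPlus M S = upper_semi_Fredholm_on M S"
| "in_class_on PhiMinus M S = lower_semi_Fredholm_on M S"
| "in_class_on Phi M S = Fredholm_on M S"
| "in_class_on WPlus M S = (upper_semi_Fredholm_on M S \<and> index_nonpos_on M S)"
| "in_class_on WMinus M S = (lower_semi_Fredholm_on M S \<and> index_nonneg_on M S)"
| "in_class_on W M S = (Fredholm_on M S \<and> index_nonpos_on M S \<and> index_nonneg_on M S)"
| "in_class_on BPlus M S = (upper_semi_Fredholm_on M S \<and> finite_ascent_on M S)"
| "in_class_on BMinus M S = (lower_semi_Fredholm_on M S \<and> finite_descent_on M S)"
| "in_class_on B M S = (Fredholm_on M S \<and> finite_ascent_on M S \<and> finite_descent_on M S)"

definition has_GKRD :: "('a::complex_banach \<Rightarrow> 'a) \<Rightarrow> bool" where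
  "has_GKRD S \<longleftrightarrow> (\<exists>M N. inv_decomp S M N \<and> Kato_on M S \<and> Riesz_on N S)"

definition has_GKD :: "('a::complex_banach \<Rightarrow> 'a) \<Rightarrow> bool" where
  "has_GKD S \<longleftrightarrow> (\<exists>M N. inv_decomp S M N \<and> Kato_on M S \<and> quasinilpotent_on N S)"

definition Kato_type :: "('a::complex_banach \<Rightarrow> 'a) \<Rightarrow> bool" where
  "Kato_type S \<longleftrightarrow> (\<exists>M N. inv_decomp S M N \<and> Kato_on M S \<and> nilpotent_on N S)"

definition essentially_Kato :: "('a::complex_banach \<Rightarrow> 'a) \<Rightarrow> bool" where
  "essentially_Kato S \<longleftrightarrow> (\<exists>M N. inv_decomp S M N \<and> Kato_on M S \<and> fin_cdim N \<and> nilpotent_on N S)"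

definition gDR :: "opclass \<Rightarrow> ('a::complex_banach \<Rightarrow> 'a) \<Rightarrow> bool" where
  "gDR R S \<longleftrightarrow> (\<exists>M N. inv_decomp S M N \<and> in_class_on R M S \<and> Riesz_on N S)"

definition sigma_cls :: "opclass \<Rightarrow> ('a::complex_banach \<Rightarrow> 'a) \<Rightarrow> complex set" where
  "sigma_cls R T = {l. \<not> in_class_on R UNIV (shiftop T l)}"

definition sigma_gKR :: "('a::complex_banach \<Rightarrow> 'a) \<Rightarrow> complex set" where
  "sigma_gKR T = {l. \<not> has_GKRD (shiftop T l)}"

definition sigma_gK :: "('a::complex_banach \<Rightarrow> 'a) \<Rightarrow> complex set" where
  "sigma_gK T = {l. \<not> has_GKD (shiftop T l)}"

definition sigma_Kt :: "('a::complex_banach \<Rightarrow> 'a) \<Rightarrow> complex set" where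
  "sigma_Kt T = {l. \<not> Kato_type (shiftop T l)}"

definition sigma_eK :: "('a::complex_banach \<Rightarrow> 'a) \<Rightarrow> complex set" where
  "sigma_eK T = {l. \<not> essentially_Kato (shiftop T l)}"

definition sigma_K :: "('a::complex_banach \<Rightarrow> 'a) \<Rightarrow> complex set" where
  "sigma_K T = {l. \<not> Kato_on UNIV (shiftop T l)}"

definition sigma_gDR :: "opclass \<Rightarrow> ('a::complex_banach \<Rightarrow> 'a) \<Rightarrow> complex set" where
  "sigma_gDR R T = {l. \<not> gDR R (shiftop T l)}"

definition acc :: "complex set \<Rightarrow> complex set" where
  "acc K = {z. z islimpt K}"

definition eta :: "complex set \<Rightarrow> complex set" where
  "eta K = - \<Union> {C. C \<in> components (- K) \<and> \<not> bounded C}"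

end

theory Submission
  imports Defs
begin

text \<open>
  Near a Kato operator \<open>K\<close> all \<open>K - l\<close> are Kato with the same nullity and deficiency: \<open>K\<close> maps
  \<open>R\<^sup>\<infinity> = (\<Inter>n. range K\<^sup>n)\<close> onto itself, hence so does \<open>K - l\<close> for small \<open>l\<close>, which moves vectors of the
  kernel of \<open>K\<close> into that of \<open>K - l\<close> and yields a uniform lower bound modulo the kernel. A Kato
  operator lies in one of the classes according to its nullity and deficiency alone, so membership is
  constant near \<open>K\<close>. A Riesz summand \<open>S\<^sub>N - l\<close> with \<open>l \<noteq> 0\<close> is Browder and does not affect
  membership in the nine classes of part (a). Therefore, if \<open>T - l\<close> admits a GKRD and \<open>l\<close> is a limit
  of points outside \<open>\<sigma>\<^sub>R(T)\<close>, a whole punctured neighbourhood of \<open>l\<close> lies outside the spectrum for the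
  second class of the pair, and \<open>l\<close> is not an accumulation point of it. The remaining inclusions rest
  on Kato's decomposition of semi-Fredholm operators, and the equality of the hulls follows from
  \<open>\<partial>\<sigma>\<^sub>R \<subseteq> H \<subseteq> \<sigma>\<^sub>R\<close>.
\<close>

subsection \<open>Linear algebra\<close>

text \<open>Restrictions of an operator live on closed subspaces of one fixed space, so every notion
  is taken relative to a set \<open>M\<close>, and deficiencies are measured by algebraic
  complements rather than by quotients or adjoints; nullity and deficiency therefore get separate
  stability proofs that are not duals of each other. In infinite dimension \<open>cdim\<close> and
  \<open>codim\<close> are least elements of an empty set of numbers, so the work is done with the
  bounds \<open>cdim_le V n\<close> and \<open>ccodim_le M R n\<close>: knowing them for every
  \<open>n\<close> settles finiteness, dimension and the index conditions at once. The analysis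
  rests on one successive approximation lemma, \<open>approximate_surjectivity\<close>, which lies
  behind the open mapping theorem, the closedness of ranges and the main perturbation estimates. The
  second class of a pair is forced in part (b): bounded below, surjective and invertible pass from
  the space to a summand, but come back only in Browder form, since a nonzero shift of the Riesz
  summand may still have a finite-dimensional kernel and defect.\<close>

interpretation cvs: vector_space "scaleC :: complex \<Rightarrow> 'a::complex_banach \<Rightarrow> 'a"
  by standard (simp_all add: scaleC_add_right scaleC_add_left scaleC_scaleC scaleC_one)

lemma csubspace_iff: "csubspace = cvs.subspace"
  by (auto simp: fun_eq_iff csubspace_def cvs.subspace_def)

lemma cspan_eq: "cspan = cvs.span"
  by (auto simp: fun_eq_iff cspan_def cvs.span_explicit)

lemma csubspace_cspan [simp]: "csubspace (cspan E)"
  by (simp add: csubspace_iff cspan_eq)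

lemma cspan_minimal: "E \<subseteq> V \<Longrightarrow> csubspace V \<Longrightarrow> cspan E \<subseteq> V"
  by (simp add: csubspace_iff cspan_eq cvs.span_minimal)

lemma cspan_superset: "E \<subseteq> cspan E"
  by (simp add: cspan_eq cvs.span_superset)

lemma csubspace_0: "csubspace V \<Longrightarrow> 0 \<in> V"
  and csubspace_add: "csubspace V \<Longrightarrow> x \<in> V \<Longrightarrow> y \<in> V \<Longrightarrow> x + y \<in> V"
  and csubspace_scale: "csubspace V \<Longrightarrow> x \<in> V \<Longrightarrow> c *\<^sub>C x \<in> V"
  by (simp_all add: csubspace_def)

lemma csubspace_diff: "csubspace V \<Longrightarrow> x \<in> V \<Longrightarrow> y \<in> V \<Longrightarrow> x - y \<in> V"
  and csubspace_neg: "csubspace V \<Longrightarrow> x \<in> V \<Longrightarrow> - x \<in> V"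
  by (simp_all add: csubspace_iff cvs.subspace_diff cvs.subspace_neg)

lemma csubspace_UNIV [simp]: "csubspace UNIV"
  and csubspace_trivial [simp]: "csubspace {0}"
  by (simp_all add: csubspace_iff)

lemma csubspace_imp_subspace: "csubspace V \<Longrightarrow> subspace V"
  unfolding csubspace_def subspace_def by (metis scaleC_of_real)

lemma scaleC_real_commute: "c *\<^sub>C (r *\<^sub>R x) = r *\<^sub>R (c *\<^sub>C x)" for x :: "'a::complex_banach"
  by (metis scaleC_of_real scaleC_scaleC mult.commute)

lemma setsumI: "a \<in> A \<Longrightarrow> b \<in> E \<Longrightarrow> a + b \<in> setsum A E"
  by (auto simp: setsum_def)

lemma csubspace_setsum: "csubspace A \<Longrightarrow> csubspace E \<Longrightarrow> csubspace (setsum A E)"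
  using cvs.subspace_sums[of A E] by (simp add: csubspace_iff setsum_def)

lemma setsum_superset: "csubspace A \<Longrightarrow> csubspace E \<Longrightarrow> A \<subseteq> setsum A E \<and> E \<subseteq> setsum A E"
proof (intro conjI subsetI)
  assume *: "csubspace A" "csubspace E"
  show "x \<in> setsum A E" if "x \<in> A" for x using setsumI[OF that csubspace_0[OF *(2)]] by simp
  show "x \<in> setsum A E" if "x \<in> E" for x using setsumI[OF csubspace_0[OF *(1)] that] by simp
qed

lemma setsum_minimal: "A \<subseteq> V \<Longrightarrow> E \<subseteq> V \<Longrightarrow> csubspace V \<Longrightarrow> setsum A E \<subseteq> V"
  unfolding setsum_def csubspace_def by auto

lemma setsum_mono: "A \<subseteq> A' \<Longrightarrow> E \<subseteq> E' \<Longrightarrow> setsum A E \<subseteq> setsum A' E'"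
  unfolding setsum_def by blast

lemma setsum_commute: "setsum A E = setsum E A"
  unfolding setsum_def by (auto; metis add.commute)

lemma setsum_0 [simp]: "setsum {0} A = A" "setsum A {0} = A"
  by (auto simp: setsum_def)

lemma cspan_Un: "cspan (A \<union> E) = setsum (cspan A) (cspan E)"
  by (simp add: setsum_def cspan_eq cvs.span_Un)

section \<open>Bounds on dimension and codimension\<close>

definition cdim_le :: "'a::complex_banach set \<Rightarrow> nat \<Rightarrow> bool" where
  "cdim_le V n \<longleftrightarrow> (\<exists>E. finite E \<and> card E \<le> n \<and> V \<subseteq> cspan E)"

definition ccodim_le :: "'a::complex_banach set \<Rightarrow> 'a set \<Rightarrow> nat \<Rightarrow> bool" where
  "ccodim_le M R n \<longleftrightarrow> (\<exists>E. finite E \<and> card E \<le> n \<and> E \<subseteq> M \<and> M \<subseteq> setsum R (cspan E))"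

lemma cdim_le_basis:
  assumes "cdim_le V n"
  obtains E where "finite E" "card E \<le> n" "E \<subseteq> V" "cvs.independent E" "V \<subseteq> cspan E"
proof -
  obtain C where C: "finite C" "card C \<le> n" "V \<subseteq> cspan C" using assms by (auto simp: cdim_le_def)
  obtain E where E: "E \<subseteq> V" "cvs.independent E" "V \<subseteq> cvs.span E"
    using cvs.maximal_independent_subset by blast
  have "finite E \<and> card E \<le> card C"
    by (rule cvs.independent_span_bound) (use E C in \<open>auto simp: cspan_eq\<close>)
  with E C that show thesis by (auto simp: cspan_eq)
qed

lemma cdim_le_independent:
  assumes "cdim_le V n" "I \<subseteq> V" "cvs.independent I"
  shows "finite I \<and> card I \<le> n"
proof -
  obtain C where C: "finite C" "card C \<le> n" "V \<subseteq> cspan C" using assms by (auto simp: cdim_le_def)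
  then show ?thesis
    using cvs.independent_span_bound[of C I] assms(2,3) by (force simp: cspan_eq)
qed

lemma cdim_leI:
  assumes "\<And>I. finite I \<Longrightarrow> I \<subseteq> V \<Longrightarrow> cvs.independent I \<Longrightarrow> card I \<le> n"
  shows "cdim_le V n"
proof -
  obtain E where E: "E \<subseteq> V" "cvs.independent E" "V \<subseteq> cvs.span E"
    using cvs.maximal_independent_subset by blast
  have "finite E"
  proof (rule ccontr)
    assume "infinite E"
    then obtain I where "I \<subseteq> E" "finite I" "card I = Suc n"
      using infinite_arbitrarily_large by blast
    with assms[of I] E cvs.independent_mono show False by force
  qed
  with E assms[of E] show ?thesis by (auto simp: cdim_le_def cspan_eq)
qed

lemma not_cdim_le:
  assumes "\<not> cdim_le V n"
  obtains I where "finite I" "card I = Suc n" "I \<subseteq> V" "cvs.independent I"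
proof -
  obtain I where I: "finite I" "I \<subseteq> V" "cvs.independent I" "card I \<ge> Suc n"
    using assms cdim_leI by (metis not_less_eq_eq)
  then obtain J where "J \<subseteq> I" "card J = Suc n" by (meson obtain_subset_with_card_n)
  with I show thesis using that[of J] cvs.independent_mono finite_subset by blast
qed

lemma cdim_le_mono: "cdim_le V n \<Longrightarrow> U \<subseteq> V \<Longrightarrow> n \<le> m \<Longrightarrow> cdim_le U m"
  unfolding cdim_le_def by (meson order_trans)

lemma cdim_le_0: "csubspace V \<Longrightarrow> cdim_le V 0 \<longleftrightarrow> V = {0}"
  by (auto simp: cdim_le_def cspan_eq csubspace_def)

lemma fin_cdim_iff: "fin_cdim V \<longleftrightarrow> (\<exists>n. cdim_le V n)"
proof
  show "fin_cdim V \<Longrightarrow> \<exists>n. cdim_le V n" by (auto simp: fin_cdim_def cdim_le_def)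
  show "\<exists>n. cdim_le V n \<Longrightarrow> fin_cdim V" by (meson cdim_le_basis fin_cdim_def)
qed

text \<open>Reconciles spanning sets of exact size, as in \<open>cdim\<close> and
  \<open>codim\<close>, with those of size at most \<open>n\<close>. The equation also covers the
  infinite case: both predicates are then identically false, hence have the same unspecified least
  value.\<close>

lemma Least_card_eq:
  assumes Q: "\<And>n. Q n \<longleftrightarrow> (\<exists>E. finite E \<and> card E \<le> n \<and> P E)"
  shows "(LEAST n. \<exists>E. finite E \<and> card E = n \<and> P E) = (LEAST n. Q n)"
proof (cases "\<exists>n. Q n")
  case True
  define m where "m = (LEAST n. Q n)"
  have "Q m" unfolding m_def using True LeastI_ex by metis
  then obtain E where E: "finite E" "card E \<le> m" "P E" using Q by blast
  then have "Q (card E)" using Q by blast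
  then have "card E = m" using E(2) unfolding m_def by (simp add: Least_le antisym)
  show ?thesis unfolding m_def[symmetric]
  proof (rule Least_equality)
    show "\<exists>E. finite E \<and> card E = m \<and> P E" using E \<open>card E = m\<close> by blast
    show "m \<le> n" if "\<exists>E. finite E \<and> card E = n \<and> P E" for n
      unfolding m_def by (rule Least_le) (use that Q in blast)
  qed
next
  case False
  then have "(\<lambda>n. \<exists>E. finite E \<and> card E = n \<and> P E) = Q"
    using Q by (intro ext) (metis order_refl)
  then show ?thesis by simp
qed

lemma cdim_eq_Least: "cdim V = (LEAST n. cdim_le V n)"
  unfolding cdim_def
proof (rule Least_card_eq)
  show "cdim_le V n \<longleftrightarrow> (\<exists>E. finite E \<and> card E \<le> n \<and> E \<subseteq> V \<and> V \<subseteq> cspan E)" for n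
    using cdim_le_basis[of V n] unfolding cdim_le_def by metis
qed

lemma cdim_le_iff: "cdim_le V n \<longleftrightarrow> fin_cdim V \<and> cdim V \<le> n"
proof
  assume "cdim_le V n"
  then show "fin_cdim V \<and> cdim V \<le> n" by (auto simp: fin_cdim_iff cdim_eq_Least intro: Least_le)
next
  assume *: "fin_cdim V \<and> cdim V \<le> n"
  then have "cdim_le V (cdim V)" unfolding cdim_eq_Least fin_cdim_iff by (metis LeastI_ex)
  with * show "cdim_le V n" using cdim_le_mono by blast
qed

lemma cdim_eq_dim: "fin_cdim V \<Longrightarrow> cdim V = cvs.dim V"
proof -
  assume "fin_cdim V"
  then have "cdim_le V (cdim V)" by (simp add: cdim_le_iff)
  then obtain E where E: "finite E" "card E \<le> cdim V" "E \<subseteq> V" "cvs.independent E" "V \<subseteq> cspan E"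
    by (rule cdim_le_basis)
  then have "cdim_le V (card E)" by (auto simp: cdim_le_def)
  then have "cdim V = card E" using E by (simp add: cdim_le_iff)
  then show ?thesis using cvs.basis_card_eq_dim[of E V] E by (simp add: cspan_eq)
qed

lemma fin_cdim_basis:
  assumes "fin_cdim V"
  obtains E where "finite E" "card E = cdim V" "E \<subseteq> V" "cvs.independent E" "V \<subseteq> cspan E"
proof -
  have "cdim_le V (cdim V)" using assms by (simp add: cdim_le_iff)
  then obtain E where E: "finite E" "card E \<le> cdim V" "E \<subseteq> V" "cvs.independent E" "V \<subseteq> cspan E"
    by (rule cdim_le_basis)
  then show thesis using that cvs.basis_card_eq_dim[of E V] cdim_eq_dim[OF assms]
    by (metis cspan_eq)
qed

lemma fin_cdim_subset: "fin_cdim V \<Longrightarrow> U \<subseteq> V \<Longrightarrow> fin_cdim U"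
  unfolding fin_cdim_iff using cdim_le_mono by blast

section \<open>Algebraic direct sums and complements\<close>

text \<open>Purely algebraic: closedness is demanded separately where boundedness of the projections
  matters, because complements of ranges are chosen without it.\<close>

definition direct_sum :: "'a::complex_banach set \<Rightarrow> 'a set \<Rightarrow> 'a set \<Rightarrow> bool" where
  "direct_sum M A E \<longleftrightarrow> csubspace A \<and> csubspace E \<and> A \<inter> E = {0} \<and> setsum A E = M"

lemma direct_sum_subspace: "direct_sum M A E \<Longrightarrow> csubspace M \<and> A \<subseteq> M \<and> E \<subseteq> M"
  unfolding direct_sum_def by (metis csubspace_setsum setsum_superset)

lemma direct_sum_commute: "direct_sum M A E \<Longrightarrow> direct_sum M E A"
  unfolding direct_sum_def by (auto simp: setsum_commute)

lemma direct_sum_trivial: "csubspace M \<Longrightarrow> direct_sum M M {0}"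
  by (auto simp: direct_sum_def csubspace_0)

lemma direct_sumE:
  assumes "direct_sum M A E" "x \<in> M"
  obtains a b where "a \<in> A" "b \<in> E" "x = a + b"
  using assms by (auto simp: direct_sum_def setsum_def)

lemma direct_sum_unique:
  assumes "direct_sum M A E" "a \<in> A" "a' \<in> A" "b \<in> E" "b' \<in> E" "a + b = a' + b'"
  shows "a = a'" "b = b'"
proof -
  have "a - a' = b' - b" using assms(6) by (simp add: algebra_simps)
  moreover have "a - a' \<in> A" "b' - b \<in> E"
    using assms by (auto simp: direct_sum_def csubspace_diff)
  ultimately have "a - a' \<in> A \<inter> E" by simp
  then have "a - a' = 0" using assms(1) unfolding direct_sum_def by blast
  then show "a = a'" "b = b'" using assms(6) by auto
qed

lemma direct_sum_assoc:
  assumes "direct_sum M A E" "direct_sum E C D"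
  shows "direct_sum M (setsum A C) D" "direct_sum (setsum A C) A C"
proof -
  have s: "csubspace A" "csubspace E" "csubspace C" "csubspace D" "C \<subseteq> E" "D \<subseteq> E"
    using assms direct_sum_subspace[OF assms(2)] by (auto simp: direct_sum_def)
  have "setsum (setsum A C) D = setsum A (setsum C D)"
  proof (intro equalityI subsetI)
    fix x assume "x \<in> setsum (setsum A C) D"
    then obtain a c d where "a \<in> A" "c \<in> C" "d \<in> D" "x = a + (c + d)"
      by (auto simp: setsum_def add.assoc)
    then show "x \<in> setsum A (setsum C D)" by (simp add: setsumI)
  next
    fix x assume "x \<in> setsum A (setsum C D)"
    then obtain a c d where "a \<in> A" "c \<in> C" "d \<in> D" "x = (a + c) + d"
      by (auto simp: setsum_def add.assoc)
    then show "x \<in> setsum (setsum A C) D" by (simp only: setsumI)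
  qed
  then have M: "setsum (setsum A C) D = M" using assms by (auto simp: direct_sum_def)
  have "x = 0" if "x \<in> setsum A C" "x \<in> D" for x
  proof -
    obtain a c where ac: "x = a + c" "a \<in> A" "c \<in> C" using \<open>x \<in> setsum A C\<close> by (auto simp: setsum_def)
    have "x \<in> E" "c \<in> E" using s ac that by auto
    then have "a \<in> E" using ac s csubspace_diff[of E x c] by simp
    then have "a = 0" using ac assms(1) by (auto simp: direct_sum_def)
    then have "x \<in> C \<inter> D" using ac that by auto
    then show "x = 0" using assms(2) by (auto simp: direct_sum_def)
  qed
  then have "setsum A C \<inter> D = {0}" using s csubspace_0 csubspace_setsum by blast
  then show "direct_sum M (setsum A C) D" using M s csubspace_setsum by (auto simp: direct_sum_def)
  have "A \<inter> C = {0}" using assms(1) s csubspace_0 by (auto simp: direct_sum_def)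
  then show "direct_sum (setsum A C) A C" using s by (auto simp: direct_sum_def)
qed

text \<open>A basis of \<open>R\<close> is extended to one of \<open>M\<close>, and the new vectors
  span the complement. It need not be closed, which is enough for counting dimensions.\<close>

lemma complement_exists:
  assumes "csubspace R" "csubspace M" "R \<subseteq> M"
  obtains C where "direct_sum M R C"
proof -
  obtain E where E: "E \<subseteq> R" "cvs.independent E" "R \<subseteq> cvs.span E"
    using cvs.maximal_independent_subset by blast
  obtain E' where E': "E \<subseteq> E'" "E' \<subseteq> M" "cvs.independent E'" "M \<subseteq> cvs.span E'"
    using cvs.maximal_independent_subset_extend[of E M] E assms by blast
  have R: "R = cspan E" and M: "M = cspan E'"
    using E E' cspan_minimal[OF E(1) assms(1)] cspan_minimal[OF E'(2) assms(2)] by (auto simp: cspan_eq)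
  \<comment> \<open>The representation of \<open>x\<close> over \<open>E'\<close> is supported both
    in \<open>E\<close> and in \<open>E' - E\<close>, hence nowhere.\<close>
  have "x = 0" if x: "x \<in> cvs.span E" "x \<in> cvs.span (E' - E)" for x
  proof -
    have i: "cvs.independent E'" by fact
    have "cvs.representation E' x = cvs.representation E x"
      by (rule cvs.representation_extend) (use E' x in auto)
    moreover have "cvs.representation E' x = cvs.representation (E' - E) x"
      by (rule cvs.representation_extend) (use E' x in auto)
    ultimately have "cvs.representation E' x b = 0" for b
      using cvs.representation_ne_zero by (metis DiffE)
    then have "(\<Sum>b | cvs.representation E' x b \<noteq> 0. cvs.representation E' x b *\<^sub>C b) = 0" by simp
    moreover have "x \<in> cvs.span E'" using x E' cvs.span_mono by blast
    ultimately show "x = 0" using cvs.sum_nonzero_representation_eq[OF i] by metis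
  qed
  moreover have "setsum (cspan E) (cspan (E' - E)) = cspan E'"
    using cspan_Un[of E "E' - E"] E' by (simp add: Un_absorb1)
  ultimately have "direct_sum M R (cspan (E' - E))"
    unfolding direct_sum_def R M using csubspace_0[OF csubspace_cspan] by (auto simp: cspan_eq csubspace_iff cvs.span_zero)
  then show thesis using that by blast
qed

text \<open>Vectors spanning \<open>M\<close> modulo \<open>R\<close> may be replaced by their
  components in \<open>C\<close>, and these span \<open>C\<close> because \<open>C\<close> meets
  \<open>R\<close> trivially. Codimension questions thus become dimension questions.\<close>

lemma ccodim_le_complement:
  assumes d: "direct_sum M R C"
  shows "ccodim_le M R n \<longleftrightarrow> cdim_le C n"
proof
  have s: "csubspace R" "csubspace C" "csubspace M" "R \<subseteq> M" "C \<subseteq> M"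
    using d direct_sum_subspace[OF d] by (auto simp: direct_sum_def)
  {
    assume "cdim_le C n"
    then obtain E where E: "finite E" "card E \<le> n" "E \<subseteq> C" "C \<subseteq> cspan E" by (rule cdim_le_basis)
    then have "M \<subseteq> setsum R (cspan E)" using d setsum_mono[of R R C "cspan E"] by (auto simp: direct_sum_def)
    then show "ccodim_le M R n" unfolding ccodim_le_def using E s by blast
  next
    assume "ccodim_le M R n"
    then obtain E where E: "finite E" "card E \<le> n" "E \<subseteq> M" "M \<subseteq> setsum R (cspan E)"
      by (auto simp: ccodim_le_def)
    have "\<exists>c\<in>C. b - c \<in> R" if "b \<in> E" for b
    proof -
      have bM: "b \<in> M" using E that by blast
      obtain r c where "r \<in> R" "c \<in> C" "b = r + c" by (rule direct_sumE[OF d bM])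
      then show ?thesis by (intro bexI[of _ c]) auto
    qed
    then obtain f where f: "\<And>b. b \<in> E \<Longrightarrow> f b \<in> C \<and> b - f b \<in> R" by metis
    have fC: "cspan (f ` E) \<subseteq> C" using f s cspan_minimal by blast
    have "b \<in> setsum R (cspan (f ` E))" if "b \<in> E" for b
      using setsumI[of "b - f b" R "f b" "cspan (f ` E)"] f[OF that] that cspan_superset[of "f ` E"] by auto
    then have "cspan E \<subseteq> setsum R (cspan (f ` E))"
      using cspan_minimal csubspace_setsum[OF s(1)] by (metis csubspace_cspan subsetI)
    then have M: "M \<subseteq> setsum R (cspan (f ` E))"
      using E(4) setsum_minimal[of R "setsum R (cspan (f ` E))" "cspan E"] csubspace_setsum[OF s(1)] setsum_superset[OF s(1)]
      by (meson csubspace_cspan order_trans)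
    have "C \<subseteq> cspan (f ` E)"
    proof
      fix c assume c: "c \<in> C"
      then obtain r v where rv: "c = r + v" "r \<in> R" "v \<in> cspan (f ` E)" using M s by (auto simp: setsum_def)
      have "c - v \<in> C" using c rv fC s csubspace_diff by blast
      then have "c - v = 0" using rv d by (auto simp: direct_sum_def)
      with rv show "c \<in> cspan (f ` E)" by simp
    qed
    moreover have "finite (f ` E)" "card (f ` E) \<le> n" using E card_image_le[of E f] by auto
    ultimately show "cdim_le C n" by (auto simp: cdim_le_def)
  }
qed

lemma fin_codim_iff: "fin_codim M R \<longleftrightarrow> (\<exists>n. ccodim_le M R n)"
  unfolding fin_codim_def ccodim_le_def by blast

lemma codim_eq_Least: "codim M R = (LEAST n. ccodim_le M R n)"
  unfolding codim_def by (rule Least_card_eq) (simp add: ccodim_le_def)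

lemma codim_complement:
  assumes "direct_sum M R C"
  shows "fin_codim M R \<longleftrightarrow> fin_cdim C" "codim M R = cdim C"
  using ccodim_le_complement[OF assms]
  by (simp_all add: fin_codim_iff fin_cdim_iff codim_eq_Least cdim_eq_Least)

lemma independent_Un_direct:
  assumes "csubspace A" "csubspace E" "A \<inter> E = {0}" "I \<subseteq> A" "J \<subseteq> E" "finite J"
    and I: "cvs.independent I" and "cvs.independent J"
  shows "cvs.independent (I \<union> J)"
  using \<open>finite J\<close> \<open>J \<subseteq> E\<close> \<open>cvs.independent J\<close>
proof (induction J)
  case empty
  then show ?case using I by simp
next
  case (insert b J)
  have J: "cvs.independent (I \<union> J)" "b \<notin> cvs.span J"
    using insert cvs.independent_mono[of "insert b J" J] cvs.independent_insert[of b J] by auto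
  have "b \<notin> cvs.span (I \<union> J)"
  proof
    assume "b \<in> cvs.span (I \<union> J)"
    then obtain x y where xy: "b = x + y" "x \<in> cspan I" "y \<in> cspan J"
      using cspan_Un[of I J] by (auto simp: cspan_eq setsum_def)
    have "x \<in> A" "y \<in> E" using xy cspan_minimal assms insert by (metis subsetD insert_subset)+
    moreover have "x = b - y" using xy by simp
    ultimately have "x \<in> A \<inter> E" using csubspace_diff[of E b y] assms(2) insert(4) by blast
    then have "x = 0" unfolding assms(3) by simp
    then show False using xy J by (simp add: cspan_eq)
  qed
  then show ?case using J cvs.independent_insertI by simp
qed

lemma cdim_direct_sum:
  assumes d: "direct_sum M A E"
  shows "fin_cdim M \<longleftrightarrow> fin_cdim A \<and> fin_cdim E"
    and "fin_cdim A \<Longrightarrow> fin_cdim E \<Longrightarrow> cdim M = cdim A + cdim E"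
proof -
  have *: "fin_cdim M \<and> cdim M = cdim A + cdim E" if "fin_cdim A" "fin_cdim E"
  proof -
    obtain I where I: "finite I" "card I = cdim A" "I \<subseteq> A" "cvs.independent I" "A \<subseteq> cspan I"
      using fin_cdim_basis \<open>fin_cdim A\<close> by blast
    obtain J where J: "finite J" "card J = cdim E" "J \<subseteq> E" "cvs.independent J" "E \<subseteq> cspan J"
      using fin_cdim_basis \<open>fin_cdim E\<close> by blast
    have ind: "cvs.independent (I \<union> J)"
      by (rule independent_Un_direct[of A E]) (use I J d in \<open>auto simp: direct_sum_def\<close>)
    have sp: "M \<subseteq> cspan (I \<union> J)"
      using d setsum_mono[OF I(5) J(5)] by (simp add: cspan_Un direct_sum_def)
    have sub: "I \<union> J \<subseteq> M" using I J direct_sum_subspace[OF d] by auto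
    have "I \<inter> J \<subseteq> {0}" using I J d by (auto simp: direct_sum_def)
    then have "I \<inter> J = {}" using I(4) cvs.dependent_zero by blast
    then have c: "card (I \<union> J) = cdim A + cdim E" using I J by (simp add: card_Un_disjoint)
    have f: "fin_cdim M" using sp sub I J unfolding fin_cdim_def by (intro exI[of _ "I \<union> J"]) auto
    then show ?thesis using cvs.basis_card_eq_dim[OF sub _ ind] sp c cdim_eq_dim[OF f] by (simp add: cspan_eq)
  qed
  then show "fin_cdim M \<longleftrightarrow> fin_cdim A \<and> fin_cdim E"
    using fin_cdim_subset direct_sum_subspace[OF d] by blast
  show "fin_cdim A \<Longrightarrow> fin_cdim E \<Longrightarrow> cdim M = cdim A + cdim E" using * by blast
qed

text \<open>Adding to \<open>G\<close> a complement of \<open>R + G\<close> gives a complement of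
  \<open>R\<close>, whose dimension is bounded by the codimension.\<close>

lemma cdim_le_of_ccodim_le:
  assumes "csubspace M" "csubspace R" "csubspace G" "R \<subseteq> M" "G \<subseteq> M" "G \<inter> R = {0}" "ccodim_le M R n"
  shows "cdim_le G n"
proof -
  have s: "csubspace (setsum R G)" "setsum R G \<subseteq> M"
    using assms(2,3) csubspace_setsum setsum_minimal[OF assms(4,5,1)] by auto
  obtain C where C: "direct_sum M (setsum R G) C" using complement_exists[OF s(1) assms(1) s(2)] .
  have "direct_sum (setsum R G) G R"
    using assms by (auto simp: direct_sum_def setsum_commute)
  from direct_sum_assoc(1)[OF direct_sum_commute[OF C] this]
  have d: "direct_sum M R (setsum C G)" by (rule direct_sum_commute)
  have "csubspace C" using C by (simp add: direct_sum_def)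
  then have "G \<subseteq> setsum C G" using assms(3) setsum_superset by metis
  moreover have "cdim_le (setsum C G) n" using ccodim_le_complement[OF d] assms(7) by simp
  ultimately show ?thesis using cdim_le_mono by blast
qed

text \<open>A vector of \<open>M\<close> outside \<open>V\<close> enlarges every independent subset
  of \<open>V\<close>. This drop by one, with its codimension analogue below, makes the induction
  for the Kato decomposition terminate.\<close>

lemma cdim_le_psubset:
  assumes "cdim_le M (Suc n)" "csubspace V" "V \<subset> M"
  shows "cdim_le V n"
proof (rule cdim_leI)
  fix I assume I: "finite I" "I \<subseteq> V" "cvs.independent I"
  obtain m where m: "m \<in> M" "m \<notin> V" using assms by blast
  have "m \<notin> cvs.span I" using m I assms cspan_minimal[of I V] by (auto simp: cspan_eq)
  then have "cvs.independent (insert m I)" using I cvs.independent_insertI by blast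
  moreover have "insert m I \<subseteq> M" using m I assms by blast
  ultimately have "card (insert m I) \<le> Suc n" using cdim_le_independent[OF assms(1)] by blast
  moreover have "m \<notin> I" using m I by blast
  ultimately show "card I \<le> n" using I by simp
qed

lemma ccodim_le_psubset:
  assumes "ccodim_le M R (Suc n)" "csubspace M" "csubspace R" "csubspace V" "R \<subseteq> V" "V \<subset> M"
  shows "ccodim_le V R n"
proof -
  obtain C where C: "direct_sum V R C" using complement_exists[OF assms(3,4,5)] .
  obtain D where D: "direct_sum M V D" using complement_exists[OF assms(4,2)] assms(6) by blast
  have d: "direct_sum M R (setsum D C)" "direct_sum (setsum D C) D C"
    using direct_sum_assoc[OF direct_sum_commute[OF D] direct_sum_commute[OF C]] direct_sum_commute by blast+
  have "C \<noteq> setsum D C"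
  proof
    assume "C = setsum D C"
    then have "M = setsum R C" using d by (simp add: direct_sum_def)
    then show False using C assms by (auto simp: direct_sum_def)
  qed
  then have "C \<subset> setsum D C" using direct_sum_subspace[OF d(2)] by blast
  then show ?thesis
    using cdim_le_psubset[of "setsum D C" n C] assms ccodim_le_complement[OF d(1)] ccodim_le_complement[OF C] C
    by (auto simp: direct_sum_def)
qed

lemma ccodim_le_0: "csubspace M \<Longrightarrow> R \<subseteq> M \<Longrightarrow> ccodim_le M R 0 \<longleftrightarrow> R = M"
  by (auto simp: ccodim_le_def cspan_eq)

lemma cdim_image_le:
  assumes "fin_cdim V" and S: "\<And>x y. S (x + y) = S x + S y" "\<And>c x. S (c *\<^sub>C x) = c *\<^sub>C S x"
  shows "fin_cdim (S ` V)" "cdim (S ` V) \<le> cdim V"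
proof -
  interpret module_hom scaleC scaleC S
    by (simp add: module_hom_iff S cvs.module_axioms)
  obtain E where E: "finite E" "card E = cdim V" "E \<subseteq> V" "V \<subseteq> cspan E"
    using fin_cdim_basis[OF assms(1)] by metis
  have "S ` V \<subseteq> cspan (S ` E)" using spans_image[of V E] E by (simp add: cspan_eq)
  then have "cdim_le (S ` V) (cdim V)" unfolding cdim_le_def using E card_image_le[of E S] by (intro exI[of _ "S ` E"]) auto
  then show "fin_cdim (S ` V)" "cdim (S ` V) \<le> cdim V" by (auto simp: cdim_le_iff)
qed

lemma cdim_image_inj:
  assumes "fin_cdim V" "csubspace V" and S: "\<And>x y. S (x + y) = S x + S y" "\<And>c x. S (c *\<^sub>C x) = c *\<^sub>C S x"
    and inj: "\<And>x. x \<in> V \<Longrightarrow> S x = 0 \<Longrightarrow> x = 0"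
  shows "cdim (S ` V) = cdim V"
proof -
  interpret module_hom scaleC scaleC S
    by (simp add: module_hom_iff S cvs.module_axioms)
  obtain E where E: "finite E" "card E = cdim V" "E \<subseteq> V" "cvs.independent E" "V \<subseteq> cspan E"
    using fin_cdim_basis[OF assms(1)] by metis
  have sV: "cvs.span E = V" using E assms(2) cspan_minimal[of E V] by (auto simp: cspan_eq)
  have i: "inj_on S V"
    using inj_on_iff_eq_0[of V] inj assms(2) by (simp add: csubspace_iff)
  then have ind: "cvs.independent (S ` E)"
    using independent_injective_image E(4) sV by blast
  have "card (S ` E) = card E" using i E inj_on_subset card_image by blast
  moreover have f: "fin_cdim (S ` V)" using cdim_image_le[OF assms(1) S] by blast
  moreover have "finite (S ` E) \<and> card (S ` E) \<le> cdim (S ` V)"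
    by (rule cdim_le_independent[OF _ _ ind]) (use f E in \<open>auto simp: cdim_le_iff\<close>)
  ultimately show ?thesis using cdim_image_le(2)[OF assms(1) S] E by simp
qed

text \<open>Rank-nullity: a complement of the kernel is mapped bijectively onto the range, so the
  kernel and a complement of the range have equal dimension.\<close>

lemma finite_dim_index_zero:
  assumes "fin_cdim Z" "csubspace Z" "S ` Z \<subseteq> Z"
    and S: "\<And>x y. S (x + y) = S x + S y" "\<And>c x. S (c *\<^sub>C x) = c *\<^sub>C S x"
  shows "fin_codim Z (S ` Z)" "codim Z (S ` Z) = cdim (kerOn Z S)"
proof -
  interpret module_hom scaleC scaleC S
    by (simp add: module_hom_iff S cvs.module_axioms)
  have k: "csubspace (kerOn Z S)" "kerOn Z S \<subseteq> Z"
    using assms(2) by (auto simp: kerOn_def csubspace_def S)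
  obtain C where C: "direct_sum Z (kerOn Z S) C" using complement_exists[OF k(1) assms(2) k(2)] .
  have i: "csubspace (S ` Z)" using assms(2) subspace_image by (simp add: csubspace_iff)
  obtain D where D: "direct_sum Z (S ` Z) D" using complement_exists[OF i assms(2,3)] .
  have f: "fin_cdim C" "fin_cdim (kerOn Z S)" "fin_cdim D" "fin_cdim (S ` Z)"
    using cdim_direct_sum(1)[OF C] cdim_direct_sum(1)[OF D] assms by auto
  have "S ` Z = S ` C"
  proof
    show "S ` C \<subseteq> S ` Z" using direct_sum_subspace[OF C] by blast
    show "S ` Z \<subseteq> S ` C"
    proof (clarify)
      fix x assume "x \<in> Z"
      then obtain a b where "a \<in> kerOn Z S" "b \<in> C" "x = a + b" using direct_sumE[OF C] by blast
      then show "S x \<in> S ` C" by (auto simp: kerOn_def S)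
    qed
  qed
  moreover have "cdim (S ` C) = cdim C"
  proof (rule cdim_image_inj[OF f(1) _ S])
    show "csubspace C" using C by (simp add: direct_sum_def)
    show "x = 0" if "x \<in> C" "S x = 0" for x
      using that C direct_sum_subspace[OF C] by (auto simp: direct_sum_def kerOn_def)
  qed
  ultimately have "cdim (kerOn Z S) = cdim D"
    using cdim_direct_sum(2)[OF C] cdim_direct_sum(2)[OF D] f by simp
  then show "codim Z (S ` Z) = cdim (kerOn Z S)" "fin_codim Z (S ` Z)"
    using codim_complement[OF D] f by auto
qed


subsection \<open>Hahn-Banach, open mapping and finite-dimensional subspaces\<close>

text \<open>Homogeneity is imposed only as an inequality, which is easier to verify; scaling back by
  the inverse recovers equality in \<open>sublin_scale\<close>.\<close>

definition sublin :: "('a::real_vector \<Rightarrow> real) \<Rightarrow> bool" where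
  "sublin q \<longleftrightarrow> (\<forall>x y. q (x + y) \<le> q x + q y) \<and> (\<forall>t>0. \<forall>x. q (t *\<^sub>R x) \<le> t * q x) \<and> q 0 = 0"

lemma sublin_scale: "sublin q \<Longrightarrow> t \<ge> 0 \<Longrightarrow> q (t *\<^sub>R x) = t * q x"
proof (cases "t = 0")
  case False
  assume q: "sublin q" "t \<ge> 0"
  then have t: "t > 0" "inverse t > 0" using False by auto
  have "q (inverse t *\<^sub>R (t *\<^sub>R x)) \<le> inverse t * q (t *\<^sub>R x)" using q t unfolding sublin_def by blast
  then have "t * q x \<le> q (t *\<^sub>R x)" using t by (simp add: field_simps)
  then show ?thesis using q t unfolding sublin_def by (meson antisym)
qed (auto simp: sublin_def)

lemma sublin_neg: "sublin q \<Longrightarrow> - q (- x) \<le> q x"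
  unfolding sublin_def by (metis add.right_inverse le_add_same_cancel1 add.commute minus_le_iff diff_ge_0_iff_ge diff_minus_eq_add)

text \<open>The term \<open>t = 0\<close> shows that the new functional lies below \<open>q\<close>,
  and the term \<open>t = 1\<close> bounds its value at \<open>- y\<close> by \<open>- q y\<close>.
  A functional that cannot be lowered must therefore already be odd.\<close>

definition sublin_shift :: "('a::real_vector \<Rightarrow> real) \<Rightarrow> 'a \<Rightarrow> 'a \<Rightarrow> real" where
  "sublin_shift q y x = (INF t\<in>{0..}. q (x + t *\<^sub>R y) - t * q y)"

lemma sublin_shift_le:
  assumes "sublin q" "t \<ge> 0"
  shows "sublin_shift q y x \<le> q (x + t *\<^sub>R y) - t * q y"
  unfolding sublin_shift_def
proof (rule cINF_lower)
  \<comment> \<open>This lower bound does not depend on \<open>s\<close>, so the infimum is a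
    genuine one.\<close>
  have "- q (- x) \<le> q (x + s *\<^sub>R y) - s * q y" if "s \<ge> 0" for s
  proof -
    have "q (s *\<^sub>R y) \<le> q (x + s *\<^sub>R y) + q (- x)"
      using assms(1) unfolding sublin_def by (metis add.commute add_uminus_conv_diff add_diff_cancel_left')
    then show ?thesis using sublin_scale[OF assms(1) that, of y] by simp
  qed
  then show "bdd_below ((\<lambda>t. q (x + t *\<^sub>R y) - t * q y) ` {0..})" by (auto intro!: bdd_belowI)
qed (use assms in auto)

lemma sublin_shift_greatest:
  "(\<And>t. t \<ge> 0 \<Longrightarrow> c \<le> q (x + t *\<^sub>R y) - t * q y) \<Longrightarrow> c \<le> sublin_shift q y x"
  unfolding sublin_shift_def by (rule cINF_greatest) auto

lemma sublin_sublin_shift: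
  assumes q: "sublin q"
  shows "sublin (sublin_shift q y)"
  unfolding sublin_def
proof (intro conjI allI impI)
  fix x z :: 'a
  have *: "sublin_shift q y (x + z) \<le> (q (x + t *\<^sub>R y) - t * q y) + (q (z + s *\<^sub>R y) - s * q y)"
    if "t \<ge> 0" "s \<ge> 0" for t s
  proof -
    have "sublin_shift q y (x + z) \<le> q ((x + z) + (t + s) *\<^sub>R y) - (t + s) * q y"
      by (rule sublin_shift_le[OF q]) (use that in auto)
    also have "(x + z) + (t + s) *\<^sub>R y = (x + t *\<^sub>R y) + (z + s *\<^sub>R y)" by (simp add: algebra_simps)
    also have "q \<dots> - (t + s) * q y \<le> (q (x + t *\<^sub>R y) + q (z + s *\<^sub>R y)) - (t + s) * q y"
      using q unfolding sublin_def by simp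
    finally show ?thesis by (simp add: algebra_simps)
  qed
  have "sublin_shift q y (x + z) - (q (z + s *\<^sub>R y) - s * q y) \<le> sublin_shift q y x" if "s \<ge> 0" for s
    by (rule sublin_shift_greatest) (use *[OF _ that] in \<open>force simp: algebra_simps\<close>)
  then have "sublin_shift q y (x + z) - sublin_shift q y x \<le> sublin_shift q y z"
    by (intro sublin_shift_greatest) (force simp: algebra_simps)
  then show "sublin_shift q y (x + z) \<le> sublin_shift q y x + sublin_shift q y z" by simp
next
  fix t :: real and x :: 'a
  assume t: "t > 0"
  have "sublin_shift q y (t *\<^sub>R x) / t \<le> q (x + s *\<^sub>R y) - s * q y" if "s \<ge> 0" for s
  proof -
    have "sublin_shift q y (t *\<^sub>R x) \<le> q (t *\<^sub>R x + (t * s) *\<^sub>R y) - (t * s) * q y"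
      by (rule sublin_shift_le[OF q]) (use that t in auto)
    also have "t *\<^sub>R x + (t * s) *\<^sub>R y = t *\<^sub>R (x + s *\<^sub>R y)" by (simp add: algebra_simps)
    also have "q \<dots> = t * q (x + s *\<^sub>R y)" using sublin_scale[OF q] t by simp
    finally show ?thesis using t by (simp add: field_simps)
  qed
  then have "sublin_shift q y (t *\<^sub>R x) / t \<le> sublin_shift q y x" by (rule sublin_shift_greatest)
  then show "sublin_shift q y (t *\<^sub>R x) \<le> t * sublin_shift q y x" using t by (simp add: field_simps)
next
  have "sublin_shift q y 0 \<le> q 0" using sublin_shift_le[OF q, of 0 y 0] by simp
  moreover have "0 \<le> sublin_shift q y 0" by (rule sublin_shift_greatest) (simp add: sublin_scale[OF q])
  ultimately show "sublin_shift q y 0 = 0" using q by (simp add: sublin_def)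
qed

text \<open>Zorn's lemma for the reversed pointwise order. The pointwise infimum of a chain is
  finite, as \<open>- p (- x)\<close> lies below all values at \<open>x\<close>, and it is
  subadditive because any two members of the chain can be replaced by the smaller one.\<close>

lemma minimal_sublin_exists:
  fixes p :: "'a::real_vector \<Rightarrow> real"
  assumes p: "sublin p"
  obtains m where "sublin m" "m \<le> p" "\<And>q. sublin q \<Longrightarrow> q \<le> m \<Longrightarrow> q = m"
proof -
  define A where "A = {q. sublin q \<and> q \<le> p}"
  have "\<exists>m\<in>A. \<forall>a\<in>A. m \<ge> a \<longrightarrow> a = m"
  proof (rule predicate_Zorn)
    show "partial_order_on A (relation_of (\<ge>) A)"
      unfolding partial_order_on_def preorder_on_def refl_on_def trans_on_def antisym_on_def relation_of_def
      by (auto intro: order_trans)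
    fix \<C> assume "\<C> \<in> Chains (relation_of (\<ge>) A)"
    then have C: "\<C> \<subseteq> A" "\<And>q r. q \<in> \<C> \<Longrightarrow> r \<in> \<C> \<Longrightarrow> q \<le> r \<or> r \<le> q"
      unfolding Chains_def relation_of_def by auto
    show "\<exists>u\<in>A. \<forall>a\<in>\<C>. a \<ge> u"
    proof (cases "\<C> = {}")
      case True
      then show ?thesis using p by (auto simp: A_def)
    next
      case False
      define u where "u x = (INF q\<in>\<C>. q x)" for x
      have bdd: "bdd_below ((\<lambda>q. q x) ` \<C>)" for x
      proof (rule bdd_belowI)
        fix y assume "y \<in> (\<lambda>q. q x) ` \<C>"
        then obtain q where q: "q \<in> \<C>" "y = q x" by auto
        then have "- q (- x) \<le> y" "q (- x) \<le> p (- x)" using C sublin_neg[of q x] by (auto simp: A_def le_fun_def)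
        then show "- p (- x) \<le> y" by linarith
      qed
      have ul: "u x \<le> q x" if "q \<in> \<C>" for q x unfolding u_def by (rule cINF_lower[OF bdd that])
      have ug: "c \<le> u x" if "\<And>q. q \<in> \<C> \<Longrightarrow> c \<le> q x" for c x
        unfolding u_def by (rule cINF_greatest[OF False that])
      have sub: "sublin q" if "q \<in> \<C>" for q using that C by (auto simp: A_def)
      have "sublin u" unfolding sublin_def
      proof (intro conjI allI impI)
        fix x y :: 'a
        have *: "u (x + y) \<le> q x + r y" if qr: "q \<in> \<C>" "r \<in> \<C>" for q r
        proof -
          obtain s where s: "s \<in> \<C>" "s \<le> q" "s \<le> r" using C(2)[OF qr] qr by blast
          have "u (x + y) \<le> s (x + y)" using ul s by blast
          also have "\<dots> \<le> s x + s y" using sub[OF s(1)] by (simp add: sublin_def)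
          also have "\<dots> \<le> q x + r y" using s by (intro add_mono) (auto simp: le_fun_def)
          finally show ?thesis .
        qed
        have "u (x + y) - r y \<le> u x" if "r \<in> \<C>" for r by (rule ug) (use *[OF _ that] in \<open>force simp: algebra_simps\<close>)
        then have "u (x + y) - u x \<le> u y" by (intro ug) (force simp: algebra_simps)
        then show "u (x + y) \<le> u x + u y" by simp
      next
        fix t :: real and x :: 'a assume t: "t > 0"
        have "u (t *\<^sub>R x) / t \<le> q x" if "q \<in> \<C>" for q
          using ul[OF that, of "t *\<^sub>R x"] sublin_scale[OF sub[OF that], of t x] t by (simp add: field_simps)
        then have "u (t *\<^sub>R x) / t \<le> u x" by (rule ug)
        then show "u (t *\<^sub>R x) \<le> t * u x" using t by (simp add: field_simps)
      next
        have q0: "q 0 = 0" if "q \<in> \<C>" for q using sub[OF that] by (simp add: sublin_def)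
        obtain q where "q \<in> \<C>" using False by blast
        then have "u 0 \<le> 0" using ul[of q 0] q0[of q] by simp
        moreover have "0 \<le> u 0"
        proof (rule ug)
          show "0 \<le> r 0" if "r \<in> \<C>" for r using q0[OF that] by (simp only: order_refl)
        qed
        ultimately show "u 0 = 0" by (rule antisym)
      qed
      moreover have "u \<le> p"
      proof (rule le_funI)
        fix x
        obtain q where q: "q \<in> \<C>" using False by blast
        then have "q x \<le> p x" using C(1) by (auto simp: A_def le_fun_def)
        with ul[OF q, of x] show "u x \<le> p x" by (rule order_trans)
      qed
      ultimately show ?thesis using ul by (intro bexI[of _ u]) (auto simp: A_def le_fun_def)
    qed
  qed
  then obtain m where "m \<in> A" "\<forall>a\<in>A. m \<ge> a \<longrightarrow> a = m" by blast
  then show thesis using that[of m] by (force simp: A_def)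
qed

text \<open>A minimal sublinear functional is linear: comparing it with its shift along \<^term>\<open>y\<close> forces
  \<^term>\<open>m (- y) = - m y\<close>.\<close>

lemma Hahn_Banach_dominated:
  fixes p :: "'a::real_vector \<Rightarrow> real"
  assumes p: "sublin p"
  obtains f where "linear f" "\<And>x. f x \<le> p x" "f x0 = p x0"
proof -
  have shift: "sublin_shift q y \<le> q" "sublin_shift q y (- y) \<le> - q y" if "sublin q" for q :: "'a \<Rightarrow> real" and y
    using sublin_shift_le[OF that, of 0 y] sublin_shift_le[OF that, of 1 y "- y"] that
    by (auto simp: le_fun_def sublin_def)
  \<comment> \<open>Starting below the shift of \<open>p\<close> along \<open>x0\<close>, rather
    than below \<open>p\<close> itself, forces \<open>m (- x0) \<le> - p x0\<close> and hence builds
    in the prescribed value at \<open>x0\<close>.\<close>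
  obtain m where m: "sublin m" "m \<le> sublin_shift p x0" "\<And>q. sublin q \<Longrightarrow> q \<le> m \<Longrightarrow> q = m"
    using minimal_sublin_exists[OF sublin_sublin_shift[OF p]] by metis
  have mp: "m x \<le> p x" for x using m(2) shift(1)[OF p, of x0] by (meson le_funD order_trans)
  have odd: "m (- y) = - m y" for y
  proof -
    have "sublin_shift m y = m" using m(3)[OF sublin_sublin_shift[OF m(1)] shift(1)[OF m(1)]] .
    then have "m (- y) \<le> - m y" using shift(2)[OF m(1), of y] by simp
    then show ?thesis using sublin_neg[OF m(1), of y] by simp
  qed
  have "linear m"
  proof (rule linearI)
    fix x y
    have "m x \<le> m (x + y) + m (- y)" using m(1) unfolding sublin_def by (metis add.assoc add.right_inverse add.right_neutral)
    moreover have "m (x + y) \<le> m x + m y" using m(1) unfolding sublin_def by blast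
    ultimately show "m (x + y) = m x + m y" using odd[of y] by simp
  next
    fix r :: real and x
    show "m (r *\<^sub>R x) = r *\<^sub>R m x"
    proof (cases "r \<ge> 0")
      case True then show ?thesis using sublin_scale[OF m(1)] by simp
    next
      case False
      then have "m ((- r) *\<^sub>R x) = (- r) * m x" using sublin_scale[OF m(1), of "- r"] by simp
      then show ?thesis using odd[of "r *\<^sub>R x"] by simp
    qed
  qed
  moreover have "m x0 = p x0"
  proof -
    have "m (- x0) \<le> - p x0" using m(2) shift(2)[OF p, of x0] by (meson le_funD order_trans)
    then show ?thesis using odd[of x0] mp[of x0] by simp
  qed
  ultimately show thesis using that mp by blast
qed

definition cfunctional :: "('a::complex_banach \<Rightarrow> complex) \<Rightarrow> bool" where
  "cfunctional f \<longleftrightarrow> bounded_linear f \<and> (\<forall>c x. f (c *\<^sub>C x) = c * f x)"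

lemma cfunctional_add: "cfunctional f \<Longrightarrow> f (x + y) = f x + f y"
  and cfunctional_diff: "cfunctional f \<Longrightarrow> f (x - y) = f x - f y"
  and cfunctional_scale: "cfunctional f \<Longrightarrow> f (c *\<^sub>C x) = c * f x"
  and cfunctional_0: "cfunctional f \<Longrightarrow> f 0 = 0"
  and cfunctional_continuous: "cfunctional f \<Longrightarrow> continuous_on S f"
  by (auto simp: cfunctional_def bounded_linear.linear linear_add linear_diff linear_0 linear_continuous_on)

text \<open>The distance to \<open>V\<close> serves as the dominating functional: anything linear
  below it vanishes on \<open>V\<close>, is bounded by the norm, and can attain the positive
  distance of a point outside a closed \<open>V\<close>.\<close>

lemma infdist_sublin:
  fixes V :: "'a::real_normed_vector set"
  assumes V: "subspace V"
  shows "sublin (\<lambda>x. infdist x V)"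
proof -
  have ne: "V \<noteq> {}" using V subspace_0 by blast
  have lt: "infdist x V < e \<longleftrightarrow> (\<exists>v\<in>V. norm (x - v) < e)" for x e
  proof -
    have "bdd_below ((\<lambda>v. norm (x - v)) ` V)" by (rule bdd_belowI[of _ 0]) auto
    from cINF_less_iff[OF ne this, of e] show ?thesis using ne by (simp add: infdist_def dist_norm)
  qed
  show ?thesis unfolding sublin_def
  proof (intro conjI allI impI)
    fix x y :: 'a
    show "infdist (x + y) V \<le> infdist x V + infdist y V"
    proof (rule field_le_epsilon)
      fix e :: real assume "e > 0"
      then obtain v w where vw: "v \<in> V" "w \<in> V" "norm (x - v) < infdist x V + e/2" "norm (y - w) < infdist y V + e/2"
        using lt[of x "infdist x V + e/2"] lt[of y "infdist y V + e/2"] by auto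
      have "norm ((x + y) - (v + w)) \<le> norm (x - v) + norm (y - w)"
        by (metis add_diff_add norm_triangle_ineq)
      then have "infdist (x + y) V < infdist x V + infdist y V + e"
        unfolding lt using vw V by (intro bexI[of _ "v + w"]) (auto simp: subspace_add)
      then show "infdist (x + y) V \<le> infdist x V + infdist y V + e" by simp
    qed
  next
    fix t :: real and x :: 'a assume t: "t > 0"
    show "infdist (t *\<^sub>R x) V \<le> t * infdist x V"
    proof (rule field_le_epsilon)
      fix e :: real assume "e > 0"
      then obtain v where v: "v \<in> V" "norm (x - v) < infdist x V + e/t"
        using lt[of x "infdist x V + e/t"] t by auto
      have "norm (t *\<^sub>R x - t *\<^sub>R v) = t * norm (x - v)"
        using t by (metis scaleR_diff_right norm_scaleR abs_of_pos)
      also have "\<dots> < t * (infdist x V + e/t)" using t v by simp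
      also have "\<dots> = t * infdist x V + e" using t by (simp add: field_simps)
      finally have "infdist (t *\<^sub>R x) V < t * infdist x V + e"
        unfolding lt using v V by (intro bexI[of _ "t *\<^sub>R v"]) (auto simp: subspace_scale)
      then show "infdist (t *\<^sub>R x) V \<le> t * infdist x V + e" by simp
    qed
  next
    show "infdist 0 V = 0" using subspace_0[OF V] by simp
  qed
qed

lemma separating_functional:
  fixes V :: "'a::complex_banach set"
  assumes V: "csubspace V" "closed V" and x0: "x0 \<notin> V"
  obtains f where "cfunctional f" "\<And>v. v \<in> V \<Longrightarrow> f v = 0" "f x0 = 1"
proof -
  have ne: "V \<noteq> {}" using V csubspace_0 by blast
  obtain g where g: "linear g" "\<And>x. g x \<le> infdist x V" "g x0 = infdist x0 V"
    using Hahn_Banach_dominated[OF infdist_sublin[OF csubspace_imp_subspace[OF V(1)]]] by metis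
  have le: "\<bar>g x\<bar> \<le> norm x" for x
  proof -
    have "infdist y V \<le> norm y" for y using infdist_le[OF csubspace_0[OF V(1)], of y] by simp
    then have "g x \<le> norm x" "g (- x) \<le> norm x" using g(2)[of x] g(2)[of "- x"] by (metis order_trans norm_minus_cancel)+
    then show ?thesis using linear_neg[OF g(1), of x] by simp
  qed
  have gV: "g v = 0" if "v \<in> V" for v
    using g(2)[of v] g(2)[of "- v"] that linear_neg[OF g(1), of v] csubspace_neg[OF V(1) that] by simp
  \<comment> \<open>The standard complexification \<open>g x - \<i> g (\<i> x)\<close> of a real
    functional; it still vanishes on \<open>V\<close>, since \<open>V\<close> is stable under
    multiplication by \<open>\<i>\<close>.\<close>
  define h where "h x = Complex (g x) (- g (\<i> *\<^sub>C x))" for x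
  have gr: "g (of_real r *\<^sub>C x) = r * g x" for r x using linear_scale[OF g(1), of r x] by (simp add: scaleC_of_real)
  have add: "h (x + y) = h x + h y" for x y
    by (simp add: h_def linear_add[OF g(1)] scaleC_add_right complex_eq_iff)
  have "h (c *\<^sub>C x) = c * h x" for c x
  proof -
    have c: "c = of_real (Re c) + of_real (Im c) * \<i>" by (simp add: complex_eq_iff)
    have "c *\<^sub>C x = of_real (Re c) *\<^sub>C x + of_real (Im c) *\<^sub>C (\<i> *\<^sub>C x)"
      by (subst c) (simp only: scaleC_add_left scaleC_scaleC)
    then have 1: "g (c *\<^sub>C x) = Re c * g x + Im c * g (\<i> *\<^sub>C x)" by (simp only: linear_add[OF g(1)] gr)
    have "\<i> * c = of_real (- Im c) + of_real (Re c) * \<i>" by (simp add: complex_eq_iff)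
    then have "\<i> *\<^sub>C c *\<^sub>C x = of_real (- Im c) *\<^sub>C x + of_real (Re c) *\<^sub>C (\<i> *\<^sub>C x)"
      by (simp only: scaleC_add_left scaleC_scaleC)
    then have 2: "g (\<i> *\<^sub>C c *\<^sub>C x) = - Im c * g x + Re c * g (\<i> *\<^sub>C x)"
      by (simp only: linear_add[OF g(1)] gr)
    show ?thesis unfolding h_def 1 2 by (simp add: complex_eq_iff algebra_simps)
  qed
  note scale = this
  have "bounded_linear h"
  proof (rule bounded_linear_intro)
    show "h (r *\<^sub>R x) = r *\<^sub>R h x" for r x
      using scale[of "of_real r" x] by (simp add: scaleC_of_real scaleR_conv_of_real)
    show "norm (h x) \<le> norm x * 2" for x
      using cmod_le[of "h x"] le[of x] le[of "\<i> *\<^sub>C x"] by (simp add: h_def norm_scaleC)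
  qed (rule add)
  then have h: "cfunctional h" using scale by (simp add: cfunctional_def)
  have "infdist x0 V > 0"
    using in_closed_iff_infdist_zero[OF V(2) ne, of x0] x0 infdist_nonneg[of x0 V] by linarith
  then have nz: "h x0 \<noteq> 0" using g(3) by (auto simp: h_def complex_eq_iff)
  have hV: "h v = 0" if "v \<in> V" for v using gV[OF that] gV[OF csubspace_scale[OF V(1) that]] by (simp add: h_def complex_eq_iff)
  show thesis
  proof (rule that[of "\<lambda>x. inverse (h x0) * h x"])
    show "cfunctional (\<lambda>x. inverse (h x0) * h x)"
      using h by (auto simp: cfunctional_def bounded_linear_const_mult)
  qed (use nz hV in auto)
qed

section \<open>Successive approximation, open mapping and closed ranges\<close>

text \<open>Each correction leaves a remainder smaller by the factor \<open>\<theta>\<close>; the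
  corrections are dominated by a geometric series, whose sum gives
  \<open>C / (1 - \<theta>)\<close>. Only the remainders have to stay in \<open>Y\<close>, so
  \<open>Y\<close> may be a range, its closure or a whole invariant subspace.\<close>

lemma approximate_surjectivity:
  fixes g :: "'a::banach \<Rightarrow> 'b::real_normed_vector"
  assumes g: "bounded_linear g" and E: "subspace E" "closed E"
    and inv: "\<And>y e. y \<in> Y \<Longrightarrow> e \<in> E \<Longrightarrow> y - g e \<in> Y"
    and appr: "\<And>y. y \<in> Y \<Longrightarrow> \<exists>e\<in>E. norm e \<le> C * norm y \<and> norm (y - g e) \<le> \<theta> * norm y"
    and \<theta>: "0 \<le> \<theta>" "\<theta> < 1" and C: "0 \<le> C" and y: "y \<in> Y"
  shows "\<exists>e\<in>E. g e = y \<and> norm e \<le> C / (1 - \<theta>) * norm y"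
proof -
  obtain h where h: "\<And>y. y \<in> Y \<Longrightarrow> h y \<in> E \<and> norm (h y) \<le> C * norm y \<and> norm (y - g (h y)) \<le> \<theta> * norm y"
    using appr by metis
  define r where "r n = ((\<lambda>z. z - g (h z)) ^^ n) y" for n
  have rY: "r n \<in> Y" for n by (induction n) (auto simp: r_def y h inv)
  have rn: "norm (r n) \<le> \<theta> ^ n * norm y" for n
  proof (induction n)
    case (Suc n)
    have "norm (r (Suc n)) \<le> \<theta> * norm (r n)" using h[OF rY[of n]] by (simp add: r_def)
    also have "\<dots> \<le> \<theta> * (\<theta> ^ n * norm y)" using Suc \<theta>(1) by (rule mult_left_mono)
    finally show ?case by (simp add: mult.assoc)
  qed (simp add: r_def)
  have hn: "norm (h (r n)) \<le> (C * norm y) * \<theta> ^ n" for n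
  proof -
    have "norm (h (r n)) \<le> C * norm (r n)" using h[OF rY] by blast
    also have "\<dots> \<le> C * (\<theta> ^ n * norm y)" using rn C by (rule mult_left_mono)
    finally show ?thesis by (simp add: mult_ac)
  qed
  have geo: "summable (\<lambda>n. (C * norm y) * \<theta> ^ n)" "(\<Sum>n. (C * norm y) * \<theta> ^ n) = (C * norm y) * (1 / (1 - \<theta>))"
    using \<theta> by (simp_all add: summable_geometric suminf_mult suminf_geometric)
  have sm: "summable (\<lambda>n. norm (h (r n)))" by (rule summable_comparison_test[OF _ geo(1)]) (use hn in auto)
  define e where "e = (\<Sum>n. h (r n))"
  have lim: "(\<lambda>n. \<Sum>i<n. h (r i)) \<longlonglongrightarrow> e"
    unfolding e_def by (rule summable_LIMSEQ[OF summable_norm_cancel[OF sm]])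
  have "e \<in> E" by (rule closed_sequentially[OF E(2) _ lim]) (use h rY E in \<open>auto intro: subspace_sum\<close>)
  moreover have "g e = y"
  proof -
    have part: "g (\<Sum>i<n. h (r i)) = y - r n" for n
      by (induction n) (auto simp: r_def bounded_linear.linear[OF g] linear_0 linear_add)
    have "(\<lambda>n. \<theta> ^ n * norm y) \<longlonglongrightarrow> 0" using \<theta> by (auto intro!: tendsto_mult_left_zero LIMSEQ_power_zero)
    then have "r \<longlonglongrightarrow> 0" by (rule Lim_null_comparison[rotated]) (use rn in auto)
    then have "(\<lambda>n. g (\<Sum>i<n. h (r i))) \<longlonglongrightarrow> y - 0" unfolding part by (intro tendsto_intros)
    moreover have "(\<lambda>n. g (\<Sum>i<n. h (r i))) \<longlonglongrightarrow> g e" by (rule bounded_linear.tendsto[OF g lim])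
    ultimately show ?thesis using LIMSEQ_unique by fastforce
  qed
  moreover have "norm e \<le> C / (1 - \<theta>) * norm y"
  proof -
    have "norm e \<le> (\<Sum>n. norm (h (r n)))" unfolding e_def by (rule summable_norm[OF sm])
    also have "\<dots> \<le> (\<Sum>n. (C * norm y) * \<theta> ^ n)" by (rule suminf_le[OF hn sm geo(1)])
    finally show ?thesis unfolding geo(2) by simp
  qed
  ultimately show ?thesis by blast
qed

text \<open>The closed range is a Baire space covered by the closures of images of balls, so one of
  these closures has interior points relative to the range; \<open>approximate_surjectivity\<close>
  then removes the closure.\<close>

lemma open_mapping:
  fixes g :: "'a::banach \<Rightarrow> 'b::banach"
  assumes g: "bounded_linear g" and E: "subspace E" "closed E" and cl: "closed (g ` E)"
  obtains C where "C > 0" "\<And>y. y \<in> g ` E \<Longrightarrow> \<exists>e\<in>E. g e = y \<and> norm e \<le> C * norm y"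
proof -
  define Y where "Y = g ` E"
  have lin: "linear g" using g by (rule bounded_linear.linear)
  have Y: "subspace Y" unfolding Y_def using lin E(1) by (rule linear_subspace_image)
  define S where "S n = closure (g ` (E \<inter> cball 0 (real n)))" for n
  have SY: "S n \<subseteq> Y" for n unfolding S_def Y_def using cl by (intro closure_minimal) auto
  have UY: "\<Union> (range S) = Y"
  proof
    show "\<Union> (range S) \<subseteq> Y" using SY by blast
    show "Y \<subseteq> \<Union> (range S)"
    proof
      fix y assume "y \<in> Y"
      then obtain e where "e \<in> E" "y = g e" by (auto simp: Y_def)
      moreover obtain n where "norm e \<le> real n" using real_arch_simple by blast
      ultimately have "y \<in> S n" unfolding S_def by (intro closure_subset[THEN subsetD]) auto
      then show "y \<in> \<Union> (range S)" by blast
    qed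
  qed
  have "\<exists>n. top_of_set Y interior_of S n \<noteq> {}"
  proof (rule ccontr)
    assume "\<not> ?thesis"
    moreover have "closedin (top_of_set Y) (S n)" for n
      using SY by (intro closed_subset) (auto simp: S_def)
    moreover have "completely_metrizable_space (top_of_set Y)"
      using cl completely_metrizable_space_closedin[OF completely_metrizable_space_euclidean, of Y] by (simp add: Y_def)
    ultimately have "top_of_set Y interior_of \<Union> (range S) = {}"
      by (intro Baire_category_alt) auto
    then have "Y = {}" unfolding UY using interior_of_topspace[of "top_of_set Y"] by simp
    then show False using subspace_0[OF Y] by blast
  qed
  then obtain n y0 T where T: "openin (top_of_set Y) T" "y0 \<in> T" "T \<subseteq> S n"
    by (auto simp: interior_of_def)
  then obtain r where r: "r > 0" "\<And>y. y \<in> Y \<Longrightarrow> dist y y0 < r \<Longrightarrow> y \<in> T" and y0: "y0 \<in> Y"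
    unfolding openin_euclidean_subtopology_iff by blast
  \<comment> \<open>A small \<open>y\<close> is the difference of the two points
    \<open>y0 + y\<close> and \<open>y0\<close> of \<open>S n\<close>, so it is approximated by the
    image of a difference of two vectors of norm at most \<open>n\<close>.\<close>
  have *: "\<exists>e\<in>E. norm e \<le> 2 * real n \<and> norm (y - g e) \<le> r / 4" if y: "y \<in> Y" "norm y < r" for y
  proof -
    have "y0 + y \<in> S n" "y0 \<in> S n" using r(2)[of "y0 + y"] r(1) T y y0 Y by (auto simp: dist_norm subspace_add)
    then have "\<exists>e\<in>E \<inter> cball 0 (real n). dist (g e) (y0 + y) < r/8" "\<exists>e\<in>E \<inter> cball 0 (real n). dist (g e) y0 < r/8"
      unfolding S_def closure_approachable using r(1) by (auto dest!: spec[of _ "r/8"])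
    then obtain e1 e2 where e: "e1 \<in> E" "norm e1 \<le> n" "dist (g e1) (y0 + y) < r/8" "e2 \<in> E" "norm e2 \<le> n" "dist (g e2) y0 < r/8"
      by auto
    have "norm (y - g (e1 - e2)) = norm ((y0 + y - g e1) - (y0 - g e2))"
      by (simp add: linear_diff[OF lin] algebra_simps)
    also have "\<dots> \<le> norm (y0 + y - g e1) + norm (y0 - g e2)" by (rule norm_triangle_ineq4)
    also have "\<dots> \<le> r / 4" using e by (simp add: dist_norm norm_minus_commute)
    finally show ?thesis using e norm_triangle_ineq4[of e1 e2] subspace_diff[OF E(1), of e1 e2]
      by (intro bexI[of _ "e1 - e2"]) auto
  qed
  \<comment> \<open>A vector scaled to norm \<open>r/2\<close> has an approximate preimage of norm
    at most \<open>2 * n\<close> with error at most \<open>r/4\<close>, that is half its norm;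
    \<open>C\<close> is the ratio of \<open>2 * n\<close> to \<open>r/2\<close>.\<close>
  define C where "C = 4 * real n / r"
  have appr: "\<exists>e\<in>E. norm e \<le> C * norm y \<and> norm (y - g e) \<le> 1/2 * norm y" if y: "y \<in> Y" for y
  proof (cases "y = 0")
    case True
    then show ?thesis using subspace_0[OF E(1)] linear_0[OF lin] by (intro bexI[of _ 0]) auto
  next
    case False
    define s where "s = r / (2 * norm y)"
    have s: "s > 0" "s * norm y = r / 2" using False r(1) by (auto simp: s_def)
    obtain e where e: "e \<in> E" "norm e \<le> 2 * real n" "norm (s *\<^sub>R y - g e) \<le> r / 4"
      using *[of "s *\<^sub>R y"] s subspace_scale[OF Y y] r(1) by auto
    have "norm (y - g (inverse s *\<^sub>R e)) = norm (inverse s *\<^sub>R (s *\<^sub>R y - g e))"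
      using s by (simp add: linear_scale[OF lin] scaleR_diff_right)
    also have "\<dots> = inverse s * norm (s *\<^sub>R y - g e)" using s by simp
    also have "\<dots> \<le> inverse s * (r / 4)" using e s by (intro mult_left_mono) auto
    also have "\<dots> = 1/2 * norm y" using s r(1) False by (simp add: s_def field_simps)
    finally have 1: "norm (y - g (inverse s *\<^sub>R e)) \<le> 1/2 * norm y" .
    have "norm (inverse s *\<^sub>R e) \<le> inverse s * (2 * real n)" using e s by (simp add: mult_left_mono)
    also have "\<dots> = C * norm y" using r(1) False by (simp add: s_def C_def field_simps)
    finally show ?thesis using 1 subspace_scale[OF E(1) e(1)] by blast
  qed
  \<comment> \<open>The summand 1 keeps the constant positive even if \<open>n = 0\<close> and
    therefore \<open>C = 0\<close>.\<close>
  have "\<exists>e\<in>E. g e = y \<and> norm e \<le> (2 * C + 1) * norm y" if y: "y \<in> Y" for y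
  proof -
    have "\<exists>e\<in>E. g e = y \<and> norm e \<le> C / (1 - 1/2) * norm y"
      by (rule approximate_surjectivity[OF g E _ appr]) (use Y y r(1) in \<open>auto simp: Y_def C_def intro: subspace_diff\<close>)
    then obtain e where e: "e \<in> E" "g e = y" "norm e \<le> (2 * C) * norm y" by auto
    have "(2 * C) * norm y \<le> (2 * C + 1) * norm y" by (intro mult_right_mono) auto
    with e show ?thesis by (intro bexI[of _ e]) auto
  qed
  moreover have "2 * C + 1 > 0" using r(1) by (simp add: C_def add_nonneg_pos)
  ultimately show thesis using that by (simp add: Y_def)
qed

lemma subspace_closure:
  assumes "subspace (V :: 'a::real_normed_vector set)"
  shows "subspace (closure V)"
proof (rule subspaceI)
  show "0 \<in> closure V" using subspace_0[OF assms] closure_subset by blast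
next
  fix x y assume "x \<in> closure V" "y \<in> closure V"
  then obtain u v where "\<And>n. u n \<in> V" "u \<longlonglongrightarrow> x" "\<And>n. v n \<in> V" "v \<longlonglongrightarrow> y"
    unfolding closure_sequential by metis
  then show "x + y \<in> closure V" unfolding closure_sequential
    by (intro exI[of _ "\<lambda>n. u n + v n"]) (auto intro: subspace_add[OF assms] tendsto_add)
next
  fix c x assume "x \<in> closure V"
  then obtain u where "\<And>n. u n \<in> V" "u \<longlonglongrightarrow> x"
    unfolding closure_sequential by metis
  then show "c *\<^sub>R x \<in> closure V" unfolding closure_sequential
    by (intro exI[of _ "\<lambda>n. c *\<^sub>R u n"]) (auto intro: subspace_scale[OF assms] tendsto_scaleR)
qed

text \<open>Converse of the open mapping estimate: a point of the closure is approximated by points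
  of the range with controlled preimages, and iterating yields an exact preimage.\<close>

lemma closed_image_bounded_preimage:
  fixes g :: "'a::banach \<Rightarrow> 'b::real_normed_vector"
  assumes g: "bounded_linear g" and E: "subspace E" "closed E" and C: "C \<ge> 0"
    and pre: "\<And>y. y \<in> g ` E \<Longrightarrow> \<exists>e\<in>E. g e = y \<and> norm e \<le> C * norm y"
  shows "closed (g ` E)"
proof -
  have lin: "linear g" using g by (rule bounded_linear.linear)
  have sub: "subspace (closure (g ` E))"
    using linear_subspace_image[OF lin E(1)] by (rule subspace_closure)
  have "y \<in> g ` E" if y: "y \<in> closure (g ` E)" for y
  proof -
    \<comment> \<open>The factor \<open>3/2\<close> arises because a vector within
      \<open>norm z / 2\<close> of \<open>z\<close> has norm at most
      \<open>3/2 * norm z\<close>.\<close>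
    have "\<exists>e\<in>E. g e = y \<and> norm e \<le> (C * (3/2)) / (1 - 1/2) * norm y"
    proof (rule approximate_surjectivity[OF g E _ _ _ _ _ y])
      show "z - g e \<in> closure (g ` E)" if "z \<in> closure (g ` E)" "e \<in> E" for z e
        using that sub closure_subset by (metis imageI subsetD subspace_diff)
      show "\<exists>e\<in>E. norm e \<le> (C * (3/2)) * norm z \<and> norm (z - g e) \<le> 1/2 * norm z"
        if z: "z \<in> closure (g ` E)" for z
      proof (cases "z = 0")
        case True
        then show ?thesis using subspace_0[OF E(1)] linear_0[OF lin] by (intro bexI[of _ 0]) auto
      next
        case False
        then obtain w where w: "w \<in> g ` E" "dist w z < 1/2 * norm z"
          using z unfolding closure_approachable by (metis half_gt_zero mult.commute mult_1 times_divide_eq_left zero_less_norm_iff)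
        obtain e where e: "e \<in> E" "g e = w" "norm e \<le> C * norm w" using pre[OF w(1)] by blast
        have "norm w \<le> 3/2 * norm z" using w(2) norm_triangle_sub[of w z] by (simp add: dist_norm)
        then have "C * norm w \<le> C * (3/2 * norm z)" using C by (rule mult_left_mono)
        then show ?thesis using e w by (intro bexI[of _ e]) (auto simp: dist_norm norm_minus_commute)
      qed
    qed (use C in auto)
    then show ?thesis by blast
  qed
  then show ?thesis by (metis closure_subset closure_eq subsetI subset_antisym)
qed

section \<open>Finite-dimensional perturbations and bounded projections\<close>

lemma bounded_linear_scaleC_left: "bounded_linear (\<lambda>c. c *\<^sub>C b)"
proof (rule bounded_linear_intro[of _ "norm b"])
  show "(r *\<^sub>R c) *\<^sub>C b = r *\<^sub>R c *\<^sub>C b" for r c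
    using scaleC_scaleC[of "of_real r" c b] scaleC_of_real[of r "c *\<^sub>C b"] by (simp add: scaleR_conv_of_real)
qed (auto simp: scaleC_add_left norm_scaleC)

text \<open>For a new vector \<open>b\<close> outside \<open>U\<close>, a functional vanishing on
  \<open>U\<close> with \<open>f b = 1\<close> reads off the coefficient of \<open>b\<close>; the
  enlarged sum is then the preimage of \<open>U\<close> under the continuous map
  \<open>x - f x *\<^sub>C b\<close>.\<close>

lemma closed_setsum_fin:
  assumes V: "csubspace V" "closed V" and "finite F"
  shows "closed (setsum V (cspan F))"
  using \<open>finite F\<close>
proof (induction F)
  case empty
  then show ?case using V by (simp add: cspan_eq)
next
  case (insert b F)
  define U where "U = setsum V (cspan F)"
  have U: "csubspace U" "closed U" using insert V by (auto simp: U_def csubspace_setsum)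
  have eq: "setsum V (cspan (insert b F)) = {x. \<exists>k. x - k *\<^sub>C b \<in> U}"
  proof (intro equalityI subsetI)
    fix x assume "x \<in> setsum V (cspan (insert b F))"
    then obtain v w where vw: "x = v + w" "v \<in> V" "w \<in> cspan (insert b F)" by (auto simp: setsum_def)
    then obtain k where "w - k *\<^sub>C b \<in> cspan F" by (auto simp: cspan_eq cvs.span_insert)
    then have "v + (w - k *\<^sub>C b) \<in> U" using vw by (simp add: U_def setsumI)
    then show "x \<in> {x. \<exists>k. x - k *\<^sub>C b \<in> U}" using vw by (auto simp: algebra_simps)
  next
    fix x assume "x \<in> {x. \<exists>k. x - k *\<^sub>C b \<in> U}"
    then obtain k v w where vw: "x - k *\<^sub>C b = v + w" "v \<in> V" "w \<in> cspan F" by (auto simp: U_def setsum_def)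
    have "(w + k *\<^sub>C b) - k *\<^sub>C b \<in> cspan F" using vw by simp
    then have "w + k *\<^sub>C b \<in> cspan (insert b F)" unfolding cspan_eq cvs.span_insert by blast
    moreover have "x = v + (w + k *\<^sub>C b)" using vw by (simp add: algebra_simps)
    ultimately show "x \<in> setsum V (cspan (insert b F))" using vw setsumI by blast
  qed
  show ?case
  proof (cases "b \<in> U")
    case True
    have "x \<in> U" if "x - k *\<^sub>C b \<in> U" for x k
      using csubspace_add[OF U(1) that csubspace_scale[OF U(1) True, of k]] by simp
    moreover have "x - 0 *\<^sub>C b \<in> U" if "x \<in> U" for x
      using csubspace_diff[OF U(1) that csubspace_scale[OF U(1) True, of 0]] .
    ultimately have "{x. \<exists>k. x - k *\<^sub>C b \<in> U} = U" by blast
    then show ?thesis using eq U by simp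
  next
    case False
    then obtain f where f: "cfunctional f" "\<And>v. v \<in> U \<Longrightarrow> f v = 0" "f b = 1"
      using separating_functional[OF U] by metis
    have "x - k *\<^sub>C b \<in> U \<Longrightarrow> k = f x" for x k
      using f(2)[of "x - k *\<^sub>C b"] f by (simp add: cfunctional_diff cfunctional_scale)
    then have "{x. \<exists>k. x - k *\<^sub>C b \<in> U} = (\<lambda>x. x - f x *\<^sub>C b) -` U" by auto
    moreover have "closed ((\<lambda>x. x - f x *\<^sub>C b) -` U)"
    proof -
      have "continuous_on UNIV (\<lambda>x. f x *\<^sub>C b)"
        by (rule continuous_on_compose2[OF linear_continuous_on[OF bounded_linear_scaleC_left, of UNIV] cfunctional_continuous[OF f(1)]]) simp
      then show ?thesis using U(2) by (intro closed_vimage continuous_intros)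
    qed
    ultimately show ?thesis using eq by simp
  qed
qed

lemma closed_setsum_fin_cdim:
  assumes "csubspace V" "closed V" "csubspace F" "fin_cdim F"
  shows "closed (setsum V F)"
proof -
  obtain E where "finite E" "E \<subseteq> F" "F \<subseteq> cspan E" using assms(4) by (auto simp: fin_cdim_def)
  then have "F = cspan E" "finite E" using cspan_minimal[OF _ assms(3), of E] by auto
  then show ?thesis using closed_setsum_fin[OF assms(1,2)] by simp
qed

lemma closed_fin_cdim: "csubspace F \<Longrightarrow> fin_cdim F \<Longrightarrow> closed F"
  using closed_setsum_fin_cdim[of "{0}" F] by simp

text \<open>The open mapping theorem for addition on \<open>A \<times> E\<close>: by uniqueness, the
  preimage with controlled norm is the pair of components.\<close>

lemma direct_sum_projection_bounded:
  assumes d: "direct_sum M A E" and "closed M" "closed A" "closed E"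
  obtains C where "C > 0" "\<And>a b. a \<in> A \<Longrightarrow> b \<in> E \<Longrightarrow> norm a \<le> C * norm (a + b)"
proof -
  have s: "csubspace A" "csubspace E" using d by (auto simp: direct_sum_def)
  define g where "g p = fst p + snd p" for p :: "'a \<times> 'a"
  have g: "bounded_linear g" unfolding g_def by (intro bounded_linear_intros)
  have "M = setsum A E" using d by (simp add: direct_sum_def)
  then have im: "g ` (A \<times> E) = M" unfolding setsum_def g_def image_def by auto
  obtain C where C: "C > 0" "\<And>y. y \<in> M \<Longrightarrow> \<exists>e\<in>A \<times> E. g e = y \<and> norm e \<le> C * norm y"
    using open_mapping[OF g subspace_Times[of A E] closed_Times[OF assms(3,4)]] s assms(2)
    unfolding im by (metis csubspace_imp_subspace)
  have "norm a \<le> C * norm (a + b)" if ab: "a \<in> A" "b \<in> E" for a b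
  proof -
    have "a + b \<in> M" using ab d setsumI by (auto simp: direct_sum_def)
    then obtain a' b' where e: "a' \<in> A" "b' \<in> E" "a' + b' = a + b" "norm (a', b') \<le> C * norm (a + b)"
      using C(2) by (force simp: g_def)
    then have "a' = a" using direct_sum_unique(1)[OF d] ab by metis
    moreover have "norm a' \<le> C * norm (a + b)" using e(4) norm_fst_le[of a' b'] by (rule order_trans[rotated])
    ultimately show ?thesis by simp
  qed
  with C(1) that show thesis by blast
qed

text \<open>Modulo the span already treated, a new vector contributes only its component
  \<open>z\<close> in the closed complement \<open>Z\<close>; if \<open>z\<close> is nonzero,
  \<open>Z\<close> is cut down to the kernel of a functional with value 1 at
  \<open>z\<close>.\<close>

lemma closed_complement_fin:
  assumes M: "csubspace M" "closed M" and "finite F" "F \<subseteq> M"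
  shows "\<exists>Z. direct_sum M (cspan F) Z \<and> closed Z"
  using \<open>finite F\<close> \<open>F \<subseteq> M\<close>
proof (induction F)
  case empty
  then show ?case using M by (auto simp: cspan_eq intro!: exI[of _ M] direct_sum_commute[OF direct_sum_trivial])
next
  case (insert b F)
  then obtain Z where Z: "direct_sum M (cspan F) Z" "closed Z" by auto
  have sZ: "csubspace Z" using Z by (simp add: direct_sum_def)
  have bM: "b \<in> M" using insert by simp
  obtain v z where vz: "v \<in> cspan F" "z \<in> Z" "b = v + z" by (rule direct_sumE[OF Z(1) bM])
  have span: "cspan (insert b F) = setsum (cspan F) (cspan {z})"
  proof -
    have "b - z \<in> cvs.span F" using vz by (simp add: cspan_eq)
    then have "cvs.span (insert b F) = cvs.span (insert z F)" by (rule cvs.eq_span_insert_eq)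
    then show ?thesis using cspan_Un[of F "{z}"] by (simp add: cspan_eq)
  qed
  have zs: "cspan {z} = range (\<lambda>k. k *\<^sub>C z)" by (simp add: cspan_eq cvs.span_singleton)
  show ?case
  proof (cases "z = 0")
    case True
    then show ?thesis using Z span by (auto simp: cspan_eq)
  next
    case False
    obtain f where f: "cfunctional f" "f z = 1"
      using separating_functional[of "{0::'a}" z] False by auto
    define Z' where "Z' = Z \<inter> f -` {0}"
    have cl: "closed Z'" unfolding Z'_def using Z(2) cfunctional_continuous[OF f(1)] by (intro closed_Int closed_vimage) auto
    have sZ': "csubspace Z'" using sZ f(1) by (auto simp: Z'_def csubspace_def cfunctional_0 cfunctional_add cfunctional_scale)
    have "direct_sum Z (cspan {z}) Z'"
    proof -
      have "cspan {z} \<inter> Z' = {0}"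
        using f csubspace_0[OF sZ'] csubspace_0[OF csubspace_cspan, of "{z}"]
        by (auto simp: zs Z'_def cfunctional_scale)
      moreover have "setsum (cspan {z}) Z' = Z"
      proof (intro equalityI subsetI)
        fix x assume "x \<in> setsum (cspan {z}) Z'"
        then show "x \<in> Z" using vz(2) sZ by (auto simp: zs setsum_def Z'_def csubspace_add csubspace_scale)
      next
        fix x assume x: "x \<in> Z"
        have "x - f x *\<^sub>C z \<in> Z'" using x vz(2) sZ f
          by (auto simp: Z'_def csubspace_diff csubspace_scale cfunctional_diff cfunctional_scale)
        then have "f x *\<^sub>C z + (x - f x *\<^sub>C z) \<in> setsum (cspan {z}) Z'" by (intro setsumI) (auto simp: zs)
        then show "x \<in> setsum (cspan {z}) Z'" by simp
      qed
      ultimately show ?thesis using sZ' by (simp add: direct_sum_def)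
    qed
    from direct_sum_assoc(1)[OF Z(1) this] cl span show ?thesis by auto
  qed
qed

lemma closed_complement_exists:
  assumes "csubspace M" "closed M" "csubspace F" "fin_cdim F" "F \<subseteq> M"
  obtains Z where "direct_sum M F Z" "closed Z"
proof -
  obtain E where "finite E" "E \<subseteq> F" "F \<subseteq> cspan E" using assms(4) by (auto simp: fin_cdim_def)
  then have "F = cspan E" "finite E" "E \<subseteq> M" using assms(5) cspan_minimal[OF _ assms(3), of E] by auto
  then show thesis using closed_complement_fin[OF assms(1,2)] that by metis
qed


subsection \<open>Stability of Kato operators\<close>

lemma bounded_clinear_imp: "bounded_clinear S \<Longrightarrow> bounded_linear S"
  and bounded_clinear_add: "bounded_clinear S \<Longrightarrow> S (x + y) = S x + S y"
  and bounded_clinear_diff: "bounded_clinear S \<Longrightarrow> S (x - y) = S x - S y"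
  and bounded_clinear_scale: "bounded_clinear S \<Longrightarrow> S (c *\<^sub>C x) = c *\<^sub>C S x"
  and bounded_clinear_0: "bounded_clinear S \<Longrightarrow> S 0 = 0"
  by (simp_all add: bounded_clinear_def bounded_linear.linear linear_add linear_diff linear_0)

lemmas bounded_clinear_simps = bounded_clinear_add bounded_clinear_diff bounded_clinear_scale bounded_clinear_0

lemma bounded_linear_scaleC_right: "bounded_linear (\<lambda>x. c *\<^sub>C x)"
  by (rule bounded_linear_intro[of _ "cmod c"])
    (simp_all add: scaleC_add_right norm_scaleC scaleC_real_commute mult.commute)

lemma scaleC_0_left [simp]: "0 *\<^sub>C x = 0"
  and scaleC_0_right [simp]: "c *\<^sub>C 0 = 0"
  and scaleC_diff_right: "c *\<^sub>C (x - y) = c *\<^sub>C x - c *\<^sub>C y"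
  by (simp_all add: cvs.scale_right_diff_distrib)

lemma bounded_clinear_shiftop: "bounded_clinear S \<Longrightarrow> bounded_clinear (shiftop S l)"
  unfolding shiftop_def bounded_clinear_def
  by (simp add: bounded_linear_sub bounded_linear_scaleC_right scaleC_diff_right scaleC_scaleC mult.commute)

lemma shiftop_shiftop [simp]: "shiftop (shiftop S a) b = shiftop S (a + b)"
  by (simp add: shiftop_def scaleC_add_left algebra_simps)

lemma shiftop_0 [simp]: "shiftop S 0 = S"
  by (simp add: shiftop_def)

lemma bounded_clinear_funpow: "bounded_clinear S \<Longrightarrow> bounded_clinear (S ^^ n)"
proof (induction n)
  case (Suc n)
  then show ?case
    by (auto simp: bounded_clinear_def o_def intro: bounded_linear_compose)
qed (simp add: bounded_clinear_def id_def)

lemma closed_invD: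
  assumes "closed_inv S M"
  shows "csubspace M" "closed M" "subspace M" "x \<in> M \<Longrightarrow> S x \<in> M" "S ` M \<subseteq> M"
  using assms by (auto simp: closed_inv_def csubspace_imp_subspace)

lemma closed_inv_funpow: "closed_inv S M \<Longrightarrow> x \<in> M \<Longrightarrow> (S ^^ n) x \<in> M"
  by (induction n) (auto simp: closed_inv_def)

lemma closed_inv_shiftop: "closed_inv S M \<Longrightarrow> closed_inv (shiftop S l) M"
  unfolding closed_inv_def shiftop_def by (auto intro!: csubspace_diff csubspace_scale)

lemma csubspace_kerOn: "bounded_clinear S \<Longrightarrow> csubspace M \<Longrightarrow> csubspace (kerOn M S)"
  by (auto simp: kerOn_def csubspace_def bounded_clinear_simps)

lemma csubspace_image:
  assumes "bounded_clinear S" "csubspace M"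
  shows "csubspace (S ` M)"
  unfolding csubspace_def
proof (intro conjI ballI allI)
  show "0 \<in> S ` M" using assms csubspace_0 bounded_clinear_0 by (metis image_eqI)
  fix x assume "x \<in> S ` M"
  then obtain a where a: "a \<in> M" "x = S a" by blast
  show "c *\<^sub>C x \<in> S ` M" for c
    using a assms by (auto simp: bounded_clinear_scale[symmetric] csubspace_scale)
  fix y assume "y \<in> S ` M"
  then show "x + y \<in> S ` M"
    using a assms by (auto simp: bounded_clinear_add[symmetric] csubspace_add)
qed

lemma kerOn_subset: "kerOn M S \<subseteq> M"
  by (auto simp: kerOn_def)

lemma kerOn_mono: "A \<subseteq> M \<Longrightarrow> kerOn A S = A \<inter> kerOn M S"
  by (auto simp: kerOn_def)

lemma injective_closed_range_bounded_below:
  assumes S: "bounded_clinear S" and Z: "csubspace Z" "closed Z" "closed (S ` Z)"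
    and inj: "kerOn Z S \<subseteq> {0}"
  obtains c where "c > 0" "\<And>x. x \<in> Z \<Longrightarrow> c * norm x \<le> norm (S x)"
proof -
  obtain C where C: "C > 0" "\<And>y. y \<in> S ` Z \<Longrightarrow> \<exists>e\<in>Z. S e = y \<and> norm e \<le> C * norm y"
    using open_mapping[OF bounded_clinear_imp[OF S] csubspace_imp_subspace[OF Z(1)] Z(2,3)] by metis
  have "inverse C * norm x \<le> norm (S x)" if x: "x \<in> Z" for x
  proof -
    obtain e where e: "e \<in> Z" "S e = S x" "norm e \<le> C * norm (S x)" using C(2)[of "S x"] x by blast
    have "e - x \<in> kerOn Z S" using e x Z S by (simp add: kerOn_def csubspace_diff bounded_clinear_diff)
    then have "e = x" using inj by auto
    then show ?thesis using e C(1) by (simp add: field_simps)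
  qed
  with C(1) that[of "inverse C"] show thesis by simp
qed

lemma bounded_below_closed_range:
  assumes S: "bounded_clinear S" and Z: "csubspace Z" "closed Z"
    and c: "c > 0" "\<And>x. x \<in> Z \<Longrightarrow> c * norm x \<le> norm (S x)"
  shows "closed (S ` Z)"
proof (rule closed_image_bounded_preimage[OF bounded_clinear_imp[OF S] csubspace_imp_subspace[OF Z(1)] Z(2), of "inverse c"])
  show "\<exists>e\<in>Z. S e = y \<and> norm e \<le> inverse c * norm y" if "y \<in> S ` Z" for y
    using that c by (auto simp: field_simps)
qed (use c in simp)

text \<open>Any preimage in \<open>M\<close> of a vector of the image of \<open>V\<close> differs
  from one in \<open>V\<close> by a kernel vector, so it lies in \<open>V\<close>; the preimage
  bound for \<open>M\<close> is inherited.\<close>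

lemma closed_image_ker_subset:
  assumes S: "bounded_clinear S" and M: "csubspace M" "closed M" "closed (S ` M)"
    and V: "csubspace V" "closed V" "kerOn M S \<subseteq> V" "V \<subseteq> M"
  shows "closed (S ` V)"
proof -
  obtain C where C: "C > 0" "\<And>y. y \<in> S ` M \<Longrightarrow> \<exists>e\<in>M. S e = y \<and> norm e \<le> C * norm y"
    using open_mapping[OF bounded_clinear_imp[OF S] csubspace_imp_subspace[OF M(1)] M(2,3)] by metis
  show ?thesis
  proof (rule closed_image_bounded_preimage[OF bounded_clinear_imp[OF S] csubspace_imp_subspace[OF V(1)] V(2)])
    fix y assume "y \<in> S ` V"
    then obtain v where v: "v \<in> V" "y = S v" by blast
    then obtain e where e: "e \<in> M" "S e = y" "norm e \<le> C * norm y" using C(2)[of y] V(4) by blast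
    have "e - v \<in> kerOn M S" using e v V(4) M S by (auto simp: kerOn_def csubspace_diff bounded_clinear_diff)
    then have "(e - v) + v \<in> V" using V v csubspace_add by blast
    then show "\<exists>e\<in>V. S e = y \<and> norm e \<le> C * norm y" using e by (intro bexI[of _ e]) auto
  qed (use C in simp)
qed

section \<open>The generalized range of a Kato operator\<close>

definition Rinf :: "'a::complex_banach set \<Rightarrow> ('a \<Rightarrow> 'a) \<Rightarrow> 'a set" where
  "Rinf M S = (\<Inter>n. (S ^^ n) ` M)"

lemma image_funpow_Suc: "(S ^^ Suc n) ` M = S ` ((S ^^ n) ` M)"
  by (simp add: image_comp)

lemma image_funpow_Suc': "(S ^^ Suc n) ` M = (S ^^ n) ` (S ` M)"
  by (simp add: funpow_Suc_right image_comp del: funpow.simps)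

lemma image_funpow_decreasing:
  assumes "closed_inv S M" "m \<le> n"
  shows "(S ^^ n) ` M \<subseteq> (S ^^ m) ` M"
  using assms(2)
proof (induction n rule: dec_induct)
  case (step n)
  have "(S ^^ Suc n) ` M \<subseteq> (S ^^ n) ` M"
    unfolding image_funpow_Suc' using closed_invD(5)[OF assms(1)] by (rule image_mono)
  with step show ?case by blast
qed simp

lemma image_funpow_subset: "closed_inv S M \<Longrightarrow> (S ^^ n) ` M \<subseteq> M"
  using closed_inv_funpow by blast

text \<open>The kernel condition is asked only for powers below \<open>n\<close>, so that the lemma
  still applies to the first power whose range misses a kernel vector; the splitting of a Jordan
  block needs exactly this case.\<close>

lemma closed_range_funpow:
  assumes S: "bounded_clinear S" and M: "closed_inv S M" and cl: "closed (S ` M)"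
    and ker: "\<And>m. m < n \<Longrightarrow> kerOn M S \<subseteq> (S ^^ m) ` M"
  shows "closed ((S ^^ n) ` M)"
  using ker
proof (induction n)
  case 0
  then show ?case using closed_invD(2)[OF M] by simp
next
  case (Suc n)
  then have IH: "closed ((S ^^ n) ` M)" by simp
  show ?case unfolding image_funpow_Suc
    by (rule closed_image_ker_subset[OF S closed_invD(1,2)[OF M] cl _ IH])
      (use Suc.prems csubspace_image[OF bounded_clinear_funpow[OF S] closed_invD(1)[OF M]] image_funpow_subset[OF M] in auto)
qed

lemma Rinf_subset: "Rinf M S \<subseteq> M"
proof
  fix x assume "x \<in> Rinf M S"
  then have "x \<in> (S ^^ 0) ` M" unfolding Rinf_def by blast
  then show "x \<in> M" by simp
qed

lemma csubspace_Rinf: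
  assumes "bounded_clinear S" "csubspace M"
  shows "csubspace (Rinf M S)"
  using cvs.subspace_Inter[of "range (\<lambda>n. (S ^^ n) ` M)"]
    csubspace_image[OF bounded_clinear_funpow[OF assms(1)] assms(2)]
  by (auto simp: csubspace_iff Rinf_def)

lemma closed_Rinf:
  assumes "bounded_clinear S" "closed_inv S M" "Kato_on M S"
  shows "closed (Rinf M S)"
  unfolding Rinf_def using closed_range_funpow[OF assms(1,2)] assms(3)
  by (intro closed_INT) (auto simp: Kato_on_def)

text \<open>Any two preimages of \<open>S y\<close> differ by a kernel vector, which lies in the
  range of every power. Hence \<open>S\<close> maps \<open>Rinf M S\<close> onto itself, not merely
  into itself.\<close>

lemma Rinf_preimage:
  assumes S: "bounded_clinear S" "closed_inv S M" and ker: "\<And>n. kerOn M S \<subseteq> (S ^^ n) ` M"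
    and y: "y \<in> M" "S y \<in> Rinf M S"
  shows "y \<in> Rinf M S"
  unfolding Rinf_def
proof
  fix n
  have "S y \<in> (S ^^ Suc n) ` M" using y(2) by (auto simp: Rinf_def simp del: funpow.simps)
  then obtain z where z: "z \<in> M" "S y = S ((S ^^ n) z)" by auto
  have zn: "(S ^^ n) z \<in> M" using closed_inv_funpow[OF S(2) z(1)] .
  have "y - (S ^^ n) z \<in> kerOn M S"
    using z y(1) zn S closed_invD(1)[OF S(2)] by (simp add: kerOn_def csubspace_diff bounded_clinear_diff)
  then have "y - (S ^^ n) z \<in> (S ^^ n) ` M" using ker by blast
  moreover have "(S ^^ n) z \<in> (S ^^ n) ` M" using z by blast
  ultimately have "(y - (S ^^ n) z) + (S ^^ n) z \<in> (S ^^ n) ` M"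
    by (intro csubspace_add csubspace_image bounded_clinear_funpow S(1) closed_invD(1)[OF S(2)])
  then show "y \<in> (S ^^ n) ` M" by simp
qed

lemma Rinf_invariant:
  assumes "closed_inv S M" "x \<in> Rinf M S"
  shows "S x \<in> Rinf M S"
  unfolding Rinf_def
proof
  fix n
  have "x \<in> (S ^^ n) ` M" using assms(2) by (auto simp: Rinf_def)
  then have "S x \<in> (S ^^ Suc n) ` M" unfolding image_funpow_Suc by blast
  then show "S x \<in> (S ^^ n) ` M" using image_funpow_decreasing[OF assms(1), of n "Suc n"] by auto
qed

lemma Kato_Rinf_preimage:
  assumes S: "bounded_clinear S" "closed_inv S M" "Kato_on M S"
  obtains C where "C > 0" "\<And>x. x \<in> Rinf M S \<Longrightarrow> \<exists>y\<in>Rinf M S. S y = x \<and> norm y \<le> C * norm x"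
proof -
  have cl: "closed (S ` M)" and ker: "\<And>n. kerOn M S \<subseteq> (S ^^ n) ` M" using S(3) by (auto simp: Kato_on_def)
  obtain C where C: "C > 0" "\<And>y. y \<in> S ` M \<Longrightarrow> \<exists>e\<in>M. S e = y \<and> norm e \<le> C * norm y"
    using open_mapping[OF bounded_clinear_imp[OF S(1)] closed_invD(3,2)[OF S(2)] cl] by metis
  have "\<exists>y\<in>Rinf M S. S y = x \<and> norm y \<le> C * norm x" if x: "x \<in> Rinf M S" for x
  proof -
    have "x \<in> (S ^^ 1) ` M" using x unfolding Rinf_def by blast
    then obtain e where "e \<in> M" "S e = x" "norm e \<le> C * norm x" using C(2)[of x] by auto
    with x Rinf_preimage[OF S(1,2) ker] show ?thesis by (intro bexI[of _ e]) auto
  qed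
  with C(1) that show thesis by blast
qed

text \<open>A preimage under \<open>S\<close> is an approximate preimage under \<open>S - l\<close>
  with relative error \<open>cmod l * C\<close>, which is below one half for
  \<open>cmod l < 1 / (2 * C)\<close>.\<close>

lemma Kato_shift_Rinf:
  assumes S: "bounded_clinear S" "closed_inv S M" "Kato_on M S"
  obtains r C where "r > 0" "C > 0"
    "\<And>l x. cmod l < r \<Longrightarrow> x \<in> Rinf M S \<Longrightarrow> \<exists>y\<in>Rinf M S. shiftop S l y = x \<and> norm y \<le> C * norm x"
proof -
  obtain C where C: "C > 0" "\<And>x. x \<in> Rinf M S \<Longrightarrow> \<exists>y\<in>Rinf M S. S y = x \<and> norm y \<le> C * norm x"
    using Kato_Rinf_preimage[OF S] by blast
  have sR: "csubspace (Rinf M S)" using csubspace_Rinf[OF S(1) closed_invD(1)[OF S(2)]] .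
  have "\<exists>y\<in>Rinf M S. shiftop S l y = x \<and> norm y \<le> C / (1 - 1/2) * norm x"
    if l: "cmod l < 1 / (2 * C)" and x: "x \<in> Rinf M S" for l x
  proof (rule approximate_surjectivity[OF _ csubspace_imp_subspace[OF sR] closed_Rinf[OF S] _ _ _ _ _ x])
    show "bounded_linear (shiftop S l)" using bounded_clinear_imp[OF bounded_clinear_shiftop[OF S(1)]] .
    show "y - shiftop S l e \<in> Rinf M S" if "y \<in> Rinf M S" "e \<in> Rinf M S" for y e
      using that Rinf_invariant[OF S(2)] sR unfolding shiftop_def by (intro csubspace_diff csubspace_scale) auto
    fix y assume "y \<in> Rinf M S"
    then obtain e where e: "e \<in> Rinf M S" "S e = y" "norm e \<le> C * norm y" using C(2) by blast
    have "norm (y - shiftop S l e) = cmod l * norm e" using e by (simp add: shiftop_def norm_scaleC)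
    also have "\<dots> \<le> 1 / (2 * C) * (C * norm y)" using l e C(1) by (intro mult_mono) auto
    also have "\<dots> = 1/2 * norm y" using C(1) by simp
    finally show "\<exists>e\<in>Rinf M S. norm e \<le> C * norm y \<and> norm (y - shiftop S l e) \<le> 1/2 * norm y" using e by blast
  qed (use C in auto)
  then show thesis using that[of "1 / (2 * C)" "C / (1 - 1/2)"] C(1) by simp
qed

text \<open>An eigenvector for \<open>l \<noteq> 0\<close> is the image under \<open>S ^^ n\<close>
  of its own multiple by \<open>inverse l ^ n\<close>; for \<open>l = 0\<close> this is the
  assumption on the kernel.\<close>

lemma kernel_shift_subset_Rinf:
  assumes S: "bounded_clinear S" "closed_inv S M" and ker: "\<And>n. kerOn M S \<subseteq> (S ^^ n) ` M"
  shows "kerOn M (shiftop S l) \<subseteq> Rinf M S"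
proof
  fix x assume "x \<in> kerOn M (shiftop S l)"
  then have x: "x \<in> M" "S x = l *\<^sub>C x" by (auto simp: kerOn_def shiftop_def)
  show "x \<in> Rinf M S"
  proof (cases "l = 0")
    case True
    then have "x \<in> kerOn M S" using x by (simp add: kerOn_def)
    then show ?thesis using ker by (auto simp: Rinf_def)
  next
    case False
    have "(S ^^ n) (inverse l ^ n *\<^sub>C x) = x" for n
    proof (induction n)
      case (Suc n)
      have "(S ^^ Suc n) (inverse l ^ Suc n *\<^sub>C x) = inverse l *\<^sub>C S ((S ^^ n) (inverse l ^ n *\<^sub>C x))"
        by (simp add: bounded_clinear_scale[OF bounded_clinear_funpow[OF S(1)]] bounded_clinear_scale[OF S(1)] scaleC_scaleC)
      then show ?case using Suc x(2) False by (simp add: scaleC_scaleC scaleC_one)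
    qed (simp add: scaleC_one)
    moreover have "inverse l ^ n *\<^sub>C x \<in> M" for n using x(1) closed_invD(1)[OF S(2)] by (simp add: csubspace_scale)
    ultimately show ?thesis unfolding Rinf_def by (metis INT_I image_eqI)
  qed
qed

text \<open>If \<open>S x = 0\<close> and \<open>y\<close> solves \<open>(S - l) y = x\<close> in
  \<open>Rinf M S\<close>, then \<open>S - l\<close> kills \<open>x + l y\<close>, because
  \<open>(S - l) x = - l x\<close>. The correction \<open>l y\<close> is small with
  \<open>l\<close>.\<close>

lemma Kato_kernel_approximation:
  assumes S: "bounded_clinear S" "closed_inv S M" "Kato_on M S"
  obtains r C where "r > 0" "C > 0"
    "\<And>l x. cmod l < r \<Longrightarrow> x \<in> kerOn M S \<Longrightarrow> \<exists>z\<in>kerOn M (shiftop S l). norm (x - z) \<le> cmod l * C * norm x"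
proof -
  obtain r C where rC: "r > 0" "C > 0"
    "\<And>l x. cmod l < r \<Longrightarrow> x \<in> Rinf M S \<Longrightarrow> \<exists>y\<in>Rinf M S. shiftop S l y = x \<and> norm y \<le> C * norm x"
    using Kato_shift_Rinf[OF S] by blast
  have "\<exists>z\<in>kerOn M (shiftop S l). norm (x - z) \<le> cmod l * C * norm x"
    if l: "cmod l < r" and x: "x \<in> kerOn M S" for l x
  proof -
    have "x \<in> Rinf M S" using x S(3) by (auto simp: Kato_on_def Rinf_def)
    then obtain y where y: "y \<in> Rinf M S" "shiftop S l y = x" "norm y \<le> C * norm x" using rC(3)[OF l] by blast
    have "y \<in> M" "x \<in> M" "S x = 0" using y(1) Rinf_subset x by (auto simp: kerOn_def)
    then have "x + l *\<^sub>C y \<in> M" using closed_invD(1)[OF S(2)] by (simp add: csubspace_add csubspace_scale)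
    moreover have "shiftop S l (x + l *\<^sub>C y) = 0"
    proof -
      have "shiftop S l (x + l *\<^sub>C y) = shiftop S l x + l *\<^sub>C shiftop S l y"
        by (simp add: bounded_clinear_simps[OF bounded_clinear_shiftop[OF S(1)]])
      then show ?thesis using \<open>S x = 0\<close> y(2) by (simp add: shiftop_def)
    qed
    ultimately have "x + l *\<^sub>C y \<in> kerOn M (shiftop S l)" by (simp add: kerOn_def)
    moreover have "norm (x - (x + l *\<^sub>C y)) \<le> cmod l * C * norm x"
      using mult_left_mono[OF y(3), of "cmod l"] by (simp add: norm_scaleC)
    ultimately show ?thesis by blast
  qed
  with rC that show thesis by blast
qed

text \<open>The distance of \<^term>\<open>x\<close> to the kernel of \<^term>\<open>S - l\<close> is estimated by a multiple of itself below
  one half plus a multiple of \<^term>\<open>norm ((S - l) x)\<close>, so it can be absorbed.\<close>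

lemma Kato_uniform_preimage:
  assumes S: "bounded_clinear S" "closed_inv S M" "Kato_on M S"
  obtains r C where "r > 0" "C > 0"
    "\<And>l y. cmod l < r \<Longrightarrow> y \<in> shiftop S l ` M \<Longrightarrow> \<exists>x\<in>M. shiftop S l x = y \<and> norm x \<le> C * norm y"
proof -
  note M = closed_invD[OF S(2)]
  have cl: "closed (S ` M)" using S(3) by (auto simp: Kato_on_def)
  obtain C where C: "C > 0" "\<And>y. y \<in> S ` M \<Longrightarrow> \<exists>e\<in>M. S e = y \<and> norm e \<le> C * norm y"
    using open_mapping[OF bounded_clinear_imp[OF S(1)] M(3,2) cl] by metis
  obtain r D where rD: "r > 0" "D > 0"
    "\<And>l x. cmod l < r \<Longrightarrow> x \<in> kerOn M S \<Longrightarrow> \<exists>z\<in>kerOn M (shiftop S l). norm (x - z) \<le> cmod l * D * norm x"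
    using Kato_kernel_approximation[OF S] by blast
  \<comment> \<open>With \<open>cmod l * D \<le> 1/8\<close> and \<open>cmod l * C \<le> 1/4\<close>
    the factor of \<open>norm x\<close> in the estimate below is at most \<open>13/32\<close>, hence
    below one half.\<close>
  define \<rho> where "\<rho> = min r (min (1 / (8 * D)) (1 / (4 * C)))"
  have "\<exists>x\<in>M. shiftop S l x = y \<and> norm x \<le> (6 * C) * norm y"
    if l: "cmod l < \<rho>" and y: "y \<in> shiftop S l ` M" for l y
  proof -
    have l3: "cmod l < r" "cmod l * D \<le> 1/8" "cmod l * C \<le> 1/4"
      using l rD C by (auto simp: \<rho>_def field_simps)
    let ?K = "kerOn M (shiftop S l)"
    have sK: "csubspace ?K" by (rule csubspace_kerOn[OF bounded_clinear_shiftop[OF S(1)] M(1)])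
    have step: "\<exists>z\<in>?K. norm (x - z) \<le> 1/2 * norm x + 2 * C * norm y" if x: "x \<in> M" "shiftop S l x = y" for x
    proof -
      obtain u where u: "u \<in> M" "S u = S x" "norm u \<le> C * norm (S x)" using C(2)[of "S x"] x(1) by blast
      have "S x = l *\<^sub>C x + y" using x(2) by (auto simp: shiftop_def)
      then have "norm (S x) \<le> cmod l * norm x + norm y" by (metis norm_scaleC norm_triangle_ineq)
      then have "norm u \<le> C * (cmod l * norm x + norm y)" using u(3) C(1) by (meson mult_left_mono order_trans less_imp_le)
      also have "\<dots> = (cmod l * C) * norm x + C * norm y" by (simp add: algebra_simps)
      also have "\<dots> \<le> 1/4 * norm x + C * norm y" using l3(3) by (intro add_right_mono mult_right_mono) auto
      finally have nu: "norm u \<le> 1/4 * norm x + C * norm y" .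
      have "x - u \<in> kerOn M S" using u x M(1) S(1) by (simp add: kerOn_def csubspace_diff bounded_clinear_diff)
      then obtain z where z: "z \<in> ?K" "norm (x - u - z) \<le> cmod l * D * norm (x - u)" using rD(3)[OF l3(1)] by blast
      have "cmod l * D * norm (x - u) \<le> 1/8 * (norm x + norm u)"
        using l3(2) norm_triangle_ineq4[of x u] by (intro mult_mono) auto
      moreover have "norm (x - z) \<le> norm u + norm (x - u - z)"
        using norm_triangle_ineq[of u "x - u - z"] by simp
      ultimately have "norm (x - z) \<le> norm u + 1/8 * (norm x + norm u)" using z(2) by linarith
      also have "\<dots> \<le> 1/2 * norm x + 2 * C * norm y"
      proof -
        have "0 \<le> C * norm y" using C(1) by simp
        moreover have "u' + 1/8 * (x' + u') \<le> 1/2 * x' + 2 * c" if "0 \<le> c" "u' \<le> 1/4 * x' + c" "0 \<le> x'" for c u' x' :: real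
          using that by (simp add: field_simps)
        ultimately show ?thesis using nu unfolding mult.assoc by simp
      qed
      finally show ?thesis using z(1) by blast
    qed
    obtain x where x: "x \<in> M" "shiftop S l x = y" using y by blast
    show ?thesis
    proof (cases "y = 0")
      case True
      then show ?thesis using csubspace_0[OF M(1)] S(1) by (intro bexI[of _ 0]) (auto simp: shiftop_def bounded_clinear_0)
    next
      case False
      define d where "d = (INF z\<in>?K. norm (x - z))"
      have ne: "?K \<noteq> {}" using csubspace_0[OF sK] by blast
      have bdd: "bdd_below ((\<lambda>z. norm (x - z)) ` ?K)" by (rule bdd_belowI[of _ 0]) auto
      \<comment> \<open>Translating \<open>x\<close> by a kernel vector does not change its distance
        \<open>d\<close> to the kernel, so the estimate may be applied to \<open>x - z\<close> with
        \<open>z\<close> nearly optimal.\<close>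
      have "d \<le> 1/2 * norm (x - z) + 2 * C * norm y" if z: "z \<in> ?K" for z
      proof -
        have "x - z \<in> M" "shiftop S l (x - z) = y"
          using x z M(1) by (auto simp: kerOn_def csubspace_diff bounded_clinear_diff[OF bounded_clinear_shiftop[OF S(1)]])
        then obtain w where w: "w \<in> ?K" "norm (x - z - w) \<le> 1/2 * norm (x - z) + 2 * C * norm y" using step by blast
        have "d \<le> norm (x - (z + w))" unfolding d_def by (rule cINF_lower[OF bdd csubspace_add[OF sK z w(1)]])
        then show ?thesis using w(2) by (simp add: diff_diff_eq)
      qed
      then have "2 * (d - 2 * C * norm y) \<le> norm (x - z)" if "z \<in> ?K" for z
        using that by (fastforce simp: algebra_simps)
      then have "2 * (d - 2 * C * norm y) \<le> d" by (subst (2) d_def, intro cINF_greatest[OF ne])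
      then have "d \<le> 4 * C * norm y" by simp
      \<comment> \<open>The infimum need not be attained; a constant strictly larger than 4 leaves
        room to choose \<open>z\<close>.\<close>
      also have "\<dots> < 6 * C * norm y" using False C(1) by simp
      finally obtain z where z: "z \<in> ?K" "norm (x - z) < 6 * C * norm y"
        unfolding d_def using cINF_less_iff[OF ne bdd] by blast
      have "x - z \<in> M" "shiftop S l (x - z) = y"
        using x z M(1) by (auto simp: kerOn_def csubspace_diff bounded_clinear_diff[OF bounded_clinear_shiftop[OF S(1)]])
      with z(2) show ?thesis by (intro bexI[of _ "x - z"]) auto
    qed
  qed
  moreover have "\<rho> > 0" using rD C by (simp add: \<rho>_def)
  ultimately show thesis using that[of \<rho> "6 * C"] C(1) by simp
qed

text \<open>The kernel of \<open>S - l\<close> lies in \<open>Rinf M S\<close>, on which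
  \<open>S - l\<close> is still onto, so it lies in the range of every power of
  \<open>S - l\<close>. Closedness of the range is the preimage bound just proved.\<close>

lemma Kato_on_shift:
  assumes S: "bounded_clinear S" "closed_inv S M" "Kato_on M S"
  obtains r where "r > 0" "\<And>l. cmod l < r \<Longrightarrow> Kato_on M (shiftop S l)"
proof -
  note M = closed_invD[OF S(2)]
  obtain r1 C where rC: "r1 > 0" "C > 0"
    "\<And>l x. cmod l < r1 \<Longrightarrow> x \<in> Rinf M S \<Longrightarrow> \<exists>y\<in>Rinf M S. shiftop S l y = x \<and> norm y \<le> C * norm x"
    using Kato_shift_Rinf[OF S] by blast
  obtain r2 D where rD: "r2 > 0" "D > 0"
    "\<And>l y. cmod l < r2 \<Longrightarrow> y \<in> shiftop S l ` M \<Longrightarrow> \<exists>x\<in>M. shiftop S l x = y \<and> norm x \<le> D * norm y"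
    using Kato_uniform_preimage[OF S] by blast
  have "Kato_on M (shiftop S l)" if l: "cmod l < min r1 r2" for l
    unfolding Kato_on_def
  proof (intro conjI allI)
    show "closed (shiftop S l ` M)"
      by (rule closed_image_bounded_preimage[OF bounded_clinear_imp[OF bounded_clinear_shiftop[OF S(1)]] M(3,2), of D])
        (use l rD in auto)
    fix n
    have "Rinf M S \<subseteq> (shiftop S l ^^ n) ` Rinf M S"
    proof (induction n)
      case (Suc n)
      have "Rinf M S \<subseteq> shiftop S l ` Rinf M S"
      proof
        fix x assume "x \<in> Rinf M S"
        then obtain y where "y \<in> Rinf M S" "shiftop S l y = x" using rC(3)[of l x] l by auto
        then show "x \<in> shiftop S l ` Rinf M S" by blast
      qed
      also have "\<dots> \<subseteq> (shiftop S l ^^ Suc n) ` Rinf M S"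
        unfolding image_funpow_Suc using Suc by (rule image_mono)
      finally show ?case .
    qed simp
    also have "\<dots> \<subseteq> (shiftop S l ^^ n) ` M" using Rinf_subset by (rule image_mono)
    finally show "kerOn M (shiftop S l) \<subseteq> (shiftop S l ^^ n) ` M"
      using kernel_shift_subset_Rinf[OF S(1,2), of l] S(3) by (auto simp: Kato_on_def)
  qed
  then show thesis using that[of "min r1 r2"] rC rD by simp
qed

section \<open>Constancy of nullity and deficiency\<close>

text \<open>A subspace \<open>F\<close> of the kernel of dimension \<open>n + 1\<close> has a closed
  complement \<open>Z\<close>. The kernel \<open>V\<close> of \<open>S - l\<close> approximates
  \<open>F\<close> so well that \<open>V + Z\<close> is still all of \<open>M\<close>; if
  \<open>V\<close> had dimension at most \<open>n\<close>, so would every complement of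
  \<open>Z\<close>, in particular \<open>F\<close>.\<close>

lemma Kato_nullity_lower:
  assumes S: "bounded_clinear S" "closed_inv S M" "Kato_on M S" and n: "\<not> cdim_le (kerOn M S) n"
  obtains r where "r > 0" "\<And>l. cmod l < r \<Longrightarrow> \<not> cdim_le (kerOn M (shiftop S l)) n"
proof -
  note M = closed_invD[OF S(2)]
  obtain I where I: "finite I" "card I = Suc n" "I \<subseteq> kerOn M S" "cvs.independent I" using not_cdim_le[OF n] .
  define F where "F = cspan I"
  have F: "csubspace F" "F \<subseteq> kerOn M S" "F \<subseteq> M" "fin_cdim F" "closed F" "I \<subseteq> F"
    using cspan_minimal[OF I(3) csubspace_kerOn[OF S(1) M(1)]] kerOn_subset[of M S] closed_setsum_fin[of "{0}" I] cspan_superset[of I] I(1)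
    unfolding F_def fin_cdim_def by auto
  obtain Z where Z: "direct_sum M F Z" "closed Z" using closed_complement_exists[OF M(1,2) F(1,4,3)] .
  have sZ: "csubspace Z" "Z \<subseteq> M" using Z direct_sum_subspace[OF Z(1)] by (auto simp: direct_sum_def)
  obtain P where P: "P > 0" "\<And>a b. a \<in> F \<Longrightarrow> b \<in> Z \<Longrightarrow> norm a \<le> P * norm (a + b)"
    using direct_sum_projection_bounded[OF Z(1) M(2) F(5) Z(2)] by blast
  obtain r D where rD: "r > 0" "D > 0"
    "\<And>l x. cmod l < r \<Longrightarrow> x \<in> kerOn M S \<Longrightarrow> \<exists>z\<in>kerOn M (shiftop S l). norm (x - z) \<le> cmod l * D * norm x"
    using Kato_kernel_approximation[OF S] by blast
  \<comment> \<open>Replacing the \<open>F\<close>-component of a vector by a nearby element of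
    \<open>V\<close> costs the relative error \<open>cmod l * D * P\<close>, where \<open>P\<close>
    bounds the projection onto \<open>F\<close>.\<close>
  define \<rho> where "\<rho> = min r (1 / (2 * D * P))"
  have "\<not> cdim_le (kerOn M (shiftop S l)) n" if l: "cmod l < \<rho>" for l
  proof
    define V where "V = kerOn M (shiftop S l)"
    assume "cdim_le (kerOn M (shiftop S l)) n"
    then obtain E where E: "finite E" "card E \<le> n" "E \<subseteq> V" "V \<subseteq> cspan E"
      using cdim_le_basis unfolding V_def by metis
    have V: "csubspace V" "V \<subseteq> M" using csubspace_kerOn[OF bounded_clinear_shiftop[OF S(1)] M(1)] kerOn_subset by (auto simp: V_def)
    have "fin_cdim V" using \<open>cdim_le (kerOn M (shiftop S l)) n\<close> by (auto simp: V_def fin_cdim_iff)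
    then have clV: "closed V" using V closed_fin_cdim by blast
    have lD: "cmod l < r" "cmod l * D * P \<le> 1/2" using l rD P by (auto simp: \<rho>_def field_simps)
    define g where "g p = fst p + snd p" for p :: "'a \<times> 'a"
    have g: "bounded_linear g" unfolding g_def by (intro bounded_linear_intros)
    have "\<exists>e\<in>V \<times> Z. g e = y \<and> norm e \<le> ((cmod l * D + 2) * P + 1) / (1 - 1/2) * norm y" if y: "y \<in> M" for y
    proof (rule approximate_surjectivity[OF g subspace_Times closed_Times[OF clV Z(2)] _ _ _ _ _ y])
      show "y - g e \<in> M" if "y \<in> M" "e \<in> V \<times> Z" for y e
        using that M(1) V sZ by (auto simp: g_def intro!: csubspace_diff csubspace_add)
      fix y assume "y \<in> M"
      then obtain a b where ab: "a \<in> F" "b \<in> Z" "y = a + b" using direct_sumE[OF Z(1)] by blast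
      obtain v where v: "v \<in> V" "norm (a - v) \<le> cmod l * D * norm a" using rD(3)[OF lD(1)] ab(1) F(2) unfolding V_def by blast
      have na: "norm a \<le> P * norm y" using P(2) ab by blast
      have "norm (y - g (v, b)) \<le> cmod l * D * (P * norm y)"
        using v(2) ab(3) mult_left_mono[OF na, of "cmod l * D"] rD(2) by (simp add: g_def)
      also have "\<dots> = (cmod l * D * P) * norm y" by simp
      also have "\<dots> \<le> 1/2 * norm y" using lD(2) by (rule mult_right_mono) simp
      finally have 1: "norm (y - g (v, b)) \<le> 1/2 * norm y" .
      have "norm v \<le> norm a + norm (a - v)" by (metis norm_triangle_sub norm_minus_commute)
      then have nv: "norm v \<le> (cmod l * D + 1) * norm a" using v(2) by (simp add: algebra_simps)
      have nb: "norm b \<le> norm y + norm a" using ab(3) norm_triangle_ineq4[of y a] by simp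
      have "norm (v, b) \<le> norm v + norm b" by (rule norm_Pair_le)
      also have "\<dots> \<le> (cmod l * D + 2) * norm a + norm y" using nv nb by (simp add: algebra_simps)
      also have "\<dots> \<le> (cmod l * D + 2) * (P * norm y) + norm y"
        using mult_left_mono[OF na, of "cmod l * D + 2"] rD(2) by simp
      also have "\<dots> = ((cmod l * D + 2) * P + 1) * norm y" by (simp add: algebra_simps)
      finally show "\<exists>e\<in>V \<times> Z. norm e \<le> ((cmod l * D + 2) * P + 1) * norm y \<and> norm (y - g e) \<le> 1/2 * norm y"
        using 1 v(1) ab(2) by (intro bexI[of _ "(v, b)"]) auto
    qed (use V sZ P rD in \<open>auto simp: csubspace_imp_subspace\<close>)
    then have "M \<subseteq> setsum Z V" by (fastforce simp: g_def setsum_def add.commute)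
    then have "M \<subseteq> setsum Z (cspan E)" using setsum_mono[OF order_refl E(4)] by blast
    then have "ccodim_le M Z n" unfolding ccodim_le_def using E V(2) by blast
    then have "cdim_le F n" using ccodim_le_complement[OF direct_sum_commute[OF Z(1)]] by simp
    then show False using cdim_le_independent[OF _ F(6) I(4)] I(2) by fastforce
  qed
  moreover have "\<rho> > 0" using rD P by (simp add: \<rho>_def)
  ultimately show thesis using that by blast
qed

text \<open>On a closed complement \<open>Z\<close> of the kernel \<open>S\<close> is bounded below
  by some \<open>c\<close>, so for \<open>cmod l < c\<close> the kernel of \<open>S - l\<close>
  meets \<open>Z\<close> trivially and is no larger than the codimension of
  \<open>Z\<close>.\<close>

lemma nullity_upper:
  assumes S: "bounded_clinear S" "closed_inv S M" "closed (S ` M)" and n: "cdim_le (kerOn M S) n"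
  obtains r where "r > 0" "\<And>l. cmod l < r \<Longrightarrow> cdim_le (kerOn M (shiftop S l)) n"
proof -
  note M = closed_invD[OF S(2)]
  define F where "F = kerOn M S"
  have F: "csubspace F" "F \<subseteq> M" "fin_cdim F"
    using csubspace_kerOn[OF S(1) M(1)] kerOn_subset n by (auto simp: F_def fin_cdim_iff)
  obtain Z where Z: "direct_sum M F Z" "closed Z" using closed_complement_exists[OF M(1,2) F(1,3,2)] .
  have sZ: "csubspace Z" "Z \<subseteq> M" using Z direct_sum_subspace[OF Z(1)] by (auto simp: direct_sum_def)
  have "S ` Z = S ` M"
  proof
    show "S ` M \<subseteq> S ` Z"
    proof
      fix y assume "y \<in> S ` M"
      then obtain x where x: "x \<in> M" "y = S x" by blast
      obtain a b where "a \<in> F" "b \<in> Z" "x = a + b" by (rule direct_sumE[OF Z(1) x(1)])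
      then show "y \<in> S ` Z" using x S(1) by (auto simp: F_def kerOn_def bounded_clinear_add)
    qed
  qed (use sZ in blast)
  moreover have "kerOn Z S \<subseteq> {0}"
    using Z(1) sZ(2) by (auto simp: kerOn_mono[OF sZ(2)] direct_sum_def F_def)
  ultimately obtain c where c: "c > 0" "\<And>x. x \<in> Z \<Longrightarrow> c * norm x \<le> norm (S x)"
    using injective_closed_range_bounded_below[OF S(1) sZ(1) Z(2)] S(3) by metis
  have "cdim_le (kerOn M (shiftop S l)) n" if l: "cmod l < c" for l
  proof (rule cdim_le_of_ccodim_le[OF M(1) sZ(1) _ sZ(2)])
    show "csubspace (kerOn M (shiftop S l))" using csubspace_kerOn[OF bounded_clinear_shiftop[OF S(1)] M(1)] .
    have "x = 0" if x: "x \<in> Z" "S x = l *\<^sub>C x" for x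
    proof (rule ccontr)
      assume "x \<noteq> 0"
      then have "cmod l * norm x < c * norm x" using l by simp
      then show False using c(2)[OF x(1)] x(2) by (simp add: norm_scaleC)
    qed
    then show "kerOn M (shiftop S l) \<inter> Z = {0}"
      using csubspace_0[OF M(1)] csubspace_0[OF sZ(1)] S(1) by (auto simp: kerOn_def shiftop_def bounded_clinear_0)
    show "ccodim_le M Z n" using ccodim_le_complement[OF direct_sum_commute[OF Z(1)]] n by (simp add: F_def)
  qed (rule kerOn_subset)
  with c(1) that show thesis by blast
qed

text \<open>Let \<open>G\<close> have dimension \<open>n + 1\<close> and meet the range of
  \<open>S\<close> trivially. If \<open>g = (S - l) x\<close> lies in \<open>G\<close> and
  \<open>norm x \<le> D * norm g\<close>, then \<open>g - S x = - l x\<close> is small, while the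
  bounded projection onto \<open>G\<close> gives \<open>norm g \<le> P * cmod l * norm x\<close>;
  thus \<open>g = 0\<close>. That \<open>D\<close> does not depend on \<open>l\<close> is
  essential.\<close>

lemma Kato_deficiency_lower:
  assumes S: "bounded_clinear S" "closed_inv S M" "Kato_on M S" and n: "\<not> ccodim_le M (S ` M) n"
  obtains r where "r > 0" "\<And>l. cmod l < r \<Longrightarrow> \<not> ccodim_le M (shiftop S l ` M) n"
proof -
  note M = closed_invD[OF S(2)]
  have cl: "closed (S ` M)" using S(3) by (auto simp: Kato_on_def)
  have R: "csubspace (S ` M)" using csubspace_image[OF S(1) M(1)] .
  obtain C where C: "direct_sum M (S ` M) C" using complement_exists[OF R M(1,5)] .
  then have "\<not> cdim_le C n" using n ccodim_le_complement by blast
  then obtain I where I: "finite I" "card I = Suc n" "I \<subseteq> C" "cvs.independent I" by (rule not_cdim_le)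
  define G where "G = cspan I"
  have sC: "csubspace C" "C \<subseteq> M" "S ` M \<inter> C = {0}" using C direct_sum_subspace[OF C] by (auto simp: direct_sum_def)
  have G: "csubspace G" "G \<subseteq> C" "fin_cdim G" "I \<subseteq> G"
    using cspan_minimal[OF I(3) sC(1)] cspan_superset[of I] I(1) unfolding G_def fin_cdim_def by auto
  have "S ` M \<inter> G = {0}" using sC(3) G(2) csubspace_0[OF G(1)] csubspace_0[OF R] by blast
  then have d: "direct_sum (setsum G (S ` M)) G (S ` M)" using R G(1) by (auto simp: direct_sum_def)
  have "closed (setsum G (S ` M))" using closed_setsum_fin_cdim[OF R cl G(1,3)] by (simp add: setsum_commute)
  then obtain P where P: "P > 0" "\<And>a b. a \<in> G \<Longrightarrow> b \<in> S ` M \<Longrightarrow> norm a \<le> P * norm (a + b)"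
    using direct_sum_projection_bounded[OF d _ closed_fin_cdim[OF G(1,3)] cl] by blast
  obtain r D where rD: "r > 0" "D > 0"
    "\<And>l y. cmod l < r \<Longrightarrow> y \<in> shiftop S l ` M \<Longrightarrow> \<exists>x\<in>M. shiftop S l x = y \<and> norm x \<le> D * norm y"
    using Kato_uniform_preimage[OF S] by blast
  define \<rho> where "\<rho> = min r (1 / (2 * P * D))"
  have "\<not> ccodim_le M (shiftop S l ` M) n" if l: "cmod l < \<rho>" for l
  proof
    assume le: "ccodim_le M (shiftop S l ` M) n"
    have l2: "cmod l < r" "P * cmod l * D \<le> 1/2" using l rD P by (auto simp: \<rho>_def field_simps)
    note Sl = closed_invD[OF closed_inv_shiftop[OF S(2), of l]]
    have R': "csubspace (shiftop S l ` M)" using csubspace_image[OF bounded_clinear_shiftop[OF S(1)] M(1)] .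
    have "g = 0" if g: "g \<in> G" "g \<in> shiftop S l ` M" for g
    proof -
      obtain x where x: "x \<in> M" "shiftop S l x = g" "norm x \<le> D * norm g" using rD(3)[OF l2(1) g(2)] by blast
      have "S (- x) \<in> S ` M" using x(1) csubspace_neg[OF M(1)] by blast
      then have "norm g \<le> P * norm (g + S (- x))" by (rule P(2)[OF g(1)])
      also have "S (- x) = - S x" using bounded_clinear_diff[OF S(1), of 0 x] bounded_clinear_0[OF S(1)] by simp
      also have "norm (g + - S x) = cmod l * norm x" using x(2) by (auto simp: shiftop_def norm_scaleC)
      also have "P * (cmod l * norm x) \<le> P * (cmod l * (D * norm g))"
        using x(3) P(1) by (intro mult_left_mono) auto
      also have "\<dots> = (P * cmod l * D) * norm g" by simp
      also have "\<dots> \<le> 1/2 * norm g" using l2(2) by (rule mult_right_mono) simp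
      finally show ?thesis by simp
    qed
    then have "G \<inter> shiftop S l ` M = {0}" using csubspace_0[OF G(1)] csubspace_0[OF R'] by blast
    then have "cdim_le G n" using cdim_le_of_ccodim_le[OF M(1) R' G(1) Sl(5) _ _ le] G(2) sC(2) by blast
    then show False using cdim_le_independent[OF _ G(4) I(4)] I(2) by fastforce
  qed
  moreover have "\<rho> > 0" using rD P by (simp add: \<rho>_def)
  ultimately show thesis using that by blast
qed

text \<open>With \<open>F\<close> spanned by vectors completing the range, the map
  \<open>(x, f) \<mapsto> S x + f\<close> sends \<open>M \<times> F\<close> onto \<open>M\<close>,
  and being onto survives a small shift. The same \<open>F\<close> completes the shifted
  range.\<close>

lemma deficiency_upper:
  assumes S: "bounded_clinear S" "closed_inv S M" and n: "ccodim_le M (S ` M) n"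
  obtains r where "r > 0" "\<And>l. cmod l < r \<Longrightarrow> ccodim_le M (shiftop S l ` M) n"
proof -
  note M = closed_invD[OF S(2)]
  obtain E where E: "finite E" "card E \<le> n" "E \<subseteq> M" "M \<subseteq> setsum (S ` M) (cspan E)"
    using n by (auto simp: ccodim_le_def)
  define F where "F = cspan E"
  have F: "csubspace F" "F \<subseteq> M" "closed F"
    using cspan_minimal[OF E(3) M(1)] closed_setsum_fin[of "{0}" E] E(1) by (auto simp: F_def)
  define g where "g l p = shiftop S l (fst p) + snd p" for p :: "'a \<times> 'a" and l
  have g: "bounded_linear (g l)" for l
    unfolding g_def by (intro bounded_linear_add bounded_linear_snd
      bounded_linear_compose[OF bounded_clinear_imp[OF bounded_clinear_shiftop[OF S(1)]] bounded_linear_fst])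
  have gM: "g l p \<in> M" if "p \<in> M \<times> F" for l p
    using that F(2) closed_invD(4)[OF closed_inv_shiftop[OF S(2)]] M(1) by (auto simp: g_def intro!: csubspace_add)
  have "M \<subseteq> g 0 ` (M \<times> F)"
  proof
    fix y assume "y \<in> M"
    then obtain x f where "x \<in> M" "f \<in> F" "y = S x + f" using E(4) by (auto simp: setsum_def F_def)
    then show "y \<in> g 0 ` (M \<times> F)" by (intro image_eqI[of _ _ "(x, f)"]) (auto simp: g_def)
  qed
  then have im: "g 0 ` (M \<times> F) = M" using gM by blast
  have sMF: "subspace (M \<times> F)" "closed (M \<times> F)"
    using M F by (auto intro: subspace_Times closed_Times csubspace_imp_subspace)
  obtain C where C: "C > 0" "\<And>y. y \<in> M \<Longrightarrow> \<exists>e\<in>M \<times> F. g 0 e = y \<and> norm e \<le> C * norm y"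
    using open_mapping[OF g sMF, of 0] M(2) unfolding im by metis
  have "ccodim_le M (shiftop S l ` M) n" if l: "cmod l < 1 / (2 * C)" for l
  proof -
    have "\<exists>e\<in>M \<times> F. g l e = y \<and> norm e \<le> C / (1 - 1/2) * norm y" if y: "y \<in> M" for y
    proof (rule approximate_surjectivity[OF g sMF _ _ _ _ _ y])
      show "y - g l e \<in> M" if "y \<in> M" "e \<in> M \<times> F" for y e using that gM M(1) csubspace_diff by blast
      fix y assume "y \<in> M"
      then obtain x f where e: "x \<in> M" "f \<in> F" "g 0 (x, f) = y" "norm (x, f) \<le> C * norm y" using C(2)[of y] by auto
      have "norm (y - g l (x, f)) = cmod l * norm x" using e(3) by (auto simp: g_def shiftop_def norm_scaleC)
      also have "\<dots> \<le> 1 / (2 * C) * (C * norm y)"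
        using l C(1) order_trans[OF norm_fst_le e(4)] by (intro mult_mono) auto
      also have "\<dots> = 1/2 * norm y" using C(1) by simp
      finally show "\<exists>e\<in>M \<times> F. norm e \<le> C * norm y \<and> norm (y - g l e) \<le> 1/2 * norm y" using e by blast
    qed (use C in auto)
    then have "M \<subseteq> setsum (shiftop S l ` M) F" by (fastforce simp: g_def setsum_def)
    then show ?thesis unfolding ccodim_le_def F_def using E by blast
  qed
  then show thesis using that[of "1 / (2 * C)"] C(1) by simp
qed

lemma Kato_locally_constant:
  assumes S: "bounded_clinear S" "closed_inv S M" "Kato_on M S"
  shows "\<exists>r>0. \<forall>l. cmod l < r \<longrightarrow> (cdim_le (kerOn M (shiftop S l)) n \<longleftrightarrow> cdim_le (kerOn M S) n)"
    and "\<exists>r>0. \<forall>l. cmod l < r \<longrightarrow> (ccodim_le M (shiftop S l ` M) n \<longleftrightarrow> ccodim_le M (S ` M) n)"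
proof -
  have cl: "closed (S ` M)" using S(3) by (simp add: Kato_on_def)
  show "\<exists>r>0. \<forall>l. cmod l < r \<longrightarrow> (cdim_le (kerOn M (shiftop S l)) n \<longleftrightarrow> cdim_le (kerOn M S) n)"
    using nullity_upper[OF S(1,2) cl] Kato_nullity_lower[OF S] by metis
  show "\<exists>r>0. \<forall>l. cmod l < r \<longrightarrow> (ccodim_le M (shiftop S l ` M) n \<longleftrightarrow> ccodim_le M (S ` M) n)"
    using deficiency_upper[OF S(1,2)] Kato_deficiency_lower[OF S] by metis
qed

text \<open>Connected induction only transports truth, so it is applied to \<open>P\<close> and to
  its negation.\<close>

lemma locally_constant_on_ball:
  fixes P :: "complex \<Rightarrow> bool"
  assumes loc: "\<And>a. a \<in> ball 0 r \<Longrightarrow> \<exists>e>0. \<forall>l. cmod l < e \<longrightarrow> (P (a + l) \<longleftrightarrow> P a)"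
    and b: "cmod b < r"
  shows "P b \<longleftrightarrow> P 0"
proof -
  have r: "r > 0" using b norm_ge_zero[of b] by linarith
  have "Q y" if "Q x" "x \<in> ball 0 r" "y \<in> ball 0 r" "Q = P \<or> Q = (\<lambda>z. \<not> P z)" for Q and x y :: complex
  proof (rule connected_induction_simple[of "ball 0 r" x y Q])
    fix a :: complex assume "a \<in> ball 0 r"
    then obtain e where e: "e > 0" "\<And>l. cmod l < e \<Longrightarrow> P (a + l) \<longleftrightarrow> P a" using loc by blast
    have PQ: "P z \<longleftrightarrow> P a" if "z \<in> ball a e" for z using e(2)[of "z - a"] that by (simp add: dist_norm norm_minus_commute)
    have "\<forall>x\<in>ball 0 r \<inter> ball a e. \<forall>y\<in>ball 0 r \<inter> ball a e. Q x \<longrightarrow> Q y" using PQ that(4) by (metis IntD2)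
    moreover have "openin (top_of_set (ball 0 r)) (ball 0 r \<inter> ball a e)" by (rule openin_open_Int) simp
    ultimately show "\<exists>T. openin (top_of_set (ball 0 r)) T \<and> a \<in> T \<and> (\<forall>x\<in>T. \<forall>y\<in>T. Q x \<longrightarrow> Q y)"
      using e(1) \<open>a \<in> ball 0 r\<close> by (intro exI[of _ "ball 0 r \<inter> ball a e"]) simp
  qed (use that in auto)
  from this[of P b 0] this[of "\<lambda>z. \<not> P z" b 0] show ?thesis using b r by auto
qed

text \<open>The radius of local constancy depends on \<open>n\<close>. On a disc where all shifts
  are Kato, local constancy holds around every point, and connectedness turns it into one radius
  valid for all \<open>n\<close>.\<close>

lemma Kato_constant:
  assumes S: "bounded_clinear S" "closed_inv S M" "Kato_on M S"
  obtains r where "r > 0" "\<And>l. cmod l < r \<Longrightarrow> Kato_on M (shiftop S l)"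
    "\<And>l n. cmod l < r \<Longrightarrow> cdim_le (kerOn M (shiftop S l)) n \<longleftrightarrow> cdim_le (kerOn M S) n"
    "\<And>l n. cmod l < r \<Longrightarrow> ccodim_le M (shiftop S l ` M) n \<longleftrightarrow> ccodim_le M (S ` M) n"
proof -
  obtain r where r: "r > 0" "\<And>l. cmod l < r \<Longrightarrow> Kato_on M (shiftop S l)" using Kato_on_shift[OF S] by blast
  have loc: "\<exists>e>0. \<forall>l. cmod l < e \<longrightarrow> (cdim_le (kerOn M (shiftop S (a + l))) n \<longleftrightarrow> cdim_le (kerOn M (shiftop S a)) n)"
    "\<exists>e>0. \<forall>l. cmod l < e \<longrightarrow> (ccodim_le M (shiftop S (a + l) ` M) n \<longleftrightarrow> ccodim_le M (shiftop S a ` M) n)"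
    if "a \<in> ball 0 r" for a n
    using Kato_locally_constant[OF bounded_clinear_shiftop[OF S(1)] closed_inv_shiftop[OF S(2)], of a n] r(2)[of a] that by simp_all
  show thesis
  proof (rule that[OF r])
    fix l n assume l: "cmod l < r"
    show "cdim_le (kerOn M (shiftop S l)) n \<longleftrightarrow> cdim_le (kerOn M S) n"
      using locally_constant_on_ball[OF loc(1)[where n = n] l] by simp
    show "ccodim_le M (shiftop S l ` M) n \<longleftrightarrow> ccodim_le M (S ` M) n"
      using locally_constant_on_ball[OF loc(2)[where n = n] l] by simp
  qed
qed


subsection \<open>Kato decomposition of semi-Fredholm operators\<close>

lemma setsumE:
  assumes "x \<in> setsum A E"
  obtains a b where "a \<in> A" "b \<in> E" "x = a + b"
  using assms by (auto simp: setsum_def)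

text \<open>Used with \<open>A\<close> and \<open>E\<close> the ranges on the two summands:
  complements of these inside the summands add up to a complement of the whole range, so
  deficiencies add.\<close>

lemma direct_sum_exchange:
  assumes P: "direct_sum P M N" and M: "direct_sum M A C" and N: "direct_sum N E D"
  shows "direct_sum P (setsum A E) (setsum C D)" "direct_sum (setsum A E) A E" "direct_sum (setsum C D) C D"
proof -
  have sub: "csubspace M" "csubspace N" "csubspace A" "csubspace C" "csubspace E" "csubspace D"
    using P M N by (simp_all add: direct_sum_def)
  have le: "A \<subseteq> M" "C \<subseteq> M" "E \<subseteq> N" "D \<subseteq> N"
    using direct_sum_subspace[OF M] direct_sum_subspace[OF N] by simp_all
  have MN: "M \<inter> N = {0}" using P by (simp add: direct_sum_def)
  have "A \<inter> E \<subseteq> {0}" "C \<inter> D \<subseteq> {0}" using MN le by blast+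
  then have "A \<inter> E = {0}" "C \<inter> D = {0}" using csubspace_0[OF sub(3)] csubspace_0[OF sub(4)] csubspace_0[OF sub(5)] csubspace_0[OF sub(6)] by auto
  then show 1: "direct_sum (setsum A E) A E" and 2: "direct_sum (setsum C D) C D"
    using sub by (simp_all add: direct_sum_def)
  have "x = 0" if xs: "x \<in> setsum A E" "x \<in> setsum C D" for x
  proof -
    obtain a e where 1: "a \<in> A" "e \<in> E" "x = a + e" by (rule setsumE[OF xs(1)])
    obtain c d where 2: "c \<in> C" "d \<in> D" "x = c + d" by (rule setsumE[OF xs(2)])
    note x = 1(3) 2(3) 1(1,2) 2(1,2)
    then have "a = c" "e = d" using direct_sum_unique[OF P, of a c e d] le by (auto simp: subset_iff)
    then have "a \<in> A \<inter> C" "e \<in> E \<inter> D" using x by auto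
    moreover have "A \<inter> C = {0}" "E \<inter> D = {0}" using M N by (simp_all add: direct_sum_def)
    ultimately have "a = 0" "e = 0" by simp_all
    then show ?thesis using x(1) by simp
  qed
  then have "setsum A E \<inter> setsum C D = {0}"
    using sub csubspace_0[OF csubspace_setsum] by blast
  moreover have "setsum (setsum A E) (setsum C D) = P"
  proof (intro equalityI subsetI)
    fix x assume "x \<in> setsum (setsum A E) (setsum C D)"
    then obtain a e c d where "x = (a + e) + (c + d)" and aecd: "a \<in> A" "e \<in> E" "c \<in> C" "d \<in> D"
      by (auto elim!: setsumE)
    then have "x = (a + c) + (e + d)" by (simp add: algebra_simps)
    note x = this aecd
    have "a + c \<in> M" "e + d \<in> N" using x le sub csubspace_add by blast+
    then show "x \<in> P" using x(1) P setsumI by (auto simp: direct_sum_def)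
  next
    fix x assume x: "x \<in> P"
    obtain m n where mn: "m \<in> M" "n \<in> N" "x = m + n" by (rule direct_sumE[OF P x])
    obtain a c where ac: "a \<in> A" "c \<in> C" "m = a + c" by (rule direct_sumE[OF M mn(1)])
    obtain e d where ed: "e \<in> E" "d \<in> D" "n = e + d" by (rule direct_sumE[OF N mn(2)])
    have "x = (a + e) + (c + d)" using mn ac ed by (simp add: algebra_simps)
    then show "x \<in> setsum (setsum A E) (setsum C D)" using ac ed by (simp only: setsumI)
  qed
  ultimately show "direct_sum P (setsum A E) (setsum C D)"
    using sub by (simp add: direct_sum_def csubspace_setsum)
qed

lemma direct_sum_kernel:
  assumes S: "bounded_clinear S" and P: "direct_sum P M N" and inv: "S ` M \<subseteq> M" "S ` N \<subseteq> N"
  shows "direct_sum (kerOn P S) (kerOn M S) (kerOn N S)" "kerOn M S = kerOn P S \<inter> M"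
proof -
  have sub: "csubspace M" "csubspace N" and MN: "M \<inter> N = {0}"
    using P by (simp_all add: direct_sum_def)
  have le: "M \<subseteq> P" "N \<subseteq> P" "csubspace P" using direct_sum_subspace[OF P] by simp_all
  show "kerOn M S = kerOn P S \<inter> M" using le by (auto simp: kerOn_def)
  have k: "csubspace (kerOn M S)" "csubspace (kerOn N S)" using csubspace_kerOn[OF S] sub by simp_all
  have "kerOn M S \<inter> kerOn N S = {0}" using MN csubspace_0[OF k(1)] csubspace_0[OF k(2)] by (auto simp: kerOn_def)
  moreover have "setsum (kerOn M S) (kerOn N S) = kerOn P S"
  proof (intro equalityI subsetI)
    fix x assume "x \<in> setsum (kerOn M S) (kerOn N S)"
    then obtain a b where "x = a + b" "a \<in> M" "b \<in> N" "S a = 0" "S b = 0" by (auto simp: setsum_def kerOn_def)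
    then show "x \<in> kerOn P S" using le S by (auto simp: kerOn_def bounded_clinear_add intro!: csubspace_add)
  next
    fix x assume x: "x \<in> kerOn P S"
    then have xP: "x \<in> P" "S x = 0" by (auto simp: kerOn_def)
    obtain a b where ab: "a \<in> M" "b \<in> N" "x = a + b" by (rule direct_sumE[OF P xP(1)])
    have "S a + S b = 0 + 0" using xP ab S by (simp add: bounded_clinear_add)
    then have "S a = 0" "S b = 0" using direct_sum_unique[OF P, of "S a" 0 "S b" 0] ab inv csubspace_0 sub by (auto simp: image_subset_iff)
    then show "x \<in> setsum (kerOn M S) (kerOn N S)" using ab by (auto simp: kerOn_def intro!: setsumI)
  qed
  ultimately show "direct_sum (kerOn P S) (kerOn M S) (kerOn N S)" using k by (simp add: direct_sum_def)
qed

lemma direct_sum_range: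
  assumes S: "bounded_clinear S" and P: "direct_sum P M N" and inv: "S ` M \<subseteq> M" "S ` N \<subseteq> N"
  shows "direct_sum (S ` P) (S ` M) (S ` N)" "S ` M = S ` P \<inter> M"
proof -
  have sub: "csubspace M" "csubspace N" and MN: "M \<inter> N = {0}"
    using P by (simp_all add: direct_sum_def)
  have le: "M \<subseteq> P" "N \<subseteq> P" "csubspace P" using direct_sum_subspace[OF P] by simp_all
  have k: "csubspace (S ` M)" "csubspace (S ` N)" using csubspace_image[OF S] sub by simp_all
  have "S ` M \<inter> S ` N = {0}" using MN inv csubspace_0[OF k(1)] csubspace_0[OF k(2)] by blast
  moreover have eq: "setsum (S ` M) (S ` N) = S ` P"
  proof (intro equalityI subsetI)
    fix x assume "x \<in> setsum (S ` M) (S ` N)"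
    then obtain a b where ab: "x = S (a + b)" "a \<in> M" "b \<in> N"
      by (auto simp: setsum_def bounded_clinear_add[OF S])
    then have "a + b \<in> P" using le csubspace_add by blast
    then show "x \<in> S ` P" using ab by blast
  next
    fix x assume "x \<in> S ` P"
    then obtain y where y: "y \<in> P" "x = S y" by blast
    obtain a b where ab: "a \<in> M" "b \<in> N" "y = a + b" by (rule direct_sumE[OF P y(1)])
    then have "x = S a + S b" using y S by (simp add: bounded_clinear_add)
    moreover have "S a \<in> S ` M" "S b \<in> S ` N" using ab by simp_all
    ultimately show "x \<in> setsum (S ` M) (S ` N)" by (simp only: setsumI)
  qed
  ultimately show "direct_sum (S ` P) (S ` M) (S ` N)" using k by (simp add: direct_sum_def)
  show "S ` M = S ` P \<inter> M"
  proof (intro equalityI subsetI)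
    fix x assume x: "x \<in> S ` P \<inter> M"
    then have "x \<in> setsum (S ` M) (S ` N)" unfolding eq by blast
    then obtain a b where ab: "x = S a + S b" "a \<in> M" "b \<in> N" "x \<in> M"
      using x by (auto elim!: setsumE)
    have "S a \<in> M" "S b \<in> N" using inv ab by blast+
    then have "x = S a" using direct_sum_unique(1)[OF P ab(4) _ csubspace_0[OF sub(2)], of "S a" "S b"] ab(1) by simp
    then show "x \<in> S ` M" using ab by blast
  qed (use le inv in auto)
qed

text \<open>The projections onto \<open>M\<close> and \<open>N\<close> are bounded, so both
  components of a vector of the sum are controlled by the vector itself.\<close>

lemma closed_setsum_direct:
  assumes P: "direct_sum P M N" and cl: "closed P" "closed M" "closed N"
    and A: "csubspace A" "closed A" "A \<subseteq> M" and E: "csubspace E" "closed E" "E \<subseteq> N"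
  shows "closed (setsum A E)"
proof -
  obtain C where C: "C > 0" "\<And>a b. a \<in> M \<Longrightarrow> b \<in> N \<Longrightarrow> norm a \<le> C * norm (a + b)"
    using direct_sum_projection_bounded[OF P cl] by blast
  obtain D where D: "D > 0" "\<And>a b. a \<in> N \<Longrightarrow> b \<in> M \<Longrightarrow> norm a \<le> D * norm (a + b)"
    using direct_sum_projection_bounded[OF direct_sum_commute[OF P] cl(1,3,2)] by blast
  define g where "g p = fst p + snd p" for p :: "'a \<times> 'a"
  have g: "bounded_linear g" unfolding g_def by (intro bounded_linear_intros)
  have im: "g ` (A \<times> E) = setsum A E" unfolding setsum_def g_def image_def by auto
  have "closed (g ` (A \<times> E))"
  proof (rule closed_image_bounded_preimage[OF g, of _ "C + D"])
    fix y assume "y \<in> g ` (A \<times> E)"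
    then obtain a b where ab: "a \<in> A" "b \<in> E" "y = a + b" by (auto simp: g_def)
    have "norm (a, b) \<le> norm a + norm b" by (rule norm_Pair_le)
    also have "\<dots> \<le> C * norm y + D * norm y"
      using C(2)[of a b] D(2)[of b a] ab A(3) E(3) by (intro add_mono) (auto simp: add.commute)
    finally show "\<exists>e\<in>A \<times> E. g e = y \<and> norm e \<le> (C + D) * norm y"
      using ab by (intro bexI[of _ "(a, b)"]) (auto simp: g_def algebra_simps)
  qed (use A E C D in \<open>auto intro: subspace_Times closed_Times csubspace_imp_subspace\<close>)
  then show ?thesis by (simp add: im)
qed

text \<open>The map \<open>(x, c) \<mapsto> S x + c\<close> with \<open>c\<close> in a
  finite-dimensional complement is onto, hence has bounded preimages; for vectors of the range the
  part \<open>c\<close> vanishes. This supplies the closedness that is not built into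
  \<open>lower_semi_Fredholm_on\<close>.\<close>

lemma closed_range_fin_codim:
  assumes S: "bounded_clinear S" "closed_inv S M" and f: "fin_codim M (S ` M)"
  shows "closed (S ` M)"
proof -
  note M = closed_invD[OF S(2)]
  have R: "csubspace (S ` M)" using csubspace_image[OF S(1) M(1)] .
  obtain C where C: "direct_sum M (S ` M) C" using complement_exists[OF R M(1,5)] .
  have sC: "csubspace C" "S ` M \<inter> C = {0}" "C \<subseteq> M" using C direct_sum_subspace[OF C] by (simp_all add: direct_sum_def)
  have "fin_cdim C" using codim_complement(1)[OF C] f by simp
  then have cC: "closed C" using closed_fin_cdim sC by blast
  define g where "g p = S (fst p) + snd p" for p :: "'a \<times> 'a"
  have g: "bounded_linear g"
    unfolding g_def by (intro bounded_linear_add bounded_linear_snd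
      bounded_linear_compose[OF bounded_clinear_imp[OF S(1)] bounded_linear_fst])
  have im: "g ` (M \<times> C) = M"
  proof (intro equalityI subsetI)
    fix y assume "y \<in> M"
    then obtain x c where "x \<in> M" "c \<in> C" "y = S x + c" using direct_sumE[OF C] by blast
    then show "y \<in> g ` (M \<times> C)" by (intro image_eqI[of _ _ "(x, c)"]) (auto simp: g_def)
  qed (use M sC(3) in \<open>auto simp: g_def intro!: csubspace_add\<close>)
  obtain K where K: "K > 0" "\<And>y. y \<in> M \<Longrightarrow> \<exists>e\<in>M \<times> C. g e = y \<and> norm e \<le> K * norm y"
    using open_mapping[OF g subspace_Times closed_Times[OF M(2) cC]] M(2,3) csubspace_imp_subspace[OF sC(1)]
    unfolding im by metis
  show ?thesis
  proof (rule closed_image_bounded_preimage[OF bounded_clinear_imp[OF S(1)] M(3,2)])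
    fix y assume y: "y \<in> S ` M"
    then obtain x c where xc: "x \<in> M" "c \<in> C" "S x + c = y" "norm (x, c) \<le> K * norm y"
      using K(2)[of y] M(5) by (auto simp: g_def)
    have "y - S x \<in> S ` M" using y xc(1) R csubspace_diff by blast
    then have "c = 0" using xc(2,3) sC(2) by auto
    then show "\<exists>e\<in>M. S e = y \<and> norm e \<le> K * norm y"
      using xc order_trans[OF norm_fst_le xc(4)] by (intro bexI[of _ x]) auto
  qed (use K in simp)
qed

text \<open>A Jordan chain \<open>u, S u, \<dots>, S\<^sup>k u\<close> with \<open>S\<^sup>k u\<close> in the kernel but not in the range of \<open>S\<^sup>k\<^sup>+\<^sup>1\<close> is
  split off: its complement is cut out by the functionals \<open>f \<circ> S\<^sup>i\<close>, where \<open>f\<close> vanishes on the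
  range of \<open>S\<^sup>k\<^sup>+\<^sup>1\<close> and \<open>f (S\<^sup>k u) = 1\<close>. The matrix of \<open>f (S\<^sup>i\<^sup>+\<^sup>j u)\<close> is then triangular.\<close>

lemma split_Jordan_block:
  assumes S: "bounded_clinear S" "closed_inv S M" and cl: "closed (S ` M)"
    and nK: "\<not> (\<forall>n. kerOn M S \<subseteq> (S ^^ n) ` M)"
  obtains A N n x u where "direct_sum M A N" "closed_inv S A" "closed_inv S N" "fin_cdim N"
    "\<And>y. y \<in> N \<Longrightarrow> (S ^^ n) y = 0" "closed (S ` A)"
    "x \<in> kerOn M S" "x \<notin> A" "u \<in> M" "u \<notin> setsum A (S ` M)"
proof -
  note M = closed_invD[OF S(2)]
  define n where "n = (LEAST n. \<not> kerOn M S \<subseteq> (S ^^ n) ` M)"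
  have n: "\<not> kerOn M S \<subseteq> (S ^^ n) ` M" "\<And>m. m < n \<Longrightarrow> kerOn M S \<subseteq> (S ^^ m) ` M"
    using nK LeastI_ex[of "\<lambda>n. \<not> kerOn M S \<subseteq> (S ^^ n) ` M"] not_less_Least unfolding n_def by blast+
  have "n \<noteq> 0"
  proof
    assume "n = 0"
    then show False using n(1) kerOn_subset[of M S] by simp
  qed
  then obtain k where k: "n = Suc k" using not0_implies_Suc by blast
  obtain x where x: "x \<in> kerOn M S" "x \<notin> (S ^^ n) ` M" using n(1) by blast
  have "x \<in> (S ^^ k) ` M" using x(1) n(2)[of k] k by blast
  then obtain u where u: "u \<in> M" "x = (S ^^ k) u" by blast
  have bn: "bounded_clinear (S ^^ i)" for i using bounded_clinear_funpow[OF S(1)] .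
  have sn: "csubspace ((S ^^ n) ` M)" using csubspace_image[OF bn M(1)] .
  obtain f where f: "cfunctional f" "\<And>v. v \<in> (S ^^ n) ` M \<Longrightarrow> f v = 0" "f x = 1"
    using separating_functional[OF sn closed_range_funpow[OF S cl n(2)] x(2)] by blast
  have big: "(S ^^ j) u = 0" if "j > k" for j
  proof -
    obtain i where "j = i + Suc k" using \<open>j > k\<close> by (metis add.commute less_iff_Suc_add add_Suc_right)
    moreover have "(S ^^ Suc k) u = 0" using x(1) u by (simp add: kerOn_def)
    ultimately show ?thesis using bounded_clinear_0[OF bn, of i] funpow_add[of i "Suc k" S] by (simp del: funpow.simps)
  qed
  have hank: "f ((S ^^ i) ((S ^^ j) u)) = (if i + j = k then 1 else 0)" if "i + j \<ge> k" for i j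
  proof -
    have "(S ^^ i) ((S ^^ j) u) = (S ^^ (i + j)) u" by (simp add: funpow_add)
    then show ?thesis using that big[of "i + j"] f u(2) cfunctional_0[OF f(1)] by auto
  qed
  have Sj: "(S ^^ j) u \<in> M" for j using closed_inv_funpow[OF S(2) u(1)] .
  define A where "A = {y \<in> M. \<forall>i\<le>k. f ((S ^^ i) y) = 0}"
  \<comment> \<open>All of the chain, \<open>J 0\<close>, spans the block; the tails
    \<open>J m\<close> serve only to eliminate coefficients one at a time in the uniqueness
    proof.\<close>
  define J where "J m = (\<lambda>j. (S ^^ j) u) ` {m..k}" for m
  define N where "N = cspan (J 0)"
  have N: "csubspace N" "J 0 \<subseteq> N" "fin_cdim N" "closed N" "N \<subseteq> M"
  proof -
    show "csubspace N" "J 0 \<subseteq> N" by (simp_all add: N_def cspan_superset)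
    show "N \<subseteq> M" unfolding N_def by (rule cspan_minimal[OF _ M(1)]) (auto simp: J_def Sj)
    show "fin_cdim N" unfolding fin_cdim_def N_def
      by (intro exI[of _ "J 0"]) (simp add: J_def cspan_superset)
    then show "closed N" by (rule closed_fin_cdim[rotated]) (simp add: N_def)
  qed
  have flin: "f ((S ^^ i) (a + b)) = f ((S ^^ i) a) + f ((S ^^ i) b)" "f ((S ^^ i) (a - b)) = f ((S ^^ i) a) - f ((S ^^ i) b)"
    "f ((S ^^ i) (c *\<^sub>C a)) = c * f ((S ^^ i) a)" "f ((S ^^ i) 0) = 0" for i a b c
    by (simp_all add: bounded_clinear_simps[OF bn] cfunctional_add[OF f(1)] cfunctional_diff[OF f(1)] cfunctional_scale[OF f(1)] cfunctional_0[OF f(1)])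
  have A: "csubspace A" "closed A" "A \<subseteq> M"
  proof -
    show "csubspace A" using M(1) by (auto simp: A_def csubspace_def flin)
    have "closed ((\<lambda>y. f ((S ^^ i) y)) -` {0})" for i
      by (intro closed_vimage continuous_on_compose2[OF cfunctional_continuous[OF f(1), of UNIV]]
          linear_continuous_on[OF bounded_clinear_imp[OF bn]]) auto
    moreover have "A = M \<inter> (\<Inter>i\<in>{..k}. (\<lambda>y. f ((S ^^ i) y)) -` {0})" by (auto simp: A_def)
    ultimately show "closed A" using M(2) by (auto intro!: closed_INT)
    show "A \<subseteq> M" by (auto simp: A_def)
  qed
  have SA: "S y \<in> A" if y: "y \<in> A" for y
  proof -
    have "f ((S ^^ i) (S y)) = 0" if "i \<le> k" for i
    proof (cases "i = k")
      case True
      have "(S ^^ k) (S y) = (S ^^ n) y" by (simp add: k funpow_swap1)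
      then show ?thesis using f(2)[of "(S ^^ n) y"] y True by (auto simp: A_def)
    next
      case False
      have "Suc i \<le> k" using that False by simp
      then have "f ((S ^^ Suc i) y) = 0" using y unfolding A_def by blast
      then show ?thesis by (simp add: funpow_swap1)
    qed
    moreover have "S y \<in> M" using y A(3) M(4) by blast
    ultimately show ?thesis by (simp add: A_def)
  qed
  have SN: "S ` N \<subseteq> N"
  proof -
    have "csubspace {y. S y \<in> N}" using N(1) by (auto simp: csubspace_def bounded_clinear_simps[OF S(1)])
    moreover have "J 0 \<subseteq> {y. S y \<in> N}"
    proof
      fix y assume "y \<in> J 0"
      then obtain j where j: "j \<le> k" "y = (S ^^ j) u" by (auto simp: J_def)
      have "(S ^^ Suc j) u \<in> N"
      proof (cases "j = k")
        case True
        then show ?thesis using big[of "Suc j"] csubspace_0[OF N(1)] by (simp del: funpow.simps)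
      next
        case False
        then have "(S ^^ Suc j) u \<in> J 0" unfolding J_def using j by (intro imageI) auto
        then show ?thesis using N(2) by blast
      qed
      then show "y \<in> {y. S y \<in> N}" using j by simp
    qed
    ultimately have "N \<subseteq> {y. S y \<in> N}" unfolding N_def by (metis cspan_minimal)
    then show ?thesis by blast
  qed
  have nil: "(S ^^ n) y = 0" if "y \<in> N" for y
  proof -
    have "csubspace {y. (S ^^ n) y = 0}" by (auto simp: csubspace_def bounded_clinear_simps[OF bn])
    moreover have "J 0 \<subseteq> {y. (S ^^ n) y = 0}"
    proof
      fix y assume "y \<in> J 0"
      then obtain j where j: "y = (S ^^ j) u" by (auto simp: J_def)
      have "(S ^^ n) y = (S ^^ (n + j)) u" by (simp add: j funpow_add)
      then show "y \<in> {y. (S ^^ n) y = 0}" using big[of "n + j"] k by simp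
    qed
    ultimately have "N \<subseteq> {y. (S ^^ n) y = 0}" unfolding N_def by (metis cspan_minimal)
    then show ?thesis using that by blast
  qed
  have ex: "\<exists>v\<in>N. y - v \<in> A" if y: "y \<in> M" for y
  proof -
    \<comment> \<open>The conditions are met in the order \<open>i = k, k - 1, ..., 0\<close>: the
      coefficient of \<open>(S ^^ m) u\<close> settles \<open>i = k - m\<close>, and leaves the
      conditions with larger \<open>i\<close> alone because \<open>f\<close> vanishes at
      \<open>(S ^^ (i + m)) u\<close> for \<open>i + m > k\<close>.\<close>
    have "\<exists>v\<in>N. \<forall>i\<le>k. k < i + m \<longrightarrow> f ((S ^^ i) (y - v)) = 0" if "m \<le> Suc k" for m
      using that
    proof (induction m)
      case 0
      then show ?case using csubspace_0[OF N(1)] by auto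
    next
      case (Suc m)
      then obtain v where v: "v \<in> N" "\<And>i. i \<le> k \<Longrightarrow> k < i + m \<Longrightarrow> f ((S ^^ i) (y - v)) = 0" by auto
      define c where "c = f ((S ^^ (k - m)) (y - v))"
      have "(S ^^ m) u \<in> N" using Suc.prems N(2) by (auto simp: J_def)
      then have "v + c *\<^sub>C (S ^^ m) u \<in> N" using v(1) N(1) by (simp add: csubspace_add csubspace_scale)
      moreover have "f ((S ^^ i) (y - (v + c *\<^sub>C (S ^^ m) u))) = 0" if i: "i \<le> k" "k < i + Suc m" for i
      proof -
        have "f ((S ^^ i) (y - (v + c *\<^sub>C (S ^^ m) u))) = f ((S ^^ i) (y - v)) - c * f ((S ^^ i) ((S ^^ m) u))"
          unfolding diff_diff_eq[symmetric] by (simp only: flin)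
        then show ?thesis using hank[of i m] i v(2)[of i] Suc.prems
          by (cases "i + m = k") (auto simp: c_def)
      qed
      ultimately show ?case by blast
    qed
    from this[of "Suc k"] obtain v where v: "v \<in> N" "\<And>i. i \<le> k \<Longrightarrow> f ((S ^^ i) (y - v)) = 0" by auto
    moreover have "y - v \<in> M" using y v(1) N(5) M(1) csubspace_diff by blast
    ultimately show ?thesis by (auto simp: A_def)
  qed
  have uniq: "v = 0" if v: "v \<in> N" "v \<in> A" for v
  proof -
    \<comment> \<open>The same triangularity in reverse: \<open>f\<close> after
      \<open>S ^^ (k - m)\<close> kills all later chain vectors, so the coefficient of
      \<open>(S ^^ m) u\<close> is zero.\<close>
    have "v \<in> cspan (J m)" if "m \<le> Suc k" for m
      using that
    proof (induction m)
      case 0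
      then show ?case using v by (simp add: N_def)
    next
      case (Suc m)
      have "{m..k} = insert m {Suc m..k}" using Suc.prems by auto
      then have "J m = insert ((S ^^ m) u) (J (Suc m))" by (simp add: J_def)
      then obtain c where c: "v - c *\<^sub>C (S ^^ m) u \<in> cspan (J (Suc m))"
        using Suc by (auto simp: cspan_eq cvs.span_insert)
      have "csubspace {y. f ((S ^^ (k - m)) y) = 0}" by (auto simp: csubspace_def flin)
      moreover have "J (Suc m) \<subseteq> {y. f ((S ^^ (k - m)) y) = 0}"
        using Suc.prems by (auto simp: J_def hank)
      ultimately have "f ((S ^^ (k - m)) (v - c *\<^sub>C (S ^^ m) u)) = 0" using c cspan_minimal by blast
      moreover have "f ((S ^^ (k - m)) v) = 0" using v(2) by (auto simp: A_def)
      ultimately have "c = 0" using hank[of "k - m" m] Suc.prems by (simp add: flin)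
      then show ?case using c by simp
    qed
    from this[of "Suc k"] show ?thesis by (simp add: J_def cspan_eq)
  qed
  have d: "direct_sum M A N"
  proof -
    have "A \<inter> N = {0}" using uniq csubspace_0[OF A(1)] csubspace_0[OF N(1)] by blast
    moreover have "setsum A N = M"
    proof (intro equalityI subsetI)
      fix y assume "y \<in> M"
      then obtain v where v: "v \<in> N" "y - v \<in> A" using ex by blast
      then have "(y - v) + v \<in> setsum A N" by (simp only: setsumI)
      then show "y \<in> setsum A N" by simp
    qed (use setsum_minimal[OF A(3) N(5) M(1)] in blast)
    ultimately show ?thesis using A N by (simp add: direct_sum_def)
  qed
  have invA: "closed_inv S A" and invN: "closed_inv S N"
    using A N SA SN by (auto simp: closed_inv_def)
  have "closed (S ` A)"
    using direct_sum_range(2)[OF S(1) d] closed_invD(5)[OF invA] SN cl A(2) by (simp add: closed_Int)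
  \<comment> \<open>The kernel vector \<open>x\<close> is lost on passing to \<open>A\<close>, and
    \<open>u\<close> stays outside \<open>A\<close> plus the range; this makes nullity respectively
    deficiency drop strictly.\<close>
  moreover have "x \<notin> A" using f(3) u(2) by (auto simp: A_def)
  moreover have "u \<notin> setsum A (S ` M)"
  proof
    assume "u \<in> setsum A (S ` M)"
    then obtain a y where ay: "u = a + S y" "a \<in> A" "y \<in> M" by (auto simp: setsum_def)
    have "f ((S ^^ k) u) = f ((S ^^ k) a) + f ((S ^^ k) (S y))" using ay by (simp add: flin)
    also have "(S ^^ k) (S y) = (S ^^ n) y" by (simp add: k funpow_swap1)
    finally show False using f ay u(2) by (auto simp: A_def)
  qed
  ultimately show thesis using that[of A N n x u] d invA invN N(3) nil x(1) u(1) by blast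
qed

text \<open>Strong induction on a bound for the nullity or the deficiency: as long as some kernel
  vector misses the range of some power, a Jordan block is split off and the bound decreases. The
  blocks are collected in \<open>E\<close>.\<close>

lemma Kato_decomposition_aux:
  assumes S: "bounded_clinear S"
  shows "closed_inv S M \<Longrightarrow> closed (S ` M) \<Longrightarrow> cdim_le (kerOn M S) d \<or> ccodim_le M (S ` M) d \<Longrightarrow>
    \<exists>A E n. direct_sum M A E \<and> closed_inv S A \<and> closed_inv S E \<and> Kato_on A S \<and> fin_cdim E \<and> (\<forall>x\<in>E. (S ^^ n) x = 0)"
proof (induction d arbitrary: M rule: less_induct)
  case (less d)
  note M = closed_invD[OF less.prems(1)]
  show ?case
  proof (cases "\<forall>n. kerOn M S \<subseteq> (S ^^ n) ` M")
    case True
    have "cdim_le ({0} :: 'a set) 0" by (simp only: cdim_le_0[OF csubspace_trivial])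
    then have "fin_cdim ({0} :: 'a set)" by (simp only: fin_cdim_iff) (rule exI)
    moreover have "closed_inv S {0}" using S by (simp add: closed_inv_def bounded_clinear_0)
    moreover have "Kato_on M S" using True less.prems by (simp add: Kato_on_def)
    moreover have "\<forall>x\<in>{0}. (S ^^ 0) x = 0" by simp
    ultimately show ?thesis using less.prems(1) direct_sum_trivial[OF M(1)] by blast
  next
    case False
    then obtain A N n x u where b: "direct_sum M A N" "closed_inv S A" "closed_inv S N" "fin_cdim N"
      "\<And>y. y \<in> N \<Longrightarrow> (S ^^ n) y = 0" "closed (S ` A)"
      "x \<in> kerOn M S" "x \<notin> A" "u \<in> M" "u \<notin> setsum A (S ` M)"
      using split_Jordan_block[OF S less.prems(1,2)] by metis
    note A = closed_invD[OF b(2)] and N = closed_invD[OF b(3)]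
    have AM: "A \<subseteq> M" using direct_sum_subspace[OF b(1)] by blast
    have R: "csubspace (S ` M)" "csubspace (S ` A)" using csubspace_image[OF S] M(1) A(1) by blast+
    have "\<exists>d'<d. cdim_le (kerOn A S) d' \<or> ccodim_le A (S ` A) d'"
      using less.prems(3)
    proof
      assume c: "cdim_le (kerOn M S) d"
      have "kerOn A S \<subset> kerOn M S" using b(7,8) AM by (auto simp: kerOn_def)
      moreover have "d \<noteq> 0"
      proof
        assume "d = 0"
        then have "kerOn M S = {0}" using c cdim_le_0[OF csubspace_kerOn[OF S M(1)]] by simp
        then show False using b(7,8) csubspace_0[OF A(1)] by auto
      qed
      ultimately show ?thesis using c cdim_le_psubset[of "kerOn M S" "d - 1" "kerOn A S"] csubspace_kerOn[OF S A(1)]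
        by (intro exI[of _ "d - 1"]) auto
    next
      assume c: "ccodim_le M (S ` M) d"
      \<comment> \<open>A complement of the range of \<open>S\<close> on \<open>A\<close>, taken
        inside \<open>A\<close>, is also a complement of the whole range in \<open>V\<close>; since
        \<open>V\<close> is a proper subspace of \<open>M\<close>, the deficiency on
        \<open>A\<close> is smaller.\<close>
      define V where "V = setsum A (S ` M)"
      have V: "csubspace V" "S ` M \<subseteq> V" "V \<subset> M"
        using csubspace_setsum[OF A(1) R(1)] setsum_superset[OF A(1) R(1)] setsum_minimal[OF AM M(5,1)] b(9,10)
        by (auto simp: V_def)
      have "d \<noteq> 0"
      proof
        assume "d = 0"
        then have "S ` M = M" using c ccodim_le_0[OF M(1,5)] by simp
        then show False using V by blast
      qed
      then have cV: "ccodim_le V (S ` M) (d - 1)" using ccodim_le_psubset[OF _ M(1) R(1) V, of "d - 1"] c by simp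
      obtain C where C: "direct_sum A (S ` A) C" using complement_exists[OF R(2) A(1,5)] .
      have sC: "csubspace C" "C \<subseteq> A" "S ` A \<inter> C = {0}" "setsum (S ` A) C = A"
        using C direct_sum_subspace[OF C] by (simp_all add: direct_sum_def)
      have "S ` A = S ` M \<inter> A" using direct_sum_range(2)[OF S b(1) A(5) N(5)] .
      then have "S ` M \<inter> C = {0}" using sC by auto
      moreover have "setsum (S ` M) C = V"
      proof
        show "setsum (S ` M) C \<subseteq> V" using setsum_minimal[OF V(2) _ V(1)] sC(2) setsum_superset[OF A(1) R(1)] by (auto simp: V_def)
        have "A \<subseteq> setsum (S ` M) C" using sC(4) setsum_mono[of "S ` A" "S ` M" C C] AM by blast
        then show "V \<subseteq> setsum (S ` M) C" unfolding V_def
          using setsum_minimal csubspace_setsum[OF R(1) sC(1)] setsum_superset[OF R(1) sC(1)] by blast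
      qed
      ultimately have "direct_sum V (S ` M) C" using R(1) sC(1) by (simp add: direct_sum_def)
      then have "ccodim_le A (S ` A) (d - 1)" using cV ccodim_le_complement[OF C] ccodim_le_complement by blast
      with \<open>d \<noteq> 0\<close> show ?thesis by (intro exI[of _ "d - 1"]) auto
    qed
    then obtain d' where d': "d' < d" "cdim_le (kerOn A S) d' \<or> ccodim_le A (S ` A) d'" by blast
    obtain A' E m where IH: "direct_sum A A' E" "closed_inv S A'" "closed_inv S E" "Kato_on A' S" "fin_cdim E" "\<forall>x\<in>E. (S ^^ m) x = 0"
      using less.IH[OF d'(1) b(2,6) d'(2)] by blast
    note E = closed_invD[OF IH(3)]
    define F where "F = setsum N E"
    have F: "direct_sum M A' F" "direct_sum F N E"
      using direct_sum_assoc[OF direct_sum_commute[OF b(1)] direct_sum_commute[OF IH(1)]] direct_sum_commute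
      by (auto simp: F_def)
    have fF: "fin_cdim F" using cdim_direct_sum(1)[OF F(2)] b(4) IH(5) by simp
    have sF: "csubspace F" using direct_sum_subspace[OF F(2)] by blast
    have "S ` F \<subseteq> F"
    proof
      fix y assume "y \<in> S ` F"
      then obtain v w where "v \<in> N" "w \<in> E" "y = S v + S w" by (auto simp: F_def setsum_def bounded_clinear_add[OF S])
      then show "y \<in> F" unfolding F_def by (auto intro!: setsumI N(4) E(4))
    qed
    then have "closed_inv S F" using sF closed_fin_cdim[OF sF fF] by (simp add: closed_inv_def)
    moreover have "(S ^^ (n + m)) y = 0" if yF: "y \<in> F" for y
    proof -
      note bn = bounded_clinear_funpow[OF S]
      obtain v w where vw: "v \<in> N" "w \<in> E" "y = v + w" using setsumE[OF yF[unfolded F_def]] by blast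
      have "(S ^^ (n + m)) v = (S ^^ m) ((S ^^ n) v)" by (simp add: add.commute[of n] funpow_add)
      moreover have "(S ^^ (n + m)) w = (S ^^ n) ((S ^^ m) w)" by (simp add: funpow_add)
      ultimately show ?thesis using vw b(5) IH(6) by (simp add: bounded_clinear_add[OF bn] bounded_clinear_0[OF bn])
    qed
    ultimately show ?thesis using F(1) IH(2,4) fF by blast
  qed
qed

lemma Kato_decomposition:
  assumes S: "bounded_clinear S" "closed_inv S M" and sF: "upper_semi_Fredholm_on M S \<or> lower_semi_Fredholm_on M S"
  obtains A E n where "direct_sum M A E" "closed_inv S A" "closed_inv S E" "Kato_on A S" "fin_cdim E"
    "\<And>x. x \<in> E \<Longrightarrow> (S ^^ n) x = 0"
proof -
  have "closed (S ` M)"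
    using sF closed_range_fin_codim[OF S] by (auto simp: upper_semi_Fredholm_on_def lower_semi_Fredholm_on_def)
  moreover obtain d where "cdim_le (kerOn M S) d \<or> ccodim_le M (S ` M) d"
    using sF by (auto simp: upper_semi_Fredholm_on_def lower_semi_Fredholm_on_def fin_cdim_iff fin_codim_iff)
  ultimately show thesis using Kato_decomposition_aux[OF S(1,2)] that by blast
qed


subsection \<open>Operator classes and direct sums\<close>

definition bijective_on :: "'a::complex_banach set \<Rightarrow> ('a \<Rightarrow> 'a) \<Rightarrow> bool" where
  "bijective_on M S \<longleftrightarrow> kerOn M S = {0} \<and> S ` M = M"

lemma BoundedBelow_iff:
  assumes S: "bounded_clinear S" "closed_inv S M"
  shows "in_class_on BoundedBelow M S \<longleftrightarrow> kerOn M S = {0} \<and> closed (S ` M)"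
proof
  note M = closed_invD[OF S(2)]
  {
    assume "in_class_on BoundedBelow M S"
    then obtain c where c: "c > 0" "\<And>x. x \<in> M \<Longrightarrow> c * norm x \<le> norm (S x)" by auto
    have "x = 0" if "x \<in> kerOn M S" for x
      using c(2)[of x] c(1) that by (auto simp: kerOn_def mult_le_0_iff)
    then show "kerOn M S = {0} \<and> closed (S ` M)"
      using bounded_below_closed_range[OF S(1) M(1,2) c] csubspace_0[OF csubspace_kerOn[OF S(1) M(1)]] by auto
  next
    assume "kerOn M S = {0} \<and> closed (S ` M)"
    then obtain c where "c > 0" "\<And>x. x \<in> M \<Longrightarrow> c * norm x \<le> norm (S x)"
      using injective_closed_range_bounded_below[OF S(1) M(1,2)] by blast
    then show "in_class_on BoundedBelow M S" by auto
  }
qed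

lemma Invertible_iff:
  assumes S: "bounded_clinear S" "closed_inv S M"
  shows "in_class_on Invertible M S \<longleftrightarrow> bijective_on M S"
proof
  note M = closed_invD[OF S(2)]
  {
    assume "in_class_on Invertible M S"
    then obtain G where G: "bounded_clinear_on M G" "G ` M \<subseteq> M" "\<And>x. x \<in> M \<Longrightarrow> G (S x) = x" "\<And>x. x \<in> M \<Longrightarrow> S (G x) = x"
      by auto
    have "G 0 = 0" using G(3)[OF csubspace_0[OF M(1)]] bounded_clinear_0[OF S(1)] by simp
    then have "kerOn M S \<subseteq> {0}" using G(3) by (force simp: kerOn_def)
    moreover have "M \<subseteq> S ` M"
    proof
      fix x assume "x \<in> M"
      then have "x = S (G x)" "G x \<in> M" using G by auto
      then show "x \<in> S ` M" by (rule image_eqI)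
    qed
    ultimately show "bijective_on M S"
      using M(5) csubspace_0[OF csubspace_kerOn[OF S(1) M(1)]] by (auto simp: bijective_on_def)
  next
    assume b: "bijective_on M S"
    then obtain c where c: "c > 0" "\<And>x. x \<in> M \<Longrightarrow> c * norm x \<le> norm (S x)"
      using injective_closed_range_bounded_below[OF S(1) M(1,2)] M(2) by (auto simp: bijective_on_def)
    define G where "G = inv_into M S"
    have inj: "x = y" if "x \<in> M" "y \<in> M" "S x = S y" for x y
    proof -
      have "x - y \<in> kerOn M S" using that M(1) S(1) by (simp add: kerOn_def csubspace_diff bounded_clinear_diff)
      then show ?thesis using b by (simp add: bijective_on_def)
    qed
    have SG: "G x \<in> M" "S (G x) = x" if "x \<in> M" for x
    proof -
      have "x \<in> S ` M" using that b by (simp add: bijective_on_def)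
      then show "G x \<in> M" "S (G x) = x" unfolding G_def by (rule inv_into_into, rule f_inv_into_f)
    qed
    have "bounded_clinear_on M G" unfolding bounded_clinear_on_def
    proof (intro conjI ballI allI)
      fix x y assume xy: "x \<in> M" "y \<in> M"
      show "G (x + y) = G x + G y"
        by (rule inj) (use xy SG M(1) S(1) in \<open>simp_all add: csubspace_add bounded_clinear_add\<close>)
    next
      fix a x assume x: "x \<in> M"
      show "G (a *\<^sub>C x) = a *\<^sub>C G x"
        by (rule inj) (use x SG M(1) S(1) in \<open>simp_all add: csubspace_scale bounded_clinear_scale\<close>)
    next
      have "norm (G x) \<le> inverse c * norm x" if "x \<in> M" for x
        using c(2)[OF SG(1)[OF that]] SG(2)[OF that] c(1) by (simp add: field_simps)
      then show "\<exists>K. \<forall>x\<in>M. norm (G x) \<le> K * norm x" by blast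
    qed
    moreover have "G (S x) = x" if "x \<in> M" for x
      by (rule inj) (use that SG M in auto)
    ultimately show "in_class_on Invertible M S" using SG by auto
  }
qed

lemma bijective_in_class:
  assumes S: "bounded_clinear S" "closed_inv S M" and b: "bijective_on M S"
  shows "in_class_on R M S"
proof -
  note M = closed_invD[OF S(2)]
  have k: "kerOn M S = {0}" "S ` M = M" using b by (simp_all add: bijective_on_def)
  have le: "cdim_le (kerOn M S) 0" "ccodim_le M (S ` M) 0"
    using k cdim_le_0[OF csubspace_trivial] ccodim_le_0[OF M(1), of M] by simp_all
  have "cdim (kerOn M S) = 0" "codim M (S ` M) = 0"
    unfolding cdim_eq_Least codim_eq_Least using le by (simp_all add: Least_eq_0)
  moreover have "upper_semi_Fredholm_on M S" "lower_semi_Fredholm_on M S"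
    using le k M(2) by (auto simp: upper_semi_Fredholm_on_def lower_semi_Fredholm_on_def fin_cdim_iff fin_codim_iff)
  moreover have "finite_ascent_on M S"
    unfolding finite_ascent_on_def using k(1) csubspace_0[OF M(1)] by (intro exI[of _ 0]) (auto simp: kerOn_def)
  moreover have "finite_descent_on M S"
    unfolding finite_descent_on_def using k(2) by (intro exI[of _ 0]) simp
  ultimately show ?thesis
    using BoundedBelow_iff[OF S] Invertible_iff[OF S] k b M(2)
    by (cases R) (auto simp: Fredholm_on_def index_nonpos_on_def index_nonneg_on_def simp del: in_class_on.simps(1,3))
qed

text \<open>A kernel vector of a Kato operator has the form \<open>(S ^^ p) y\<close>; then
  \<open>y\<close> is killed by the power \<open>p + 1\<close>, hence already by the power
  \<open>p\<close>.\<close>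

lemma Kato_finite_ascent:
  assumes S: "bounded_clinear S" "closed_inv S M" "Kato_on M S"
  shows "finite_ascent_on M S \<longleftrightarrow> kerOn M S = {0}"
proof
  note M = closed_invD[OF S(2)]
  {
    assume "finite_ascent_on M S"
    then obtain p where p: "kerOn M (S ^^ p) = kerOn M (S ^^ Suc p)" by (auto simp: finite_ascent_on_def)
    have "x = 0" if x: "x \<in> kerOn M S" for x
    proof -
      have "x \<in> (S ^^ p) ` M" using x S(3) by (auto simp: Kato_on_def)
      then obtain y where y: "y \<in> M" "x = (S ^^ p) y" by blast
      then have "y \<in> kerOn M (S ^^ Suc p)" using x by (simp add: kerOn_def)
      then show ?thesis using p y by (auto simp: kerOn_def)
    qed
    then show "kerOn M S = {0}" using csubspace_0[OF csubspace_kerOn[OF S(1) M(1)]] by blast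
  next
    assume "kerOn M S = {0}"
    then show "finite_ascent_on M S"
      unfolding finite_ascent_on_def using csubspace_0[OF M(1)] by (intro exI[of _ 0]) (auto simp: kerOn_def)
  }
qed

text \<open>If \<open>(S ^^ n) z\<close> is a kernel vector it equals \<open>(S ^^ n) (S w)\<close>
  for some \<open>w\<close>, so \<open>z - S w\<close> is killed by a lower power. This is what the
  descent argument needs.\<close>

lemma Kato_kernel_funpow:
  assumes S: "bounded_clinear S" "closed_inv S M" "Kato_on M S" and z: "z \<in> M" "(S ^^ n) z = 0"
  shows "z \<in> S ` M"
  using z
proof (induction n arbitrary: z)
  case 0
  then show ?case using csubspace_0[OF csubspace_image[OF S(1) closed_invD(1)[OF S(2)]]] by simp
next
  case (Suc n)
  note M = closed_invD[OF S(2)]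
  have zn: "(S ^^ n) z \<in> M" using closed_inv_funpow[OF S(2) Suc.prems(1)] .
  then have "(S ^^ n) z \<in> kerOn M S" using Suc.prems by (simp add: kerOn_def)
  then have "(S ^^ n) z \<in> (S ^^ Suc n) ` M" using S(3) unfolding Kato_on_def by blast
  then obtain w where w: "w \<in> M" "(S ^^ n) z = (S ^^ n) (S w)" by (auto simp: funpow_swap1)
  have "z - S w \<in> M" "(S ^^ n) (z - S w) = 0"
    using w Suc.prems M(1,4) by (simp_all add: csubspace_diff bounded_clinear_diff[OF bounded_clinear_funpow[OF S(1)]])
  then have "z - S w \<in> S ` M" by (rule Suc.IH)
  then have "(z - S w) + S w \<in> S ` M" using w(1) by (intro csubspace_add csubspace_image S(1) M(1)) auto
  then show ?case by simp
qed

text \<open>Stable ranges give \<open>(S ^^ q) x = (S ^^ q) (S y)\<close>, and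
  \<open>x - S y\<close>, killed by a power of \<open>S\<close>, lies in the range.\<close>

lemma Kato_finite_descent:
  assumes S: "bounded_clinear S" "closed_inv S M" "Kato_on M S"
  shows "finite_descent_on M S \<longleftrightarrow> S ` M = M"
proof
  note M = closed_invD[OF S(2)]
  {
    assume "finite_descent_on M S"
    then obtain q where q: "(S ^^ q) ` M = (S ^^ Suc q) ` M" by (auto simp: finite_descent_on_def)
    have "x \<in> S ` M" if x: "x \<in> M" for x
    proof -
      have "(S ^^ q) x \<in> (S ^^ Suc q) ` M" using q x by blast
      then obtain y where y: "y \<in> M" "(S ^^ q) x = (S ^^ q) (S y)" by (auto simp: funpow_swap1)
      have "x - S y \<in> S ` M"
        by (rule Kato_kernel_funpow[OF S, of _ q])
          (use x y M in \<open>simp_all add: csubspace_diff bounded_clinear_diff[OF bounded_clinear_funpow[OF S(1)]]\<close>)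
      then have "(x - S y) + S y \<in> S ` M" using y(1) by (intro csubspace_add csubspace_image S(1) M(1)) auto
      then show ?thesis by simp
    qed
    then show "S ` M = M" using M(5) by blast
  next
    assume "S ` M = M"
    then show "finite_descent_on M S" unfolding finite_descent_on_def by (intro exI[of _ 0]) simp
  }
qed

text \<open>For Kato operators \<open>BoundedBelow\<close> and \<open>BPlus\<close> have the same
  criterion, as do \<open>Surjective\<close> and \<open>BMinus\<close>, \<open>Invertible\<close>
  and \<open>B\<close>; this is the link between the two classes of a pair in part (b).\<close>

lemma Kato_in_class:
  assumes S: "bounded_clinear S" "closed_inv S M" "Kato_on M S"
  shows "in_class_on BoundedBelow M S \<longleftrightarrow> cdim_le (kerOn M S) 0"
    "in_class_on Surjective M S \<longleftrightarrow> ccodim_le M (S ` M) 0"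
    "in_class_on Invertible M S \<longleftrightarrow> cdim_le (kerOn M S) 0 \<and> ccodim_le M (S ` M) 0"
    "in_class_on BPlus M S \<longleftrightarrow> cdim_le (kerOn M S) 0"
    "in_class_on BMinus M S \<longleftrightarrow> ccodim_le M (S ` M) 0"
    "in_class_on B M S \<longleftrightarrow> cdim_le (kerOn M S) 0 \<and> ccodim_le M (S ` M) 0"
    "upper_semi_Fredholm_on M S \<longleftrightarrow> (\<exists>n. cdim_le (kerOn M S) n)"
    "lower_semi_Fredholm_on M S \<longleftrightarrow> (\<exists>n. ccodim_le M (S ` M) n)"
proof -
  note M = closed_invD[OF S(2)]
  have cl: "closed (S ` M)" using S(3) by (simp add: Kato_on_def)
  have k: "cdim_le (kerOn M S) 0 \<longleftrightarrow> kerOn M S = {0}" using cdim_le_0[OF csubspace_kerOn[OF S(1) M(1)]] .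
  have r: "ccodim_le M (S ` M) 0 \<longleftrightarrow> S ` M = M" using ccodim_le_0[OF M(1,5)] .
  show u: "upper_semi_Fredholm_on M S \<longleftrightarrow> (\<exists>n. cdim_le (kerOn M S) n)"
    and l: "lower_semi_Fredholm_on M S \<longleftrightarrow> (\<exists>n. ccodim_le M (S ` M) n)"
    using cl by (auto simp: upper_semi_Fredholm_on_def lower_semi_Fredholm_on_def fin_cdim_iff fin_codim_iff)
  show "in_class_on BoundedBelow M S \<longleftrightarrow> cdim_le (kerOn M S) 0" using BoundedBelow_iff[OF S(1,2)] cl k by simp
  show "in_class_on Surjective M S \<longleftrightarrow> ccodim_le M (S ` M) 0" using r by simp
  show "in_class_on Invertible M S \<longleftrightarrow> cdim_le (kerOn M S) 0 \<and> ccodim_le M (S ` M) 0"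
    using Invertible_iff[OF S(1,2)] k r by (simp add: bijective_on_def)
  show bp: "in_class_on BPlus M S \<longleftrightarrow> cdim_le (kerOn M S) 0"
    using u k Kato_finite_ascent[OF S] by auto
  show bm: "in_class_on BMinus M S \<longleftrightarrow> ccodim_le M (S ` M) 0"
    using l r Kato_finite_descent[OF S] by auto
  show "in_class_on B M S \<longleftrightarrow> cdim_le (kerOn M S) 0 \<and> ccodim_le M (S ` M) 0"
  proof -
    have "in_class_on B M S \<longleftrightarrow> in_class_on BPlus M S \<and> in_class_on BMinus M S"
      by (auto simp: Fredholm_on_def)
    then show ?thesis unfolding bp bm .
  qed
qed

lemma Kato_in_class_shift:
  assumes S: "bounded_clinear S" "closed_inv S M" "Kato_on M S"
  obtains r where "r > 0" "\<And>l R. cmod l < r \<Longrightarrow> in_class_on R M (shiftop S l) \<longleftrightarrow> in_class_on R M S"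
proof -
  obtain r where r: "r > 0" "\<And>l. cmod l < r \<Longrightarrow> Kato_on M (shiftop S l)"
    "\<And>l n. cmod l < r \<Longrightarrow> cdim_le (kerOn M (shiftop S l)) n \<longleftrightarrow> cdim_le (kerOn M S) n"
    "\<And>l n. cmod l < r \<Longrightarrow> ccodim_le M (shiftop S l ` M) n \<longleftrightarrow> ccodim_le M (S ` M) n"
    using Kato_constant[OF S] by blast
  have "in_class_on R M (shiftop S l) \<longleftrightarrow> in_class_on R M S" if l: "cmod l < r" for l R
  proof -
    note K = Kato_in_class[OF S]
      Kato_in_class[OF bounded_clinear_shiftop[OF S(1)] closed_inv_shiftop[OF S(2)] r(2)[OF l]]
    have ex: "(\<exists>n. cdim_le (kerOn M (shiftop S l)) n) = (\<exists>n. cdim_le (kerOn M S) n)"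
      "(\<exists>n. ccodim_le M (shiftop S l ` M) n) = (\<exists>n. ccodim_le M (S ` M) n)"
      by (intro ex_cong1, rule r(3)[OF l]) (intro ex_cong1, rule r(4)[OF l])
    \<comment> \<open>Equal bounds for all \<open>n\<close> mean equal predicates, so the least
      values agree whether or not any bound holds.\<close>
    have "cdim (kerOn M (shiftop S l)) = cdim (kerOn M S)" "codim M (shiftop S l ` M) = codim M (S ` M)"
    proof -
      have "cdim_le (kerOn M (shiftop S l)) = cdim_le (kerOn M S)" "ccodim_le M (shiftop S l ` M) = ccodim_le M (S ` M)"
        by (intro ext, rule r(3)[OF l]) (intro ext, rule r(4)[OF l])
      then show "cdim (kerOn M (shiftop S l)) = cdim (kerOn M S)" "codim M (shiftop S l ` M) = codim M (S ` M)"
        by (simp_all only: cdim_eq_Least codim_eq_Least)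
    qed
    moreover have "fin_cdim (kerOn M (shiftop S l)) = fin_cdim (kerOn M S)"
      "fin_codim M (shiftop S l ` M) = fin_codim M (S ` M)"
      unfolding fin_cdim_iff fin_codim_iff using ex by simp_all
    ultimately have i: "index_nonpos_on M (shiftop S l) = index_nonpos_on M S" "index_nonneg_on M (shiftop S l) = index_nonneg_on M S"
      by (simp_all add: index_nonpos_on_def index_nonneg_on_def)
    have ul: "upper_semi_Fredholm_on M (shiftop S l) = upper_semi_Fredholm_on M S"
      "lower_semi_Fredholm_on M (shiftop S l) = lower_semi_Fredholm_on M S"
      unfolding K using ex by simp_all
    show ?thesis
    proof (cases "R \<in> {PhiPlus, PhiMinus, Phi, WPlus, WMinus, W}")
      case True
      then show ?thesis using i ul by (auto simp: Fredholm_on_def)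
    next
      case False
      then have "R \<in> {BoundedBelow, Surjective, Invertible, BPlus, BMinus, B}" by (cases R) auto
      moreover have "cdim_le (kerOn M (shiftop S l)) 0 = cdim_le (kerOn M S) 0"
        "ccodim_le M (shiftop S l ` M) 0 = ccodim_le M (S ` M) 0"
        by (rule r(3)[OF l], rule r(4)[OF l])
      ultimately show ?thesis
        by (elim insertE emptyE) (simp_all only: K(1-6) K(9-14))
    qed
  qed
  with r(1) that show thesis by blast
qed

lemma ascent_stable:
  assumes S: "bounded_clinear S" and M: "closed_inv S M" and p: "kerOn M (S ^^ p) = kerOn M (S ^^ Suc p)" and q: "p \<le> q"
  shows "kerOn M (S ^^ q) = kerOn M (S ^^ p)"
  using q
proof (induction q rule: dec_induct)
  case (step q)
  have "kerOn M (S ^^ Suc q) = kerOn M (S ^^ q)"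
  proof (intro equalityI subsetI)
    fix x assume x: "x \<in> kerOn M (S ^^ Suc q)"
    define z where "z = (S ^^ (q - p)) x"
    have "z \<in> M" unfolding z_def using closed_inv_funpow[OF M] x by (simp add: kerOn_def)
    have e: "(S ^^ p) z = (S ^^ q) x" using funpow_add[of p "q - p" S] step(1) by (simp add: z_def)
    then have e2: "(S ^^ Suc p) z = (S ^^ Suc q) x" by simp
    have "z \<in> kerOn M (S ^^ Suc p)" using x e2 \<open>z \<in> M\<close> by (simp add: kerOn_def)
    then have "(S ^^ p) z = 0" unfolding p[symmetric] by (simp add: kerOn_def)
    then show "x \<in> kerOn M (S ^^ q)" using e x by (simp add: kerOn_def)
  next
    fix x assume "x \<in> kerOn M (S ^^ q)"
    then have x: "x \<in> M" "(S ^^ q) x = 0" by (auto simp: kerOn_def)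
    then show "x \<in> kerOn M (S ^^ Suc q)" using bounded_clinear_0[OF S] by (simp add: kerOn_def)
  qed
  then show ?case using step(3) by (rule trans)
qed simp

lemma descent_stable:
  fixes S :: "'a \<Rightarrow> 'a"
  assumes p: "(S ^^ p) ` M = (S ^^ Suc p) ` M" and q: "p \<le> q"
  shows "(S ^^ q) ` M = (S ^^ p) ` M"
  using q
proof (induction q rule: dec_induct)
  case (step q)
  have "(S ^^ Suc q) ` M = S ` ((S ^^ p) ` M)" unfolding image_funpow_Suc step(3) ..
  also have "\<dots> = (S ^^ p) ` M" unfolding image_funpow_Suc[symmetric] using p ..
  finally show ?case .
qed simp

section \<open>Reduction by an invariant decomposition\<close>

text \<open>The ambient \<open>P\<close> is an arbitrary closed invariant subspace, because the
  locale is used both for the given splitting of the space and for the Kato decomposition of one of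
  its summands.\<close>

locale reduced_operator =
  fixes S :: "'a::complex_banach \<Rightarrow> 'a" and P M N :: "'a set"
  assumes S: "bounded_clinear S" and d: "direct_sum P M N"
    and P: "closed_inv S P" and M: "closed_inv S M" and N: "closed_inv S N"
begin

lemma funpow_image: "(S ^^ n) ` M \<subseteq> M" "(S ^^ n) ` N \<subseteq> N"
  using closed_inv_funpow[OF M] closed_inv_funpow[OF N] by blast+

lemmas funpow_kernel = direct_sum_kernel[OF bounded_clinear_funpow[OF S] d funpow_image]
  and funpow_range = direct_sum_range[OF bounded_clinear_funpow[OF S] d funpow_image]
  and kernel = direct_sum_kernel[OF S d closed_invD(5)[OF M] closed_invD(5)[OF N]]
  and range = direct_sum_range[OF S d closed_invD(5)[OF M] closed_invD(5)[OF N]]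

lemma funpow_kernel': "kerOn N (S ^^ n) = kerOn P (S ^^ n) \<inter> N"
  using direct_sum_kernel(2)[OF bounded_clinear_funpow[OF S] direct_sum_commute[OF d] funpow_image(2,1)] .

lemma funpow_range': "(S ^^ n) ` N = (S ^^ n) ` P \<inter> N"
  using direct_sum_range(2)[OF bounded_clinear_funpow[OF S] direct_sum_commute[OF d] funpow_image(2,1)] .

lemma closed_range_iff: "closed (S ` P) \<longleftrightarrow> closed (S ` M) \<and> closed (S ` N)"
proof
  assume "closed (S ` P)"
  then show "closed (S ` M) \<and> closed (S ` N)"
    using range(2) funpow_range'[of 1] closed_invD(2)[OF M] closed_invD(2)[OF N] by (simp add: closed_Int)
next
  assume *: "closed (S ` M) \<and> closed (S ` N)"
  have "closed (setsum (S ` M) (S ` N))"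
    by (rule closed_setsum_direct[OF d])
      (use * closed_invD[OF M] closed_invD[OF N] closed_invD[OF P] csubspace_image[OF S] in auto)
  then show "closed (S ` P)" using range(1) by (simp add: direct_sum_def)
qed

lemma kernel_dim:
  "fin_cdim (kerOn P S) \<longleftrightarrow> fin_cdim (kerOn M S) \<and> fin_cdim (kerOn N S)"
  "fin_cdim (kerOn M S) \<Longrightarrow> fin_cdim (kerOn N S) \<Longrightarrow> cdim (kerOn P S) = cdim (kerOn M S) + cdim (kerOn N S)"
  using cdim_direct_sum[OF kernel(1)] by blast+

lemma range_codim:
  "fin_codim P (S ` P) \<longleftrightarrow> fin_codim M (S ` M) \<and> fin_codim N (S ` N)"
  "fin_codim M (S ` M) \<Longrightarrow> fin_codim N (S ` N) \<Longrightarrow> codim P (S ` P) = codim M (S ` M) + codim N (S ` N)"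
proof -
  obtain C where C: "direct_sum M (S ` M) C"
    using complement_exists[OF csubspace_image[OF S] closed_invD(1,5)[OF M]] closed_invD(1)[OF M] by blast
  obtain D where D: "direct_sum N (S ` N) D"
    using complement_exists[OF csubspace_image[OF S] closed_invD(1,5)[OF N]] closed_invD(1)[OF N] by blast
  have 1: "direct_sum P (S ` P) (setsum C D)"
    using direct_sum_exchange(1)[OF d C D] range(1) by (simp add: direct_sum_def)
  have 2: "direct_sum (setsum C D) C D" using direct_sum_exchange(3)[OF d C D] .
  show "fin_codim P (S ` P) \<longleftrightarrow> fin_codim M (S ` M) \<and> fin_codim N (S ` N)"
    using codim_complement(1)[OF C] codim_complement(1)[OF D] codim_complement(1)[OF 1] cdim_direct_sum(1)[OF 2] by simp
  show "fin_codim M (S ` M) \<Longrightarrow> fin_codim N (S ` N) \<Longrightarrow> codim P (S ` P) = codim M (S ` M) + codim N (S ` N)"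
    using codim_complement[OF C] codim_complement[OF D] codim_complement(2)[OF 1] cdim_direct_sum(2)[OF 2] by simp
qed

lemma finite_ascent_iff: "finite_ascent_on P S \<longleftrightarrow> finite_ascent_on M S \<and> finite_ascent_on N S"
proof
  assume "finite_ascent_on P S"
  then obtain p where "kerOn P (S ^^ p) = kerOn P (S ^^ Suc p)" by (auto simp: finite_ascent_on_def)
  then have "kerOn M (S ^^ p) = kerOn M (S ^^ Suc p)" "kerOn N (S ^^ p) = kerOn N (S ^^ Suc p)"
    by (simp_all only: funpow_kernel(2) funpow_kernel')
  then show "finite_ascent_on M S \<and> finite_ascent_on N S" unfolding finite_ascent_on_def by blast
next
  assume "finite_ascent_on M S \<and> finite_ascent_on N S"
  then obtain p q where p: "kerOn M (S ^^ p) = kerOn M (S ^^ Suc p)" and q: "kerOn N (S ^^ q) = kerOn N (S ^^ Suc q)"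
    by (auto simp: finite_ascent_on_def)
  define m where "m = max p q"
  have "kerOn M (S ^^ m) = kerOn M (S ^^ Suc m)" "kerOn N (S ^^ m) = kerOn N (S ^^ Suc m)"
    using ascent_stable[OF S M p, of m] ascent_stable[OF S M p, of "Suc m"]
      ascent_stable[OF S N q, of m] ascent_stable[OF S N q, of "Suc m"] by (simp_all add: m_def del: funpow.simps)
  then have "kerOn P (S ^^ m) = kerOn P (S ^^ Suc m)"
    using funpow_kernel(1)[of m] funpow_kernel(1)[of "Suc m"] unfolding direct_sum_def by metis
  then show "finite_ascent_on P S" unfolding finite_ascent_on_def by blast
qed

lemma finite_descent_iff: "finite_descent_on P S \<longleftrightarrow> finite_descent_on M S \<and> finite_descent_on N S"
proof
  assume "finite_descent_on P S"
  then obtain p where "(S ^^ p) ` P = (S ^^ Suc p) ` P" by (auto simp: finite_descent_on_def)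
  then have "(S ^^ p) ` M = (S ^^ Suc p) ` M" "(S ^^ p) ` N = (S ^^ Suc p) ` N"
    by (simp_all only: funpow_range(2) funpow_range')
  then show "finite_descent_on M S \<and> finite_descent_on N S" unfolding finite_descent_on_def by blast
next
  assume "finite_descent_on M S \<and> finite_descent_on N S"
  then obtain p q where p: "(S ^^ p) ` M = (S ^^ Suc p) ` M" and q: "(S ^^ q) ` N = (S ^^ Suc q) ` N"
    by (auto simp: finite_descent_on_def)
  define m where "m = max p q"
  have "(S ^^ m) ` M = (S ^^ Suc m) ` M" "(S ^^ m) ` N = (S ^^ Suc m) ` N"
    using descent_stable[OF p, of m] descent_stable[OF p, of "Suc m"]
      descent_stable[OF q, of m] descent_stable[OF q, of "Suc m"] by (simp_all add: m_def del: funpow.simps)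
  then have "(S ^^ m) ` P = (S ^^ Suc m) ` P"
    using funpow_range(1)[of m] funpow_range(1)[of "Suc m"] unfolding direct_sum_def by metis
  then show "finite_descent_on P S" unfolding finite_descent_on_def by blast
qed

lemma semi_Fredholm_iff:
  "upper_semi_Fredholm_on P S \<longleftrightarrow> upper_semi_Fredholm_on M S \<and> upper_semi_Fredholm_on N S"
  "lower_semi_Fredholm_on P S \<longleftrightarrow> lower_semi_Fredholm_on M S \<and> lower_semi_Fredholm_on N S"
  using closed_range_iff kernel_dim(1) range_codim(1)
  by (auto simp: upper_semi_Fredholm_on_def lower_semi_Fredholm_on_def)

lemma bijective_iff: "bijective_on P S \<longleftrightarrow> bijective_on M S \<and> bijective_on N S"
proof
  have 0: "0 \<in> M" "0 \<in> N" using closed_invD(1)[OF M] closed_invD(1)[OF N] csubspace_0 by blast+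
  have sub: "M \<subseteq> P" "N \<subseteq> P" using direct_sum_subspace[OF d] by blast+
  {
    assume "bijective_on P S"
    then have "kerOn P S = {0}" "S ` P = P" by (auto simp: bijective_on_def)
    then show "bijective_on M S \<and> bijective_on N S"
      using 0 sub kernel(2) range(2) funpow_kernel'[of 1] funpow_range'[of 1]
      by (simp add: bijective_on_def Int_absorb1)
  next
    assume "bijective_on M S \<and> bijective_on N S"
    then show "bijective_on P S"
      using kernel(1) range(1) d by (simp add: bijective_on_def direct_sum_def)
  }
qed

text \<open>Only inheritance by a summand is available here: the other summand may fail these
  classes. Part (b) replaces the missing converse by the larger class \<open>R'\<close>.\<close>

lemma in_class_component:
  assumes "in_class_on R P S" "R \<in> {BoundedBelow, Surjective, Invertible}"
  shows "in_class_on R M S"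
proof -
  have *: "x \<in> P" if "x \<in> M" for x using that direct_sum_subspace[OF d] by blast
  consider "R = BoundedBelow" | "R = Surjective" | "R = Invertible" using assms(2) by blast
  then show ?thesis
  proof cases
    case 1
    then show ?thesis using assms(1) * by auto
  next
    case 2
    then have "S ` M = M" using assms(1) range(2) direct_sum_subspace[OF d] by auto
    with 2 show ?thesis by simp
  next
    case 3
    then have "bijective_on P S" using assms(1) Invertible_iff[OF S P] by blast
    then have "bijective_on M S" using bijective_iff by blast
    then show ?thesis using 3 Invertible_iff[OF S M] by blast
  qed
qed

text \<open>The summand \<open>N\<close> has finite ascent and descent and adds the same finite
  number to nullity and deficiency, so it changes neither the finiteness conditions nor the sign of
  the index.\<close>

lemma in_class_iff:
  assumes N': "in_class_on B N S" "in_class_on W N S"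
    and R: "R \<in> {BPlus, BMinus, B, PhiPlus, PhiMinus, Phi, WPlus, WMinus, W}"
  shows "in_class_on R P S \<longleftrightarrow> in_class_on R M S"
proof -
  have asc: "finite_ascent_on P S \<longleftrightarrow> finite_ascent_on M S" "finite_descent_on P S \<longleftrightarrow> finite_descent_on M S"
    using N' finite_ascent_iff finite_descent_iff by auto
  have F: "upper_semi_Fredholm_on N S" "lower_semi_Fredholm_on N S" using N' by (auto simp: Fredholm_on_def)
  then have ul: "upper_semi_Fredholm_on P S \<longleftrightarrow> upper_semi_Fredholm_on M S" "lower_semi_Fredholm_on P S \<longleftrightarrow> lower_semi_Fredholm_on M S"
    using semi_Fredholm_iff by auto
  have fin: "fin_cdim (kerOn N S)" "fin_codim N (S ` N)"
    using F by (auto simp: upper_semi_Fredholm_on_def lower_semi_Fredholm_on_def)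
  have eq: "cdim (kerOn N S) = codim N (S ` N)"
    using N' fin by (auto simp: index_nonpos_on_def index_nonneg_on_def)
  have "index_nonpos_on P S \<longleftrightarrow> index_nonpos_on M S" if "upper_semi_Fredholm_on M S"
    using that kernel_dim range_codim fin eq by (auto simp: upper_semi_Fredholm_on_def index_nonpos_on_def)
  moreover have "index_nonneg_on P S \<longleftrightarrow> index_nonneg_on M S" if "lower_semi_Fredholm_on M S"
    using that kernel_dim range_codim fin eq by (auto simp: lower_semi_Fredholm_on_def index_nonneg_on_def)
  ultimately show ?thesis using R asc ul by (auto simp: Fredholm_on_def)
qed

lemma shift: "reduced_operator (shiftop S l) P M N"
  using S d P M N by unfold_locales (simp_all add: bounded_clinear_shiftop closed_inv_shiftop)

end

section \<open>Nilpotent and quasinilpotent summands\<close>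

lemma finite_dim_nilpotent_Browder:
  assumes S: "bounded_clinear S" "closed_inv S E" and E: "fin_cdim E" "\<And>x. x \<in> E \<Longrightarrow> (S ^^ n) x = 0"
  shows "in_class_on B E S" "in_class_on W E S"
proof -
  note M = closed_invD[OF S(2)]
  have i: "fin_codim E (S ` E)" "codim E (S ` E) = cdim (kerOn E S)"
    using finite_dim_index_zero[OF E(1) M(1,5)] S(1) by (simp_all add: bounded_clinear_simps)
  have "fin_cdim (S ` E)" "fin_cdim (kerOn E S)"
    using fin_cdim_subset[OF E(1) M(5)] fin_cdim_subset[OF E(1) kerOn_subset] by simp_all
  then have F: "Fredholm_on E S"
    using i closed_fin_cdim csubspace_image[OF S(1) M(1)]
    by (simp add: Fredholm_on_def upper_semi_Fredholm_on_def lower_semi_Fredholm_on_def)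
  have S0: "S 0 = 0" using S(1) by (rule bounded_clinear_0)
  have "kerOn E (S ^^ n) = kerOn E (S ^^ Suc n)" using E(2) S0 by (auto simp: kerOn_def)
  moreover have "(S ^^ n) ` E = (S ^^ Suc n) ` E"
  proof -
    have "(S ^^ n) ` E = (\<lambda>x. 0) ` E" "(S ^^ Suc n) ` E = (\<lambda>x. 0) ` E"
      using E(2) S0 by (simp_all cong: image_cong_simp)
    then show ?thesis by simp
  qed
  ultimately show "in_class_on B E S" "in_class_on W E S"
    using F i by (auto simp: finite_ascent_on_def finite_descent_on_def index_nonpos_on_def index_nonneg_on_def
        simp del: funpow.simps)
qed

lemma bijective_nilpotent_Browder:
  assumes r: "reduced_operator S P K E" and K: "bijective_on K S"
    and E: "fin_cdim E" "\<And>x. x \<in> E \<Longrightarrow> (S ^^ n) x = 0"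
  shows "in_class_on B P S" "in_class_on W P S"
proof -
  interpret reduced_operator S P K E by (rule r)
  note E' = finite_dim_nilpotent_Browder[OF S N E]
  show "in_class_on B P S" "in_class_on W P S"
    using in_class_iff[OF E', of B] in_class_iff[OF E', of W] bijective_in_class[OF S M K] by blast+
qed

text \<open>The first term \<open>- inverse l *\<^sub>C y\<close> of the Neumann series is an
  approximate preimage with relative error \<open>c / cmod l\<close>, at most one half.\<close>

lemma bijective_on_shift_large:
  assumes S: "bounded_clinear S" "closed_inv S M" and c: "\<And>x. x \<in> M \<Longrightarrow> norm (S x) \<le> c * norm x"
    and l: "l \<noteq> 0" "2 * c \<le> cmod l"
  shows "bijective_on M (shiftop S l)"
proof -
  note M = closed_invD[OF S(2)]
  have "x = 0" if "x \<in> M" "S x = l *\<^sub>C x" for x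
  proof -
    have "cmod l * norm x \<le> c * norm x" using c[OF that(1)] that(2) by (simp add: norm_scaleC)
    also have "c * norm x \<le> cmod l / 2 * norm x" using l(2) by (intro mult_right_mono) auto
    finally show ?thesis using l(1) by simp
  qed
  then have "kerOn M (shiftop S l) = {0}"
    using csubspace_0[OF M(1)] S(1) by (auto simp: kerOn_def shiftop_def bounded_clinear_0)
  moreover have "M \<subseteq> shiftop S l ` M"
  proof
    fix y assume y: "y \<in> M"
    have "\<exists>e\<in>M. shiftop S l e = y \<and> norm e \<le> inverse (cmod l) / (1 - 1/2) * norm y"
    proof (rule approximate_surjectivity[OF bounded_clinear_imp[OF bounded_clinear_shiftop[OF S(1)]] M(3,2) _ _ _ _ _ y])
      show "y - shiftop S l e \<in> M" if "y \<in> M" "e \<in> M" for y e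
        using that M(1,4) by (simp add: shiftop_def csubspace_diff csubspace_scale)
      fix y assume y: "y \<in> M"
      define e where "e = (- inverse l) *\<^sub>C y"
      have le: "l *\<^sub>C e = - y" using l(1) by (simp add: e_def scaleC_scaleC scaleC_one)
      have e: "e \<in> M" "norm e = inverse (cmod l) * norm y"
        using y M(1) by (simp_all add: e_def csubspace_neg csubspace_scale norm_scaleC norm_inverse)
      have "norm (y - shiftop S l e) = norm (S e)" using le by (simp add: shiftop_def)
      also have "\<dots> \<le> c * (inverse (cmod l) * norm y)" using c[OF e(1)] e(2) by simp
      also have "\<dots> = (c / cmod l) * norm y" by (simp add: field_simps)
      also have "\<dots> \<le> 1/2 * norm y" using l by (intro mult_right_mono) (auto simp: field_simps)
      finally show "\<exists>e\<in>M. norm e \<le> inverse (cmod l) * norm y \<and> norm (y - shiftop S l e) \<le> 1/2 * norm y"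
        using e by (intro bexI[of _ e]) auto
    qed auto
    then show "y \<in> shiftop S l ` M" by blast
  qed
  moreover have "shiftop S l ` M \<subseteq> M" using closed_invD(5)[OF closed_inv_shiftop[OF S(2)]] .
  ultimately show ?thesis unfolding bijective_on_def by (intro conjI[OF _ equalityI])
qed

text \<open>\<open>S\<^sup>n - l\<^sup>n\<close> factors through \<open>S - l\<close>.\<close>

lemma bijective_on_shift_funpow:
  assumes S: "bounded_clinear S" "closed_inv S M" and b: "bijective_on M (shiftop (S ^^ n) (l ^ n))"
  shows "bijective_on M (shiftop S l)"
proof -
  note M = closed_invD[OF S(2)]
  have "\<exists>w\<in>M. shiftop (S ^^ n) (l ^ n) x = shiftop S l w" if x: "x \<in> M" for n x
  proof (induction n)
    case 0
    then show ?case using csubspace_0[OF M(1)] bounded_clinear_0[OF bounded_clinear_shiftop[OF S(1)], of l]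
      by (intro bexI[of _ 0]) (simp_all add: shiftop_def scaleC_one)
  next
    case (Suc n)
    then obtain w where w: "w \<in> M" "shiftop (S ^^ n) (l ^ n) x = shiftop S l w" by blast
    have "shiftop (S ^^ Suc n) (l ^ Suc n) x = shiftop S l ((S ^^ n) x) + l *\<^sub>C shiftop (S ^^ n) (l ^ n) x"
      by (simp add: shiftop_def scaleC_diff_right scaleC_scaleC)
    also have "\<dots> = shiftop S l ((S ^^ n) x + l *\<^sub>C w)"
      using w(2) by (simp add: bounded_clinear_simps[OF bounded_clinear_shiftop[OF S(1)]])
    finally show ?case using w(1) closed_inv_funpow[OF S(2) x] M(1)
      by (intro bexI[of _ "(S ^^ n) x + l *\<^sub>C w"]) (assumption, simp add: csubspace_add csubspace_scale)
  qed
  then have "shiftop (S ^^ n) (l ^ n) ` M \<subseteq> shiftop S l ` M" by blast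
  moreover have "kerOn M (shiftop S l) \<subseteq> kerOn M (shiftop (S ^^ n) (l ^ n))"
  proof
    fix x assume "x \<in> kerOn M (shiftop S l)"
    then have x: "x \<in> M" "S x = l *\<^sub>C x" by (auto simp: kerOn_def shiftop_def)
    have "(S ^^ n) x = l ^ n *\<^sub>C x" for n
      by (induction n) (simp_all add: scaleC_one bounded_clinear_scale[OF S(1)] x(2) scaleC_scaleC mult.commute)
    then show "x \<in> kerOn M (shiftop (S ^^ n) (l ^ n))" using x(1) by (simp add: kerOn_def shiftop_def)
  qed
  moreover have "shiftop S l ` M \<subseteq> M" using closed_invD(5)[OF closed_inv_shiftop[OF S(2)]] .
  moreover have "0 \<in> kerOn M (shiftop S l)"
    using csubspace_0[OF csubspace_kerOn[OF bounded_clinear_shiftop[OF S(1)] M(1)]] .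
  ultimately show ?thesis using b unfolding bijective_on_def by (intro conjI equalityI) simp_all
qed

text \<open>For some \<open>n\<close> the norm of \<open>S ^^ n\<close> on \<open>M\<close> is at
  most half of \<open>cmod l ^ n\<close>, so \<open>S ^^ n\<close> minus \<open>l ^ n\<close> is
  bijective; bijectivity descends to \<open>S - l\<close> by the factorization.\<close>

lemma quasinilpotent_bijective:
  assumes S: "bounded_clinear S" "closed_inv S M" and q: "quasinilpotent_on M S" and l: "l \<noteq> 0"
  shows "bijective_on M (shiftop S l)"
proof -
  note M = closed_invD[OF S(2)]
  have "\<forall>\<^sub>F n in sequentially. opnorm_on M (S ^^ n) powr (1 / real n) < cmod l / 2"
    using q l unfolding quasinilpotent_on_def by (intro order_tendstoD(2)) auto
  then obtain m where m: "\<And>n. n \<ge> m \<Longrightarrow> opnorm_on M (S ^^ n) powr (1 / real n) < cmod l / 2"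
    unfolding eventually_sequentially by blast
  \<comment> \<open>A positive exponent is needed to undo the root and to have
    \<open>(cmod l / 2) ^ n \<le> cmod l ^ n / 2\<close>.\<close>
  define n where "n = Suc m"
  have n: "n \<ge> 1" "opnorm_on M (S ^^ n) powr (1 / real n) < cmod l / 2"
    using m[of n] by (simp_all add: n_def del: funpow.simps)
  define c where "c = opnorm_on M (S ^^ n)"
  have bn: "bounded_clinear (S ^^ n)" using bounded_clinear_funpow[OF S(1)] .
  obtain K where K: "\<And>x. norm ((S ^^ n) x) \<le> norm x * K" "0 \<le> K"
    using bounded_linear.nonneg_bounded[OF bounded_clinear_imp[OF bn]] by blast
  have bdd: "bdd_above {norm ((S ^^ n) x) | x. x \<in> M \<and> norm x \<le> 1}"
  proof (rule bdd_aboveI)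
    fix y assume "y \<in> {norm ((S ^^ n) x) | x. x \<in> M \<and> norm x \<le> 1}"
    then obtain x where x: "norm x \<le> 1" "y = norm ((S ^^ n) x)" by blast
    have "norm x * K \<le> 1 * K" using x(1) K(2) by (rule mult_right_mono)
    then show "y \<le> K" using K(1)[of x] x(2) by simp
  qed
  have le1: "norm ((S ^^ n) x) \<le> c" if "x \<in> M" "norm x \<le> 1" for x
    unfolding c_def opnorm_on_def by (rule cSup_upper[OF _ bdd]) (use that in blast)
  have c0: "0 \<le> c" using le1[OF csubspace_0[OF M(1)]] by (simp add: bounded_clinear_0[OF bn])
  have le: "norm ((S ^^ n) x) \<le> c * norm x" if x: "x \<in> M" for x
  proof (cases "x = 0")
    case True
    then show ?thesis by (simp add: bounded_clinear_0[OF bn])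
  next
    case False
    define y where "y = of_real (inverse (norm x)) *\<^sub>C x"
    have "y \<in> M" "norm y \<le> 1" using x M(1) False by (simp_all add: y_def csubspace_scale norm_scaleC norm_inverse)
    then have "norm ((S ^^ n) y) \<le> c" by (rule le1)
    then have "inverse (norm x) * norm ((S ^^ n) x) \<le> c"
      by (simp add: y_def bounded_clinear_scale[OF bn] norm_scaleC norm_inverse)
    then show ?thesis using False by (simp add: field_simps)
  qed
  have "c = (c powr (1 / real n)) ^ n"
  proof (cases "c = 0")
    case True
    then show ?thesis using n(1) by simp
  next
    case False
    then show ?thesis using c0 n(1) by (simp add: powr_realpow[symmetric] powr_powr)
  qed
  also have "\<dots> \<le> (cmod l / 2) ^ n" using n(2) unfolding c_def[symmetric] by (intro power_mono) auto
  also have "\<dots> \<le> cmod l ^ n / 2"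
    using self_le_power[of "2::real" n] n(1) unfolding power_divide by (intro divide_left_mono) simp_all
  finally have "2 * c \<le> cmod (l ^ n)" by (simp add: norm_power)
  moreover have "closed_inv (S ^^ n) M" using M closed_inv_funpow[OF S(2)] by (auto simp: closed_inv_def)
  ultimately have "bijective_on M (shiftop (S ^^ n) (l ^ n))"
    using bijective_on_shift_large[OF bn _ le, where l = "l ^ n"] l by simp
  then show ?thesis using bijective_on_shift_funpow[OF S] by blast
qed

lemma nilpotent_imp_quasinilpotent:
  assumes S: "bounded_clinear S" "csubspace N" and "nilpotent_on N S"
  shows "quasinilpotent_on N S"
proof -
  obtain n where n: "\<And>x. x \<in> N \<Longrightarrow> (S ^^ n) x = 0" using assms by (auto simp: nilpotent_on_def)
  have "opnorm_on N (S ^^ m) = 0" if "m \<ge> n" for m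
  proof -
    have "(S ^^ m) x = 0" if "x \<in> N" for x
    proof -
      have "(S ^^ ((m - n) + n)) x = (S ^^ (m - n)) ((S ^^ n) x)" by (simp only: funpow_add o_apply)
      then show ?thesis using \<open>m \<ge> n\<close> n[OF that] bounded_clinear_0[OF bounded_clinear_funpow[OF S(1)]] by simp
    qed
    then have "{norm ((S ^^ m) x) | x. x \<in> N \<and> norm x \<le> 1} = {0}"
      using csubspace_0[OF S(2)] by (auto intro!: exI[of _ 0])
    then show ?thesis by (simp add: opnorm_on_def)
  qed
  then have "\<forall>\<^sub>F m in sequentially. opnorm_on N (S ^^ m) powr (1 / real m) = 0"
    unfolding eventually_sequentially by (intro exI[of _ n]) simp
  then show ?thesis unfolding quasinilpotent_on_def by (rule tendsto_eventually)
qed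


subsection \<open>Riesz operators and spectra\<close>

lemma Kato_nilpotent_punctured:
  assumes r: "reduced_operator S P K E" and K: "Kato_on K S"
    and E: "fin_cdim E" "\<And>x. x \<in> E \<Longrightarrow> (S ^^ n) x = 0"
  obtains e where "e > 0" "\<And>l. 0 < cmod l \<Longrightarrow> cmod l < e \<Longrightarrow> bijective_on E (shiftop S l)"
    "\<And>l R. 0 < cmod l \<Longrightarrow> cmod l < e \<Longrightarrow> in_class_on R K (shiftop S l) \<longleftrightarrow> in_class_on R K S"
proof -
  interpret reduced_operator S P K E by (rule r)
  obtain e where e: "e > 0" "\<And>l R. cmod l < e \<Longrightarrow> in_class_on R K (shiftop S l) \<longleftrightarrow> in_class_on R K S"
    using Kato_in_class_shift[OF S M K] by blast
  have "nilpotent_on E S" using E(2) by (auto simp: nilpotent_on_def)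
  then have "quasinilpotent_on E S" by (rule nilpotent_imp_quasinilpotent[OF S closed_invD(1)[OF N]])
  then have "bijective_on E (shiftop S l)" if "0 < cmod l" for l
    using quasinilpotent_bijective[OF S N] that by simp
  with e that show thesis by blast
qed

text \<open>Off 0 the nilpotent part of the Kato decomposition is bijective, so for small nonzero
  \<open>m\<close> the Kato part alone decides; \<open>b\<close> says that \<open>S\<close> is
  bijective on it. In that case \<open>S\<close> is bijective plus finite-dimensional nilpotent,
  hence Browder of index 0.\<close>

lemma Fredholm_bijective_dichotomy:
  assumes S: "bounded_clinear S" "closed_inv S N" and F: "Fredholm_on N S"
  obtains e b where "e > 0" "\<And>m. 0 < cmod m \<Longrightarrow> cmod m < e \<Longrightarrow> bijective_on N (shiftop S m) \<longleftrightarrow> b"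
    "b \<Longrightarrow> in_class_on B N S" "b \<Longrightarrow> in_class_on W N S"
proof -
  obtain K E n where d: "direct_sum N K E" "closed_inv S K" "closed_inv S E" "Kato_on K S" "fin_cdim E"
    "\<And>x. x \<in> E \<Longrightarrow> (S ^^ n) x = 0"
    using Kato_decomposition[OF S] F unfolding Fredholm_on_def by metis
  have r: "reduced_operator S N K E" using S d by unfold_locales
  obtain e where e: "e > 0" "\<And>l. 0 < cmod l \<Longrightarrow> cmod l < e \<Longrightarrow> bijective_on E (shiftop S l)"
    "\<And>l R. 0 < cmod l \<Longrightarrow> cmod l < e \<Longrightarrow> in_class_on R K (shiftop S l) \<longleftrightarrow> in_class_on R K S"
    using Kato_nilpotent_punctured[OF r d(4,5,6)] by blast
  have iff: "bijective_on N (shiftop S m) \<longleftrightarrow> bijective_on K S" if m: "0 < cmod m" "cmod m < e" for m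
  proof -
    have "bijective_on N (shiftop S m) \<longleftrightarrow> bijective_on K (shiftop S m)"
      using reduced_operator.bijective_iff[OF reduced_operator.shift[OF r]] e(2)[OF m] by blast
    also have "\<dots> \<longleftrightarrow> bijective_on K S"
      using e(3)[OF m, of Invertible] Invertible_iff[OF S(1) d(2)]
        Invertible_iff[OF bounded_clinear_shiftop[OF S(1)] closed_inv_shiftop[OF d(2)]] by blast
    finally show ?thesis .
  qed
  show thesis
    by (rule that[OF e(1) iff bijective_nilpotent_Browder[OF r _ d(5,6)]])
qed

text \<open>Bijectivity of \<open>S - m\<close> on a punctured neighbourhood of \<open>l\<close> is an open and closed condition on
  \<open>l \<noteq> 0\<close>, and it holds for large \<open>l\<close>.\<close>

lemma Riesz_Browder:
  assumes S: "bounded_clinear S" "closed_inv S N" and R: "Riesz_on N S" and l: "l \<noteq> 0"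
  shows "in_class_on B N (shiftop S l)" "in_class_on W N (shiftop S l)"
proof -
  define good where "good a \<longleftrightarrow> (\<exists>e>0. \<forall>m. 0 < cmod m \<and> cmod m < e \<longrightarrow> bijective_on N (shiftop S (a + m)))" for a
  note Sa = bounded_clinear_shiftop[OF S(1)] closed_inv_shiftop[OF S(2)]
  have F: "Fredholm_on N (shiftop S a)" if "a \<noteq> 0" for a using R that by (simp add: Riesz_on_def)
  \<comment> \<open>A disc around \<open>x\<close> that avoids the centre \<open>a\<close>, where
    the dichotomy gives no information.\<close>
  have near: "\<exists>e>0. e \<le> cmod (x - a) \<and> ball x e \<subseteq> ball a r" if "x \<in> ball a r" "x \<noteq> a" for x a :: complex and r
  proof -
    define e where "e = min (cmod (x - a)) (r - dist a x)"
    have "e > 0" using that by (auto simp: e_def)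
    moreover have "ball x e \<subseteq> ball a r"
    proof
      fix y assume "y \<in> ball x e"
      then show "y \<in> ball a r" using dist_triangle[of a y x] by (auto simp: e_def)
    qed
    ultimately show ?thesis by (intro exI[of _ e]) (auto simp: e_def)
  qed
  have loc: "\<exists>T. openin (top_of_set (- {0})) T \<and> a \<in> T \<and> (\<forall>x\<in>T. \<forall>y\<in>T. good x \<longrightarrow> good y)"
    if a: "a \<in> - {0}" for a
  proof -
    have "Fredholm_on N (shiftop S a)" using F a by simp
    then obtain e b where e: "e > 0" "\<And>m. 0 < cmod m \<Longrightarrow> cmod m < e \<Longrightarrow> bijective_on N (shiftop S (a + m)) \<longleftrightarrow> b"
      using Fredholm_bijective_dichotomy[OF Sa] unfolding shiftop_shiftop by metis
    have bij: "bijective_on N (shiftop S y) \<longleftrightarrow> b" if "y \<in> ball a e" "y \<noteq> a" for y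
      using e(2)[of "y - a"] that by (simp add: dist_norm norm_minus_commute)
    have "good x \<longleftrightarrow> b" if x: "x \<in> ball a e" for x
    proof -
      have "\<exists>f>0. \<forall>m. 0 < cmod m \<and> cmod m < f \<longrightarrow> (bijective_on N (shiftop S (x + m)) \<longleftrightarrow> b)"
      proof (cases "x = a")
        case True
        with e show ?thesis by blast
      next
        case False
        then obtain f where f: "f > 0" "f \<le> cmod (x - a)" "ball x f \<subseteq> ball a e" using near x by blast
        have "bijective_on N (shiftop S (x + m)) \<longleftrightarrow> b" if "0 < cmod m" "cmod m < f" for m
        proof (rule bij)
          have "x + m \<in> ball x f" using that by (simp add: dist_norm)
          then show "x + m \<in> ball a e" using f(3) by blast
          show "x + m \<noteq> a"
          proof
            assume "x + m = a"
            then have "x - a = - m" by (simp add: algebra_simps)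
            then have "cmod (x - a) = cmod m" by simp
            then show False using that f(2) by simp
          qed
        qed
        with f(1) show ?thesis by blast
      qed
      then obtain f where f: "f > 0" "\<And>m. 0 < cmod m \<Longrightarrow> cmod m < f \<Longrightarrow> bijective_on N (shiftop S (x + m)) \<longleftrightarrow> b" by blast
      show ?thesis
      proof
        assume "good x"
        then obtain g where g: "g > 0" "\<And>m. 0 < cmod m \<Longrightarrow> cmod m < g \<Longrightarrow> bijective_on N (shiftop S (x + m))"
          by (auto simp: good_def)
        define m where "m = complex_of_real (min f g / 2)"
        have "cmod m = min f g / 2" unfolding m_def norm_of_real using f(1) g(1) by simp
        then have "0 < cmod m" "cmod m < f" "cmod m < g" using f(1) g(1) by auto
        then show b using f(2) g(2) by blast
      next
        assume b
        then show "good x" unfolding good_def using f by blast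
      qed
    qed
    moreover have "openin (top_of_set (- {0})) ((- {0}) \<inter> ball a e)" by (rule openin_open_Int) simp
    ultimately show ?thesis using a e(1) by (intro exI[of _ "(- {0}) \<inter> ball a e"]) simp
  qed
  obtain K where K: "0 < K" "\<And>x. norm (S x) \<le> norm x * K"
    using bounded_linear.pos_bounded[OF bounded_clinear_imp[OF S(1)]] by blast
  \<comment> \<open>Every point within distance 1 of \<open>z\<close> then has modulus at least
    \<open>2 * K + 1\<close>, beyond the threshold \<open>2 * K\<close> for bijectivity.\<close>
  define z where "z = complex_of_real (2 * K + 2)"
  have cz: "cmod z = 2 * K + 2" unfolding z_def norm_of_real using K by simp
  have "good z" unfolding good_def
  proof (intro exI[of _ 1] conjI allI impI)
    fix m assume m: "0 < cmod m \<and> cmod m < 1"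
    have "cmod (z + m) \<ge> 2 * K + 1" using cz m norm_diff_ineq[of z m] by simp
    moreover from this have "cmod (z + m) > 0" using K(1) by linarith
    then have "z + m \<noteq> 0" unfolding zero_less_norm_iff .
    ultimately show "bijective_on N (shiftop S (z + m))"
      using K by (intro bijective_on_shift_large[OF S, of K]) (simp_all add: mult.commute)
  qed simp
  moreover have "connected (- {0 :: complex})" by (rule connected_punctured_universe) simp
  moreover have "z \<in> - {0}" using cz K by auto
  ultimately have "good l" using connected_induction_simple[of "- {0}" z l good] loc l by blast
  then obtain g where g: "g > 0" "\<And>m. 0 < cmod m \<Longrightarrow> cmod m < g \<Longrightarrow> bijective_on N (shiftop S (l + m))"
    by (auto simp: good_def)
  obtain e b where e: "e > 0" "\<And>m. 0 < cmod m \<Longrightarrow> cmod m < e \<Longrightarrow> bijective_on N (shiftop S (l + m)) \<longleftrightarrow> b"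
    and b: "b \<Longrightarrow> in_class_on B N (shiftop S l)" "b \<Longrightarrow> in_class_on W N (shiftop S l)"
    using Fredholm_bijective_dichotomy[OF Sa F[OF l]] unfolding shiftop_shiftop by metis
  define m where "m = complex_of_real (min e g / 2)"
  have "cmod m = min e g / 2" unfolding m_def norm_of_real using e(1) g(1) by simp
  then have "0 < cmod m" "cmod m < e" "cmod m < g" using e(1) g(1) by auto
  then have b using e(2) g(2) by blast
  then show "in_class_on B N (shiftop S l)" "in_class_on W N (shiftop S l)" by (rule b)+
qed

lemma quasinilpotent_imp_Riesz:
  assumes S: "bounded_clinear S" "closed_inv S N" and q: "quasinilpotent_on N S"
  shows "Riesz_on N S"
  unfolding Riesz_on_def
proof (intro allI impI)
  fix l :: complex assume "l \<noteq> 0"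
  then have "in_class_on Phi N (shiftop S l)"
    using bijective_in_class[OF bounded_clinear_shiftop[OF S(1)] closed_inv_shiftop[OF S(2)]]
      quasinilpotent_bijective[OF S q] by blast
  then show "Fredholm_on N (shiftop S l)" by simp
qed

lemma Riesz_summand_punctured:
  assumes r: "reduced_operator S P M N" and Riesz: "Riesz_on N S" and l: "l \<noteq> 0"
  shows "R \<in> {BPlus, BMinus, B, PhiPlus, PhiMinus, Phi, WPlus, WMinus, W} \<Longrightarrow>
      in_class_on R P (shiftop S l) \<longleftrightarrow> in_class_on R M (shiftop S l)"
    and "R \<in> {BoundedBelow, Surjective, Invertible} \<Longrightarrow>
      in_class_on R P (shiftop S l) \<Longrightarrow> in_class_on R M (shiftop S l)"
proof -
  interpret reduced_operator S P M N by (rule r)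
  interpret s: reduced_operator "shiftop S l" P M N by (rule shift)
  show "in_class_on R P (shiftop S l) \<longleftrightarrow> in_class_on R M (shiftop S l)"
    if "R \<in> {BPlus, BMinus, B, PhiPlus, PhiMinus, Phi, WPlus, WMinus, W}"
    by (rule s.in_class_iff[OF Riesz_Browder[OF S N Riesz l] that])
  show "in_class_on R M (shiftop S l)"
    if "R \<in> {BoundedBelow, Surjective, Invertible}" "in_class_on R P (shiftop S l)"
    by (rule s.in_class_component[OF that(2,1)])
qed

section \<open>Punctured neighbourhoods and comparison of the decompositions\<close>

lemma inv_decomp_iff: "bounded_clinear S \<Longrightarrow> inv_decomp S M N \<longleftrightarrow> reduced_operator S UNIV M N"
  by (auto simp: inv_decomp_def reduced_operator_def direct_sum_def closed_inv_def)

text \<open>Puts part (a), where the two classes coincide, and part (b) under one argument.\<close>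

definition class_pair :: "opclass \<Rightarrow> opclass \<Rightarrow> bool" where
  "class_pair R R' \<longleftrightarrow> (R \<in> {BPlus, BMinus, B, PhiPlus, PhiMinus, Phi, WPlus, WMinus, W} \<and> R' = R) \<or>
    (R, R') \<in> {(BoundedBelow, BPlus), (Surjective, BMinus), (Invertible, B)}"

lemma GKRD_punctured:
  assumes S: "bounded_clinear S" and G: "has_GKRD S" and p: "class_pair R R'"
    and seq: "\<And>r. r > 0 \<Longrightarrow> \<exists>l. 0 < cmod l \<and> cmod l < r \<and> in_class_on R UNIV (shiftop S l)"
  shows "\<exists>r>0. \<forall>l. 0 < cmod l \<and> cmod l < r \<longrightarrow> in_class_on R' UNIV (shiftop S l)"
proof -
  obtain M N where "inv_decomp S M N" and K: "Kato_on M S" and Riesz: "Riesz_on N S" using G by (auto simp: has_GKRD_def)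
  then have r: "reduced_operator S UNIV M N" using inv_decomp_iff[OF S] by blast
  then have M: "closed_inv S M" by (rule reduced_operator.M)
  obtain e where e: "e > 0" "\<And>l R. cmod l < e \<Longrightarrow> in_class_on R M (shiftop S l) \<longleftrightarrow> in_class_on R M S"
    using Kato_in_class_shift[OF S M K] by blast
  \<comment> \<open>One nearby point suffices, since membership of the Kato part is constant on the
    disc of radius \<open>e\<close>.\<close>
  obtain l where l: "0 < cmod l" "cmod l < e" "in_class_on R UNIV (shiftop S l)" using seq[OF e(1)] by blast
  have "in_class_on R M (shiftop S l)"
    using Riesz_summand_punctured[OF r Riesz, of l R] l p by (auto simp: class_pair_def)
  then have "in_class_on R M S" using e(2)[OF l(2)] by simp
  \<comment> \<open>On the Kato summand the two classes of a pair coincide; only after this exchange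
    can the result be carried back to the whole space.\<close>
  then have R'M: "in_class_on R' M S"
  proof -
    note K' = Kato_in_class[OF S M K]
    consider "R' = R" | "R = BoundedBelow" "R' = BPlus" | "R = Surjective" "R' = BMinus" | "R = Invertible" "R' = B"
      using p by (auto simp: class_pair_def)
    then show ?thesis
      using \<open>in_class_on R M S\<close> by cases (simp_all only: K'(1-6))
  qed
  have R': "R' \<in> {BPlus, BMinus, B, PhiPlus, PhiMinus, Phi, WPlus, WMinus, W}" using p by (auto simp: class_pair_def)
  have "in_class_on R' UNIV (shiftop S l)" if "0 < cmod l" "cmod l < e" for l
    using Riesz_summand_punctured(1)[OF r Riesz _ R', of l] e(2)[OF that(2), of R'] R'M that(1) by simp
  with e(1) show ?thesis by blast
qed

lemma in_class_semi_Fredholm: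
  "in_class_on R M S \<Longrightarrow> R \<in> {BPlus, BMinus, B, PhiPlus, PhiMinus, Phi, WPlus, WMinus, W} \<Longrightarrow>
    upper_semi_Fredholm_on M S \<or> lower_semi_Fredholm_on M S"
  by (auto simp: Fredholm_on_def)

text \<open>Here \<open>S\<close> need not be Kato on \<open>M\<close>, but it is semi-Fredholm
  there, so it differs from a Kato operator by a finite-dimensional nilpotent summand. That summand
  is Browder of index 0 at the point itself and bijective nearby, and never affects
  membership.\<close>

lemma gDR_punctured:
  assumes S: "bounded_clinear S" and G: "gDR R S"
    and R: "R \<in> {BPlus, BMinus, B, PhiPlus, PhiMinus, Phi, WPlus, WMinus, W}"
  shows "\<exists>r>0. \<forall>l. 0 < cmod l \<and> cmod l < r \<longrightarrow> in_class_on R UNIV (shiftop S l)"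
proof -
  obtain M N where "inv_decomp S M N" and RM: "in_class_on R M S" and Riesz: "Riesz_on N S" using G by (auto simp: gDR_def)
  then have r: "reduced_operator S UNIV M N" using inv_decomp_iff[OF S] by blast
  then have M: "closed_inv S M" by (rule reduced_operator.M)
  obtain K E n where d: "direct_sum M K E" "closed_inv S K" "closed_inv S E" "Kato_on K S" "fin_cdim E"
    "\<And>x. x \<in> E \<Longrightarrow> (S ^^ n) x = 0"
    using Kato_decomposition[OF S M in_class_semi_Fredholm[OF RM R]] by blast
  have rM: "reduced_operator S M K E" using S M d by unfold_locales
  have RK: "in_class_on R K S"
    using reduced_operator.in_class_iff[OF rM finite_dim_nilpotent_Browder[OF S d(3,5,6)] R] RM by blast
  obtain e where e: "e > 0" "\<And>l. 0 < cmod l \<Longrightarrow> cmod l < e \<Longrightarrow> bijective_on E (shiftop S l)"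
    "\<And>l R. 0 < cmod l \<Longrightarrow> cmod l < e \<Longrightarrow> in_class_on R K (shiftop S l) \<longleftrightarrow> in_class_on R K S"
    using Kato_nilpotent_punctured[OF rM d(4,5,6)] by blast
  have "in_class_on R UNIV (shiftop S l)" if l: "0 < cmod l" "cmod l < e" for l
  proof -
    note bE = bijective_in_class[OF bounded_clinear_shiftop[OF S] closed_inv_shiftop[OF d(3)] e(2)[OF l]]
    have "in_class_on R M (shiftop S l)"
      using reduced_operator.in_class_iff[OF reduced_operator.shift[OF rM] bE bE R] e(3)[OF l] RK by blast
    then show ?thesis using Riesz_summand_punctured(1)[OF r Riesz _ R, of l] l(1) by simp
  qed
  with e(1) show ?thesis by blast
qed

lemma closed_inv_UNIV [simp]: "closed_inv S UNIV"
  by (simp add: closed_inv_def)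

lemma reduced_operator_trivial:
  assumes "bounded_clinear S"
  shows "reduced_operator S UNIV UNIV {0}" "bijective_on {0} S" "nilpotent_on {0} S" "fin_cdim ({0} :: 'a::complex_banach set)"
proof -
  have S0: "S 0 = 0" using assms by (rule bounded_clinear_0)
  then have "closed_inv S {0}" by (simp add: closed_inv_def)
  then show "reduced_operator S UNIV UNIV {0}" using assms direct_sum_trivial[of UNIV] by unfold_locales simp_all
  show "bijective_on {0} S" using S0 by (auto simp: bijective_on_def kerOn_def)
  show "nilpotent_on {0} S" unfolding nilpotent_on_def by (rule exI[of _ 0]) simp
  have "cdim_le ({0} :: 'a set) 0" by (simp only: cdim_le_0[OF csubspace_trivial])
  then show "fin_cdim ({0} :: 'a set)" by (simp only: fin_cdim_iff) (rule exI)
qed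

lemma in_class_imp_gDR:
  assumes S: "bounded_clinear S" and R: "in_class_on R UNIV S"
  shows "gDR R S"
proof -
  note t = reduced_operator_trivial[OF S]
  have "quasinilpotent_on {0} S" by (rule nilpotent_imp_quasinilpotent[OF S csubspace_trivial t(3)])
  then have "Riesz_on {0} S" by (rule quasinilpotent_imp_Riesz[OF S reduced_operator.N[OF t(1)]])
  then show ?thesis unfolding gDR_def using R t(1) inv_decomp_iff[OF S] by blast
qed

lemma Kato_imp_essentially_Kato:
  assumes S: "bounded_clinear S" and K: "Kato_on UNIV S"
  shows "essentially_Kato S"
  unfolding essentially_Kato_def using reduced_operator_trivial[OF S] inv_decomp_iff[OF S] K by blast

lemma semi_Fredholm_imp_essentially_Kato:
  assumes S: "bounded_clinear S" and F: "upper_semi_Fredholm_on UNIV S \<or> lower_semi_Fredholm_on UNIV S"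
  shows "essentially_Kato S"
proof -
  obtain K E n where d: "direct_sum UNIV K E" "closed_inv S K" "closed_inv S E" "Kato_on K S" "fin_cdim E"
    "\<And>x. x \<in> E \<Longrightarrow> (S ^^ n) x = 0"
    using Kato_decomposition[OF S _ F] by (metis closed_inv_UNIV)
  have "reduced_operator S UNIV K E" using S d by unfold_locales simp_all
  then show ?thesis unfolding essentially_Kato_def nilpotent_on_def using d inv_decomp_iff[OF S] by blast
qed

lemma essentially_Kato_imp_Kato_type: "essentially_Kato S \<Longrightarrow> Kato_type S"
  by (auto simp: essentially_Kato_def Kato_type_def)

lemma Kato_type_imp_GKD: "bounded_clinear S \<Longrightarrow> Kato_type S \<Longrightarrow> has_GKD S"
  unfolding Kato_type_def has_GKD_def
  using nilpotent_imp_quasinilpotent by (metis closed_inv_def inv_decomp_def)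

lemma GKD_imp_GKRD: "bounded_clinear S \<Longrightarrow> has_GKD S \<Longrightarrow> has_GKRD S"
  unfolding has_GKD_def has_GKRD_def
  using quasinilpotent_imp_Riesz by (metis inv_decomp_def)

lemma in_class_imp_Kato:
  assumes S: "bounded_clinear S" "closed_inv S M" and R: "in_class_on R M S" "R \<in> {BoundedBelow, Surjective, Invertible}"
  shows "Kato_on M S"
proof -
  note M = closed_invD[OF S(2)]
  have "(kerOn M S = {0} \<and> closed (S ` M)) \<or> S ` M = M"
  proof -
    consider "R = BoundedBelow" | "R = Surjective" | "R = Invertible" using R(2) by blast
    then show ?thesis
    proof cases
      case 1
      then show ?thesis using R(1) BoundedBelow_iff[OF S] by simp
    next
      case 2
      then show ?thesis using R(1) by simp
    next
      case 3
      then have "bijective_on M S" using R(1) Invertible_iff[OF S] by simp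
      then show ?thesis by (simp add: bijective_on_def)
    qed
  qed
  then show ?thesis
  proof
    assume "kerOn M S = {0} \<and> closed (S ` M)"
    moreover have "0 \<in> (S ^^ n) ` M" for n
      using csubspace_0[OF csubspace_image[OF bounded_clinear_funpow[OF S(1)] M(1)]] .
    ultimately show ?thesis by (simp add: Kato_on_def)
  next
    assume s: "S ` M = M"
    have "(S ^^ n) ` M = M" for n
      by (induction n) (simp_all add: image_funpow_Suc s del: funpow.simps(2))
    then show ?thesis using M(2) s kerOn_subset by (simp add: Kato_on_def)
  qed
qed

text \<open>The one-sided classes consist of Kato operators, so constancy near a Kato operator
  applies. For the other classes this is \<open>gDR_punctured\<close> with zero Riesz
  summand.\<close>

lemma in_class_open:
  assumes S: "bounded_clinear S" and R: "in_class_on R UNIV S" and p: "class_pair R R'"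
  shows "\<exists>r>0. \<forall>l. 0 < cmod l \<and> cmod l < r \<longrightarrow> in_class_on R UNIV (shiftop S l)"
proof (cases "R \<in> {BoundedBelow, Surjective, Invertible}")
  case True
  then have "Kato_on UNIV S" using in_class_imp_Kato[OF S _ R] by simp
  then show ?thesis using Kato_in_class_shift[OF S closed_inv_UNIV] R by metis
next
  case False
  then show ?thesis using gDR_punctured[OF S in_class_imp_gDR[OF S R]] p by (auto simp: class_pair_def)
qed

section \<open>Boundaries, hulls and the chain of spectra\<close>

lemma bounded_sigma_cls:
  assumes T: "bounded_clinear T"
  shows "bounded (sigma_cls R T)"
proof -
  obtain K where K: "0 < K" "\<And>x. norm (T x) \<le> norm x * K"
    using bounded_linear.pos_bounded[OF bounded_clinear_imp[OF T]] by blast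
  have "cmod l \<le> 2 * K" if "l \<in> sigma_cls R T" for l
  proof (rule ccontr)
    assume "\<not> cmod l \<le> 2 * K"
    moreover from this have "l \<noteq> 0" using K(1) by auto
    ultimately have "bijective_on UNIV (shiftop T l)"
      using K by (intro bijective_on_shift_large[OF T closed_inv_UNIV, of K]) (simp_all add: mult.commute)
    then have "in_class_on R UNIV (shiftop T l)" by (rule bijective_in_class[OF bounded_clinear_shiftop[OF T] closed_inv_UNIV])
    then show False using that by (simp add: sigma_cls_def)
  qed
  then show ?thesis unfolding bounded_iff by blast
qed

text \<open>An unbounded connected set avoiding \<open>H\<close> cannot meet \<open>K\<close>: it
  also leaves the bounded set \<open>K\<close>, so it would cross the frontier, which lies in
  \<open>H\<close>. Hence the two complements have the same unbounded components.\<close>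

lemma eta_eq:
  assumes K: "bounded K" and H: "frontier K \<subseteq> H" "H \<subseteq> K"
  shows "eta H = eta K"
proof -
  have "C \<in> components (- H) \<and> \<not> bounded C \<longleftrightarrow> C \<in> components (- K) \<and> \<not> bounded C" for C
  proof -
    have sub: "C \<subseteq> - K" if "connected C" "C \<subseteq> - H" "\<not> bounded C" for C
    proof (rule ccontr)
      assume "\<not> C \<subseteq> - K"
      then have "C \<inter> K \<noteq> {}" by blast
      moreover have "C - K \<noteq> {}" using that(3) K bounded_subset by blast
      ultimately have "C \<inter> frontier K \<noteq> {}" by (rule connected_Int_frontier[OF that(1)])
      then show False using that(2) H(1) by blast
    qed
    show ?thesis unfolding in_components_maximal using sub H(2)
      by (metis Compl_subset_Compl_iff bounded_subset order_trans)
  qed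
  then show ?thesis unfolding eta_def by simp
qed

lemma punctured_nbhd_not_limpt:
  assumes r: "r > 0" and P: "\<And>m. 0 < cmod m \<Longrightarrow> cmod m < r \<Longrightarrow> P (l + m)"
  shows "\<not> l islimpt {z. \<not> P z}"
proof
  assume "l islimpt {z. \<not> P z}"
  then obtain z where z: "\<not> P z" "z \<noteq> l" "dist z l < r" using r unfolding islimpt_approachable by blast
  then show False using P[of "z - l"] by (simp add: dist_norm)
qed

text \<open>A boundary point of the set where \<open>P\<close> fails is approached by points of
  \<open>P\<close> other than itself; by \<open>G\<close> a whole punctured disc then satisfies
  \<open>Q\<close>, contradicting accumulation. Below, \<open>P\<close> and \<open>Q\<close> are
  membership in the two classes of a pair.\<close>

lemma frontier_not_punctured:
  fixes P Q :: "complex \<Rightarrow> bool"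
  assumes op: "\<And>l. P l \<Longrightarrow> \<exists>r>0. \<forall>m. 0 < cmod m \<and> cmod m < r \<longrightarrow> P (l + m)"
    and acc: "frontier {z. \<not> P z} \<subseteq> acc {z. \<not> Q z}"
    and l: "l \<in> frontier {z. \<not> P z}"
    and G: "(\<And>r. r > 0 \<Longrightarrow> \<exists>m. 0 < cmod m \<and> cmod m < r \<and> P (l + m)) \<Longrightarrow>
      \<exists>r>0. \<forall>m. 0 < cmod m \<and> cmod m < r \<longrightarrow> Q (l + m)"
  shows False
proof -
  have "\<exists>m. 0 < cmod m \<and> cmod m < r \<and> P (l + m)" if r: "r > 0" for r
  proof (rule ccontr)
    assume no: "\<not> ?thesis"
    \<comment> \<open>If \<open>P\<close> held at \<open>l\<close> itself, \<open>op\<close> would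
      already provide points of \<open>P\<close> in the punctured disc.\<close>
    have "\<not> P l"
    proof
      assume "P l"
      then obtain s where s: "s > 0" "\<And>m. 0 < cmod m \<Longrightarrow> cmod m < s \<Longrightarrow> P (l + m)" using op by blast
      define m where "m = complex_of_real (min r s / 2)"
      have "cmod m = min r s / 2" unfolding m_def norm_of_real using r s(1) by simp
      then have "0 < cmod m" "cmod m < r" "cmod m < s" using r s(1) by auto
      then show False using no s(2) by blast
    qed
    have "ball l r \<subseteq> {z. \<not> P z}"
    proof
      fix z assume z: "z \<in> ball l r"
      show "z \<in> {z. \<not> P z}"
      proof (cases "z = l")
        case False
        then show ?thesis using no z by (auto simp: dist_norm norm_minus_commute dest!: spec[of _ "z - l"])
      qed (use \<open>\<not> P l\<close> in simp)
    qed
    then have "l \<in> interior {z. \<not> P z}" using r by (meson centre_in_ball interior_maximal open_ball subsetD)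
    then show False using l by (simp add: frontier_def)
  qed
  then obtain r where "r > 0" "\<And>m. 0 < cmod m \<Longrightarrow> cmod m < r \<Longrightarrow> Q (l + m)" using G by blast
  then have "\<not> l islimpt {z. \<not> Q z}" by (rule punctured_nbhd_not_limpt)
  then show False using acc l by (auto simp: acc_def)
qed

lemma isolated_in_frontier:
  fixes P :: "complex \<Rightarrow> bool"
  assumes r: "r > 0" "\<And>m. 0 < cmod m \<Longrightarrow> cmod m < r \<Longrightarrow> P (l + m)" and l: "\<not> P l"
  shows "l \<in> frontier {z. \<not> P z}"
proof -
  have "l \<notin> interior {z. \<not> P z}"
  proof
    assume "l \<in> interior {z. \<not> P z}"
    then have "l islimpt {z. \<not> P z}" using interior_limit_point by blast
    then show False using punctured_nbhd_not_limpt[of r P l] r by blast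
  qed
  moreover have "l \<in> closure {z. \<not> P z}" using l by (intro subsetD[OF closure_subset]) simp
  ultimately show ?thesis by (simp add: frontier_def)
qed

lemma frontier_subset_sigma_gKR:
  assumes T: "bounded_clinear T" and p: "class_pair R R'"
    and acc: "frontier (sigma_cls R T) \<subseteq> acc (sigma_cls R' T)"
  shows "frontier (sigma_cls R T) \<subseteq> sigma_gKR T"
proof
  fix l assume l: "l \<in> frontier (sigma_cls R T)"
  note Tl = bounded_clinear_shiftop[OF T]
  show "l \<in> sigma_gKR T"
  proof (rule ccontr)
    assume "l \<notin> sigma_gKR T"
    then have G: "has_GKRD (shiftop T l)" by (simp add: sigma_gKR_def)
    show False
    proof (rule frontier_not_punctured[OF _ acc[unfolded sigma_cls_def] l[unfolded sigma_cls_def]])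
      show "\<exists>r>0. \<forall>m. 0 < cmod m \<and> cmod m < r \<longrightarrow> in_class_on R UNIV (shiftop T (a + m))"
        if "in_class_on R UNIV (shiftop T a)" for a
        using in_class_open[OF Tl that p] by simp
      show "\<exists>r>0. \<forall>m. 0 < cmod m \<and> cmod m < r \<longrightarrow> in_class_on R' UNIV (shiftop T (l + m))"
        if "\<And>r. r > 0 \<Longrightarrow> \<exists>m. 0 < cmod m \<and> cmod m < r \<and> in_class_on R UNIV (shiftop T (l + m))"
        using GKRD_punctured[OF Tl G p] that by simp
    qed
  qed
qed

lemma sigma_chain:
  assumes T: "bounded_clinear T"
  shows "sigma_gKR T \<subseteq> sigma_gK T" "sigma_gK T \<subseteq> sigma_Kt T" "sigma_Kt T \<subseteq> sigma_eK T"
    "sigma_eK T \<subseteq> sigma_K T" "sigma_gDR R T \<subseteq> sigma_cls R T"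
proof -
  note Tl = bounded_clinear_shiftop[OF T]
  show "sigma_gKR T \<subseteq> sigma_gK T" unfolding sigma_gKR_def sigma_gK_def using GKD_imp_GKRD[OF Tl] by blast
  show "sigma_gK T \<subseteq> sigma_Kt T" unfolding sigma_Kt_def sigma_gK_def using Kato_type_imp_GKD[OF Tl] by blast
  show "sigma_Kt T \<subseteq> sigma_eK T" unfolding sigma_Kt_def sigma_eK_def using essentially_Kato_imp_Kato_type by blast
  show "sigma_eK T \<subseteq> sigma_K T" unfolding sigma_K_def sigma_eK_def using Kato_imp_essentially_Kato[OF Tl] by blast
  show "sigma_gDR R T \<subseteq> sigma_cls R T" unfolding sigma_gDR_def sigma_cls_def using in_class_imp_gDR[OF Tl] by blast
qed

lemma sigma_eK_subset:
  assumes T: "bounded_clinear T" and R: "R \<in> {BPlus, BMinus, B, PhiPlus, PhiMinus, Phi, WPlus, WMinus, W}"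
  shows "sigma_eK T \<subseteq> sigma_cls R T"
  unfolding sigma_cls_def sigma_eK_def
  using semi_Fredholm_imp_essentially_Kato[OF bounded_clinear_shiftop[OF T]] in_class_semi_Fredholm[OF _ R] by blast

text \<open>Members of these classes are Kato, also on a summand, so a decomposition witnessing
  \<open>gDR\<close> is a GKRD. In part (b) this places \<open>sigma_gDR R T\<close> between
  \<open>sigma_gKR T\<close> and \<open>sigma_cls R T\<close>, which is all that the hulls
  require.\<close>

lemma sigma_K_subset:
  assumes T: "bounded_clinear T" and R: "R \<in> {BoundedBelow, Surjective, Invertible}"
  shows "sigma_K T \<subseteq> sigma_cls R T" "sigma_gKR T \<subseteq> sigma_gDR R T"
proof -
  note Tl = bounded_clinear_shiftop[OF T]
  show "sigma_K T \<subseteq> sigma_cls R T"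
    unfolding sigma_cls_def sigma_K_def using in_class_imp_Kato[OF Tl closed_inv_UNIV _ R] by blast
  have "has_GKRD (shiftop T l)" if "gDR R (shiftop T l)" for l
    using that in_class_imp_Kato[OF Tl _ _ R] unfolding gDR_def has_GKRD_def inv_decomp_def by blast
  then show "sigma_gKR T \<subseteq> sigma_gDR R T" unfolding sigma_gKR_def sigma_gDR_def by blast
qed

text \<open>A point outside \<^term>\<open>sigma_gDR R T\<close> is at worst isolated in \<^term>\<open>sigma_cls R T\<close>, which the
  hypothesis on the boundary rules out.\<close>

lemma sigma_gDR_eq:
  assumes T: "bounded_clinear T" and R: "R \<in> {BPlus, BMinus, B, PhiPlus, PhiMinus, Phi, WPlus, WMinus, W}"
    and acc: "frontier (sigma_cls R T) \<subseteq> acc (sigma_cls R T)"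
  shows "sigma_gDR R T = sigma_cls R T"
proof
  note Tl = bounded_clinear_shiftop[OF T]
  show "sigma_gDR R T \<subseteq> sigma_cls R T" by (rule sigma_chain(5)[OF T])
  show "sigma_cls R T \<subseteq> sigma_gDR R T"
  proof
    fix l assume l: "l \<in> sigma_cls R T"
    show "l \<in> sigma_gDR R T"
    proof (rule ccontr)
      assume "l \<notin> sigma_gDR R T"
      then have "gDR R (shiftop T l)" by (simp add: sigma_gDR_def)
      from gDR_punctured[OF Tl this R] obtain r where
        r: "r > 0" "\<And>m. 0 < cmod m \<Longrightarrow> cmod m < r \<Longrightarrow> in_class_on R UNIV (shiftop T (l + m))" by auto
      have "l \<in> frontier (sigma_cls R T)" unfolding sigma_cls_def
        using isolated_in_frontier[of r "\<lambda>z. in_class_on R UNIV (shiftop T z)" l] r l by (simp add: sigma_cls_def)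
      then have "l islimpt sigma_cls R T" using acc by (auto simp: acc_def)
      then show False unfolding sigma_cls_def
        using punctured_nbhd_not_limpt[of r "\<lambda>z. in_class_on R UNIV (shiftop T z)" l] r by blast
    qed
  qed
qed

theorem theorem3p20:
  fixes T :: "'a::complex_banach \<Rightarrow> 'a"
  assumes inf_dim: "\<not> fin_cdim (UNIV :: 'a set)"
    and T: "bounded_clinear T"
  shows
   "(\<forall>R \<in> {BPlus, BMinus, B, PhiPlus, PhiMinus, Phi, WPlus, WMinus, W}.
      frontier (sigma_cls R T) \<subseteq> acc (sigma_cls R T) \<longrightarrow>
        frontier (sigma_cls R T) \<subseteq> sigma_gKR T \<and> sigma_gKR T \<subseteq> sigma_gK T \<and>
        sigma_gK T \<subseteq> sigma_Kt T \<and> sigma_Kt T \<subseteq> sigma_eK T \<and> sigma_eK T \<subseteq> sigma_cls R T \<and>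
        sigma_gK T \<subseteq> sigma_gDR R T \<and> sigma_gDR R T \<subseteq> sigma_cls R T \<and>
        eta (sigma_cls R T) = eta (sigma_gKR T) \<and> eta (sigma_gKR T) = eta (sigma_gK T) \<and>
        eta (sigma_gK T) = eta (sigma_Kt T) \<and> eta (sigma_Kt T) = eta (sigma_eK T) \<and>
        eta (sigma_eK T) = eta (sigma_gDR R T))
  \<and> (\<forall>(R, R') \<in> {(BoundedBelow, BPlus), (Surjective, BMinus), (Invertible, B)}.
      frontier (sigma_cls R T) \<subseteq> acc (sigma_cls R' T) \<longrightarrow>
        frontier (sigma_cls R T) \<subseteq> sigma_gKR T \<and> sigma_gKR T \<subseteq> sigma_gK T \<and>
        sigma_gK T \<subseteq> sigma_Kt T \<and> sigma_Kt T \<subseteq> sigma_eK T \<and> sigma_eK T \<subseteq> sigma_K T \<and>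
        sigma_K T \<subseteq> sigma_cls R T \<and>
        eta (sigma_cls R T) = eta (sigma_gKR T) \<and> eta (sigma_gKR T) = eta (sigma_gK T) \<and>
        eta (sigma_gK T) = eta (sigma_Kt T) \<and> eta (sigma_Kt T) = eta (sigma_eK T) \<and>
        eta (sigma_eK T) = eta (sigma_K T) \<and> eta (sigma_K T) = eta (sigma_gDR R T))"
proof (intro conjI ballI, goal_cases)
  case R: (1 R)
  show ?case
  proof (rule impI, goal_cases)
    case acc: 1
    have "class_pair R R" using R by (simp only: class_pair_def simp_thms)
    from frontier_subset_sigma_gKR[OF T this acc]
    have fr: "frontier (sigma_cls R T) \<subseteq> sigma_gKR T" .
    note ch = sigma_chain[OF T] sigma_eK_subset[OF T R] sigma_gDR_eq[OF T R acc]
    \<comment> \<open>In part (a) \<open>sigma_gDR R T\<close> is all of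
      \<open>sigma_cls R T\<close> under the boundary hypothesis, so this inclusion follows from the
      chain through \<open>sigma_eK T\<close>.\<close>
    have sub: "sigma_gK T \<subseteq> sigma_gDR R T" using ch by blast
    \<comment> \<open>Every set in the chain contains \<open>sigma_gKR T\<close>, hence the
      boundary, and is contained in \<open>sigma_cls R T\<close>, so one sandwich argument gives all
      hulls.\<close>
    have "eta H = eta (sigma_cls R T)" if "sigma_gKR T \<subseteq> H" "H \<subseteq> sigma_cls R T" for H
      using eta_eq[OF bounded_sigma_cls[OF T], of R H] fr that by blast
    then have "eta (sigma_gKR T) = eta (sigma_cls R T)" "eta (sigma_gK T) = eta (sigma_cls R T)"
      "eta (sigma_Kt T) = eta (sigma_cls R T)" "eta (sigma_eK T) = eta (sigma_cls R T)"
      using ch by (meson order_trans order_refl)+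
    then show ?case using fr ch sub by simp
  qed
next
  case (2 RR)
  obtain R R' where RR: "RR = (R, R')" by (cases RR)
  have p: "class_pair R R'" and R: "R \<in> {BoundedBelow, Surjective, Invertible}"
    using 2 by (auto simp: RR class_pair_def)
  show ?case unfolding RR prod.case
  proof (rule impI, goal_cases)
    case acc: 1
    from frontier_subset_sigma_gKR[OF T p acc]
    have fr: "frontier (sigma_cls R T) \<subseteq> sigma_gKR T" .
    note ch = sigma_chain[OF T] sigma_K_subset[OF T R]
    have "eta H = eta (sigma_cls R T)" if "sigma_gKR T \<subseteq> H" "H \<subseteq> sigma_cls R T" for H
      using eta_eq[OF bounded_sigma_cls[OF T], of R H] fr that by blast
    then have "eta (sigma_gKR T) = eta (sigma_cls R T)" "eta (sigma_gK T) = eta (sigma_cls R T)"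
      "eta (sigma_Kt T) = eta (sigma_cls R T)" "eta (sigma_eK T) = eta (sigma_cls R T)"
      "eta (sigma_K T) = eta (sigma_cls R T)" "eta (sigma_gDR R T) = eta (sigma_cls R T)"
      using ch by (meson order_trans order_refl)+
    then show ?case using fr ch by simp
  qed
qed

end
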